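(* Each proper Buchsteiner loop of order $32$ can be obtained by the doubling construction. That is, if $P$ is a Buchsteiner loop of order $32$ that is not conjugacy closed, then there exist a Buchsteiner loop $Q$, normal subloops $A,S$ of $Q$, an element $d\in N(Q)$ and a mapping $q:Q\to A$ satisfying the conditions of the doubling construction (listed in the context) such that $P\cong Q[d,q,z]$.
   Context: A Buchsteiner loop is a loop satisfying $x\backslash (xy\cdot z) = (y\cdot zx)/x$ for all $x,y,z$, where $\backslash$ and $/$ are left and right division. A Buchsteiner loop is proper if it is not conjugacy closed; a loop is conjugacy closed if for all $x,y$ the conjugate $L_xL_yL_x^{-1}$ is a left translation and $R_xR_yR_x^{-1}$ is a right translation, where $L_x(y)=xy$, $R_x(y)=yx$. The nucleus $N(Q)$ is the set of all $a$ such that $a(xy)=(ax)y$, $x(ay)=(xa)y$ and $x(ya)=(xy)a$ for all $x,y\in Q$; the centre $Z(Q)$ is the set of elements of $N(Q)$ commuting with all elements of $Q$. The commutator $[x,y]$ is defined by $yx\cdot[x,y]=xy$. A boolean group is a group in which $g^2=1$ for all $g$. Doubling construction. Let $Q$ be a loop with normal subloops $A$ and $S$, let $d\in N(Q)$, and let $q:Q\to A$ be a mapping. Put $\varphi(u)=[d,u]$ and $g(u,v)=q(vu)q(u)q(v)$ for $u,v\in Q$. Assume $\varphi(u)\in A$ for all $u \in Q$ and: (1) $A$ and $Q/S$ are boolean groups, and $A\le S\cap Z(Q)$; (2) $q(ua)=q(u)$ for all $u\in Q$, $a\in A$; (3) $g(u,vw)=g(u,v)g(u,w)$ and $g(vw,u)=g(v,u)g(w,u)$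 for all $u,v,w\in Q$; (4) $g(us,vt)=g(u,v)$ for all $u,v\in Q$, $s,t\in S$; (5) $\varphi(uv)=\varphi(u)\varphi(v)$ for all $u,v\in Q$; (6) $\varphi(us)=\varphi(u)$ for all $u\in Q$, $s\in S$; (7) $q(du)=q(d)q(u)$ for all $u\in Q$. Then $Q[d,q,z]$ is the loop on the disjoint union $Q\cup zQ$ ($z\notin Q$, $zQ=\{zu:u\in Q\}$ a formal copy of $Q$) with operation given for $u,v\in Q$ by $u*v=uv$, $u*zv=z\cdot(uv\,q(u)g(u,v)g(v,u))$, $zu*v=z\cdot(uv\,g(u,v))$, $zu*zv=d\,uv\,\varphi(v)q(u)g(v,u)$. *)

theory Defs
  imports "HOL-Algebra.Coset" "HOL-Algebra.Bij"
begin

text \<open>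
  Loops are carried by the \<open>monoid\<close> records of HOL-Algebra, which provide the carrier, the
  multiplication and the neutral element without imposing associativity. The notions
  \<open>order\<close>, \<open>\<cong>\<close>, cosets and \<open>Mod\<close> are likewise defined for arbitrary records.
\<close>

locale loop =
  fixes Q (structure)
  assumes m_closed: "\<lbrakk>x \<in> carrier Q; y \<in> carrier Q\<rbrakk> \<Longrightarrow> x \<otimes> y \<in> carrier Q"
    and one_closed: "\<one> \<in> carrier Q"
    and l_one: "x \<in> carrier Q \<Longrightarrow> \<one> \<otimes> x = x"
    and r_one: "x \<in> carrier Q \<Longrightarrow> x \<otimes> \<one> = x"
    and ldiv_ex1: "\<lbrakk>x \<in> carrier Q; y \<in> carrier Q\<rbrakk> \<Longrightarrow> \<exists>!w. w \<in> carrier Q \<and> x \<otimes> w = y"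
    and rdiv_ex1: "\<lbrakk>x \<in> carrier Q; y \<in> carrier Q\<rbrakk> \<Longrightarrow> \<exists>!w. w \<in> carrier Q \<and> w \<otimes> x = y"

text \<open>\<open>ldiv Q x y\<close> is $x\backslash y$ and \<open>rdiv Q y x\<close> is $y/x$.\<close>

definition ldiv :: "('a, 'b) monoid_scheme \<Rightarrow> 'a \<Rightarrow> 'a \<Rightarrow> 'a"
  where "ldiv Q x y = (THE w. w \<in> carrier Q \<and> x \<otimes>\<^bsub>Q\<^esub> w = y)"

definition rdiv :: "('a, 'b) monoid_scheme \<Rightarrow> 'a \<Rightarrow> 'a \<Rightarrow> 'a"
  where "rdiv Q y x = (THE w. w \<in> carrier Q \<and> w \<otimes>\<^bsub>Q\<^esub> x = y)"

locale buchsteiner_loop = loop +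
  assumes buchsteiner:
    "\<lbrakk>x \<in> carrier Q; y \<in> carrier Q; w \<in> carrier Q\<rbrakk>
      \<Longrightarrow> ldiv Q x ((x \<otimes> y) \<otimes> w) = rdiv Q (y \<otimes> (w \<otimes> x)) x"

text \<open>
  Translations are restricted to the carrier, since \<open>BijGroup\<close> consists of extensional functions.
\<close>

definition left_trans :: "('a, 'b) monoid_scheme \<Rightarrow> 'a \<Rightarrow> 'a \<Rightarrow> 'a"
  where "left_trans Q x = (\<lambda>y\<in>carrier Q. x \<otimes>\<^bsub>Q\<^esub> y)"

definition right_trans :: "('a, 'b) monoid_scheme \<Rightarrow> 'a \<Rightarrow> 'a \<Rightarrow> 'a"
  where "right_trans Q x = (\<lambda>y\<in>carrier Q. y \<otimes>\<^bsub>Q\<^esub> x)"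

definition conjugacy_closed :: "('a, 'b) monoid_scheme \<Rightarrow> bool"
  where "conjugacy_closed Q \<longleftrightarrow>
    (let B = BijGroup (carrier Q); L = left_trans Q; R = right_trans Q in
      \<forall>x\<in>carrier Q. \<forall>y\<in>carrier Q.
        L x \<otimes>\<^bsub>B\<^esub> L y \<otimes>\<^bsub>B\<^esub> inv\<^bsub>B\<^esub> (L x) \<in> L ` carrier Q \<and>
        R x \<otimes>\<^bsub>B\<^esub> R y \<otimes>\<^bsub>B\<^esub> inv\<^bsub>B\<^esub> (R x) \<in> R ` carrier Q)"

definition nucleus :: "('a, 'b) monoid_scheme \<Rightarrow> 'a set"
  where "nucleus Q = {a \<in> carrier Q. \<forall>x\<in>carrier Q. \<forall>y\<in>carrier Q.
    a \<otimes>\<^bsub>Q\<^esub> (x \<otimes>\<^bsub>Q\<^esub> y) = (a \<otimes>\<^bsub>Q\<^esub> x) \<otimes>\<^bsub>Q\<^esub> y \<and>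
    x \<otimes>\<^bsub>Q\<^esub> (a \<otimes>\<^bsub>Q\<^esub> y) = (x \<otimes>\<^bsub>Q\<^esub> a) \<otimes>\<^bsub>Q\<^esub> y \<and>
    x \<otimes>\<^bsub>Q\<^esub> (y \<otimes>\<^bsub>Q\<^esub> a) = (x \<otimes>\<^bsub>Q\<^esub> y) \<otimes>\<^bsub>Q\<^esub> a}"

definition loop_centre :: "('a, 'b) monoid_scheme \<Rightarrow> 'a set"
  where "loop_centre Q = {a \<in> nucleus Q. \<forall>x\<in>carrier Q. a \<otimes>\<^bsub>Q\<^esub> x = x \<otimes>\<^bsub>Q\<^esub> a}"

definition loop_commutator :: "('a, 'b) monoid_scheme \<Rightarrow> 'a \<Rightarrow> 'a \<Rightarrow> 'a"
  where "loop_commutator Q x y = ldiv Q (y \<otimes>\<^bsub>Q\<^esub> x) (x \<otimes>\<^bsub>Q\<^esub> y)"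

definition subloop :: "'a set \<Rightarrow> ('a, 'b) monoid_scheme \<Rightarrow> bool"
  where "subloop H Q \<longleftrightarrow> H \<subseteq> carrier Q \<and> \<one>\<^bsub>Q\<^esub> \<in> H \<and>
    (\<forall>x\<in>H. \<forall>y\<in>H. x \<otimes>\<^bsub>Q\<^esub> y \<in> H \<and> ldiv Q x y \<in> H \<and> rdiv Q y x \<in> H)"

text \<open>
  The three coset equations state invariance of \<open>H\<close> under the standard generators
  $R_x^{-1}L_x$, $L_{xy}^{-1}L_xL_y$ and $R_{xy}^{-1}R_yR_x$ of the inner mapping group.
\<close>

definition normal_subloop :: "'a set \<Rightarrow> ('a, 'b) monoid_scheme \<Rightarrow> bool"
  where "normal_subloop H Q \<longleftrightarrow> subloop H Q \<and>
    (\<forall>x\<in>carrier Q. x <#\<^bsub>Q\<^esub> H = H #>\<^bsub>Q\<^esub> x) \<and>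
    (\<forall>x\<in>carrier Q. \<forall>y\<in>carrier Q.
      x <#\<^bsub>Q\<^esub> (y <#\<^bsub>Q\<^esub> H) = (x \<otimes>\<^bsub>Q\<^esub> y) <#\<^bsub>Q\<^esub> H \<and>
      (H #>\<^bsub>Q\<^esub> x) #>\<^bsub>Q\<^esub> y = H #>\<^bsub>Q\<^esub> (x \<otimes>\<^bsub>Q\<^esub> y))"

definition boolean_group :: "('a, 'b) monoid_scheme \<Rightarrow> bool"
  where "boolean_group G \<longleftrightarrow> group G \<and> (\<forall>x\<in>carrier G. x \<otimes>\<^bsub>G\<^esub> x = \<one>\<^bsub>G\<^esub>)"

definition dbl_phi :: "('a, 'b) monoid_scheme \<Rightarrow> 'a \<Rightarrow> 'a \<Rightarrow> 'a"
  where "dbl_phi Q d u = loop_commutator Q d u"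

definition dbl_g :: "('a, 'b) monoid_scheme \<Rightarrow> ('a \<Rightarrow> 'a) \<Rightarrow> 'a \<Rightarrow> 'a \<Rightarrow> 'a"
  where "dbl_g Q q u v = q (v \<otimes>\<^bsub>Q\<^esub> u) \<otimes>\<^bsub>Q\<^esub> q u \<otimes>\<^bsub>Q\<^esub> q v"

locale doubling_data = loop Q for Q (structure) +
  fixes A S :: "'a set" and d :: 'a and q :: "'a \<Rightarrow> 'a"
  assumes A_normal: "normal_subloop A Q"
    and S_normal: "normal_subloop S Q"
    and d_nucleus: "d \<in> nucleus Q"
    and q_maps: "q \<in> carrier Q \<rightarrow> A"
    and phi_in_A: "\<forall>u\<in>carrier Q. dbl_phi Q d u \<in> A"
    and A_boolean: "boolean_group (Q\<lparr>carrier := A\<rparr>)"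
    and quot_boolean: "boolean_group (Q Mod S)"
    and A_sub: "A \<subseteq> S \<inter> loop_centre Q"
    and q_mod_A: "\<forall>u\<in>carrier Q. \<forall>a\<in>A. q (u \<otimes> a) = q u"
    and g_add_right: "\<forall>u\<in>carrier Q. \<forall>v\<in>carrier Q. \<forall>w\<in>carrier Q.
      dbl_g Q q u (v \<otimes> w) = dbl_g Q q u v \<otimes> dbl_g Q q u w"
    and g_add_left: "\<forall>u\<in>carrier Q. \<forall>v\<in>carrier Q. \<forall>w\<in>carrier Q.
      dbl_g Q q (v \<otimes> w) u = dbl_g Q q v u \<otimes> dbl_g Q q w u"
    and g_mod_S: "\<forall>u\<in>carrier Q. \<forall>v\<in>carrier Q. \<forall>s\<in>S. \<forall>t\<in>S.
      dbl_g Q q (u \<otimes> s) (v \<otimes> t) = dbl_g Q q u v"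
    and phi_mult: "\<forall>u\<in>carrier Q. \<forall>v\<in>carrier Q. dbl_phi Q d (u \<otimes> v) = dbl_phi Q d u \<otimes> dbl_phi Q d v"
    and phi_mod_S: "\<forall>u\<in>carrier Q. \<forall>s\<in>S. dbl_phi Q d (u \<otimes> s) = dbl_phi Q d u"
    and q_d: "\<forall>u\<in>carrier Q. q (d \<otimes> u) = q d \<otimes> q u"

text \<open>
  In the disjoint union $Q\cup zQ$, \<open>Inl u\<close> stands for $u$ and \<open>Inr u\<close> for $zu$.
\<close>

fun doubling_mult ::
  "('a, 'b) monoid_scheme \<Rightarrow> 'a \<Rightarrow> ('a \<Rightarrow> 'a) \<Rightarrow> 'a + 'a \<Rightarrow> 'a + 'a \<Rightarrow> 'a + 'a"
  where
    "doubling_mult Q d q (Inl u) (Inl v) = Inl (u \<otimes>\<^bsub>Q\<^esub> v)"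
  | "doubling_mult Q d q (Inl u) (Inr v) =
      Inr (u \<otimes>\<^bsub>Q\<^esub> v \<otimes>\<^bsub>Q\<^esub> q u \<otimes>\<^bsub>Q\<^esub> dbl_g Q q u v \<otimes>\<^bsub>Q\<^esub> dbl_g Q q v u)"
  | "doubling_mult Q d q (Inr u) (Inl v) = Inr (u \<otimes>\<^bsub>Q\<^esub> v \<otimes>\<^bsub>Q\<^esub> dbl_g Q q u v)"
  | "doubling_mult Q d q (Inr u) (Inr v) =
      Inl (d \<otimes>\<^bsub>Q\<^esub> (u \<otimes>\<^bsub>Q\<^esub> v) \<otimes>\<^bsub>Q\<^esub> dbl_phi Q d v \<otimes>\<^bsub>Q\<^esub> q u \<otimes>\<^bsub>Q\<^esub> dbl_g Q q v u)"

definition doubling :: "('a, 'b) monoid_scheme \<Rightarrow> 'a \<Rightarrow> ('a \<Rightarrow> 'a) \<Rightarrow> ('a + 'a) monoid"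
  where "doubling Q d q =
    \<lparr>carrier = carrier Q <+> carrier Q, mult = doubling_mult Q d q, one = Inl \<one>\<^bsub>Q\<^esub>\<rparr>"

end

theory Submission
  imports Defs "HOL-Library.Z2" "HOL-Library.Function_Algebras" "HOL-Algebra.FiniteProduct"
    "HOL-Algebra.Elementary_Groups"
begin

text \<open>Write \<open>N\<close> for the nucleus of the loop \<open>P\<close>. The Buchsteiner law
  says that every \<open>(L_x, R_x^{-1}, L_x R_x^{-1})\<close> is an autotopism. Hence associators
  rotate, the left, middle and right nuclei coincide, and \<open>N\<close> is invariant under
  conjugation. The proof has three stages.

  Every associator of a Buchsteiner loop of order 32 is nuclear
  (\<open>buchsteiner_ass_nuc_32\<close>). This is an induction over orders that are powers of two.
  If \<open>N\<close> is trivial, the loop is a group (\<open>group_if_nuc_trivial\<close>).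
  Otherwise a class-equation count gives a central involution \<open>k\<close>
  (\<open>central_involution\<close>), and by induction the loop modulo \<open>k\<close> has nuclear
  associators. Upstairs, the failure of the associator of \<open>x, y, z\<close> to be nuclear is
  then a bit \<open>tt x y z u v\<close>. The pentagon and the rotation rule for associators hold up
  to such bits. Carrying the bits through a formal derivation leaves a linear relation among them,
  and a sum of nine instances of this relation forces the bit to vanish (\<open>t_zero\<close>,
  \<open>central_ext.ass_nuc\<close>).

  Once associators are nuclear, the same calculus is exact. It yields the multiplication rule
  \<open>ass_mul1\<close>, the symmetries \<open>ass_swap\<close>, and nuclear commutators, so
  \<open>P/N\<close> is an abelian group. If the associator is symmetric in its first two arguments,
  then \<open>P\<close> is conjugacy closed (\<open>conjugacy_closed_copy\<close>). That symmetry
  holds when \<open>P/N\<close> has at most four elements (\<open>ass_sym_if_small\<close>) and when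
  conjugation is trivial on \<open>N\<close> (\<open>ass_sym_if_central\<close>). A proper
  \<open>P\<close> of order 32 therefore has \<open>N\<close> of order exactly 4 and
  \<open>P/N\<close> of order 8 (\<open>four_nucleus_if_proper\<close>).

  Now let \<open>N\<close> consist of 1, \<open>k\<close>, \<open>n\<close> and \<open>nk\<close>.
  All associators are powers of \<open>k\<close> (\<open>F_zero\<close>), so their exponents form a
  cyclically invariant trilinear form \<open>\<beta>\<close>, and \<open>P/N\<close> is elementary
  abelian. Commutators modulo \<open>k\<close> form an alternating form on this three-dimensional
  space, which must have a nonzero radical; let \<open>z\<close> represent a radical element
  (\<open>radical\<close>). Take a subloop \<open>H\<close> of index two that contains
  \<open>N\<close> but not \<open>z\<close> (\<open>complement\<close>). With
  \<open>A = {1, k}\<close>, \<open>S = N\<close>, \<open>d = z z\<close> and \<open>q(u)\<close>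
  the commutator of \<open>u\<close> with \<open>z\<close>, the functions of the construction become
  \<open>g(u,v) = \<beta>(z,u,v)\<close> and \<open>\<phi>(v) = \<beta>(z,z,v)\<close> as exponents
  of \<open>k\<close>. Multiplying out in \<open>H\<close> and \<open>zH\<close> reproduces the
  doubling formulas.\<close>

section \<open>Loops as total operations on a type: nucleus, autotopisms, inner mappings\<close>

locale total_loop =
  fixes mul :: "'q \<Rightarrow> 'q \<Rightarrow> 'q"  (infixl \<open>\<cdot>\<close> 70)
    and ld :: "'q \<Rightarrow> 'q \<Rightarrow> 'q"  (infixl \<open>\<setminus>\<close> 70)
    and rd :: "'q \<Rightarrow> 'q \<Rightarrow> 'q"  (infixl \<open>\<oslash>\<close> 70)
    and e :: 'q  (\<open>\<epsilon>\<close>)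
  assumes mul_ld [simp]: "x \<cdot> (x \<setminus> y) = y"
    and ld_mul [simp]: "x \<setminus> (x \<cdot> y) = y"
    and rd_mul [simp]: "(y \<oslash> x) \<cdot> x = y"
    and mul_rd [simp]: "(y \<cdot> x) \<oslash> x = y"
    and mul_e [simp]: "x \<cdot> \<epsilon> = x"
    and e_mul [simp]: "\<epsilon> \<cdot> x = x"
begin

lemma mul_lcancel [simp]: "x \<cdot> y = x \<cdot> z \<longleftrightarrow> y = z" by (metis ld_mul)
lemma mul_rcancel [simp]: "y \<cdot> x = z \<cdot> x \<longleftrightarrow> y = z" by (metis mul_rd)
lemma ld_eq_iff: "x \<setminus> y = z \<longleftrightarrow> y = x \<cdot> z" by (metis ld_mul mul_ld)
lemma rd_eq_iff: "y \<oslash> x = z \<longleftrightarrow> y = z \<cdot> x" by (metis mul_rd rd_mul)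
lemma ld_self [simp]: "x \<setminus> x = \<epsilon>" by (simp add: ld_eq_iff)
lemma rd_self [simp]: "x \<oslash> x = \<epsilon>" by (simp add: rd_eq_iff)
lemma e_ld [simp]: "\<epsilon> \<setminus> x = x" by (simp add: ld_eq_iff)
lemma rd_e [simp]: "x \<oslash> \<epsilon> = x" by (simp add: rd_eq_iff)
lemma mul_eq_left [simp]: "x \<cdot> y = x \<longleftrightarrow> y = \<epsilon>" by (metis mul_e mul_lcancel)
lemma mul_eq_right [simp]: "y \<cdot> x = x \<longleftrightarrow> y = \<epsilon>" by (metis e_mul mul_rcancel)

definition nuc :: "'q set" where
  "nuc = {a. \<forall>x y. (a \<cdot> x) \<cdot> y = a \<cdot> (x \<cdot> y) \<and> (x \<cdot> a) \<cdot> y = x \<cdot> (a \<cdot> y) \<and> (x \<cdot> y) \<cdot> a = x \<cdot> (y \<cdot> a)}"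

lemma nucD:
  assumes "a \<in> nuc"
  shows "(a \<cdot> x) \<cdot> y = a \<cdot> (x \<cdot> y)" "(x \<cdot> a) \<cdot> y = x \<cdot> (a \<cdot> y)" "(x \<cdot> y) \<cdot> a = x \<cdot> (y \<cdot> a)"
  using assms by (auto simp: nuc_def)

lemma e_nuc [simp]: "\<epsilon> \<in> nuc" by (simp add: nuc_def)

lemma nuc_mul: assumes "a \<in> nuc" "b \<in> nuc" shows "a \<cdot> b \<in> nuc"
proof -
  have "x \<cdot> y \<cdot> (a \<cdot> b) = x \<cdot> (y \<cdot> (a \<cdot> b))" for x y
    by (metis nucD(3)[OF assms(2)] nucD(3)[OF assms(1)])
  moreover have "x \<cdot> (a \<cdot> b) \<cdot> y = x \<cdot> (a \<cdot> b \<cdot> y)" for x y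
    by (metis nucD[OF assms(2)] nucD[OF assms(1)])
  moreover have "a \<cdot> b \<cdot> x \<cdot> y = a \<cdot> b \<cdot> (x \<cdot> y)" for x y
    by (metis nucD[OF assms(2)] nucD[OF assms(1)])
  ultimately show ?thesis unfolding nuc_def by simp
qed

text \<open>The defining equation of an autotopism, applied below to composites of translations and
  divisions.\<close>

definition atp :: "('q \<Rightarrow> 'q) \<Rightarrow> ('q \<Rightarrow> 'q) \<Rightarrow> ('q \<Rightarrow> 'q) \<Rightarrow> bool" where
  "atp F G H \<longleftrightarrow> (\<forall>u v. F u \<cdot> G v = H (u \<cdot> v))"

lemma atp_comp: "atp F G H \<Longrightarrow> atp F' G' H' \<Longrightarrow> atp (\<lambda>u. F (F' u)) (\<lambda>u. G (G' u)) (\<lambda>u. H (H' u))"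
  by (simp add: atp_def)

text \<open>The left inner mapping \<open>L_{xy}^{-1} L_x L_y\<close>.\<close>

definition linn :: "'q \<Rightarrow> 'q \<Rightarrow> 'q \<Rightarrow> 'q" where
  "linn x y z = (x \<cdot> y) \<setminus> (x \<cdot> (y \<cdot> z))"

lemma linn_eq: "(x \<cdot> y) \<cdot> linn x y z = x \<cdot> (y \<cdot> z)" by (simp add: linn_def)
lemma linn_e [simp]: "linn x y \<epsilon> = \<epsilon>" by (simp add: linn_def)

end

section \<open>Buchsteiner loops; those with trivial nucleus are groups\<close>

locale total_buchsteiner = total_loop mul ld rd e
  for mul :: "'q \<Rightarrow> 'q \<Rightarrow> 'q"  (infixl \<open>\<cdot>\<close> 70)
    and ld :: "'q \<Rightarrow> 'q \<Rightarrow> 'q"  (infixl \<open>\<setminus>\<close> 70)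
    and rd :: "'q \<Rightarrow> 'q \<Rightarrow> 'q"  (infixl \<open>\<oslash>\<close> 70)
    and e :: 'q  (\<open>\<epsilon>\<close>) +
  assumes buch: "x \<setminus> ((x \<cdot> y) \<cdot> z) = (y \<cdot> (z \<cdot> x)) \<oslash> x"
begin

text \<open>Each side of the Buchsteiner law equals \<open>y \<cdot> z\<close> exactly when the
  corresponding triple associates.\<close>

lemma assoc_rot: "(x \<cdot> y) \<cdot> z = x \<cdot> (y \<cdot> z) \<longleftrightarrow> (y \<cdot> z) \<cdot> x = y \<cdot> (z \<cdot> x)"
  using buch[of x y z] by (metis ld_mul mul_ld mul_rd rd_mul)

text \<open>By rotation the left, middle and right nuclei coincide, so any one of the three
  conditions gives membership.\<close>

lemma nucI1: assumes "\<And>x y. (a \<cdot> x) \<cdot> y = a \<cdot> (x \<cdot> y)" shows "a \<in> nuc"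
  unfolding nuc_def using assms assoc_rot by blast

lemma nucI2: assumes "\<And>x y. (x \<cdot> a) \<cdot> y = x \<cdot> (a \<cdot> y)" shows "a \<in> nuc"
  unfolding nuc_def using assms assoc_rot by blast

lemma nucI3: assumes "\<And>x y. (x \<cdot> y) \<cdot> a = x \<cdot> (y \<cdot> a)" shows "a \<in> nuc"
  unfolding nuc_def using assms assoc_rot by blast

text \<open>The Buchsteiner law in the form in which it can be composed:
  \<open>(L_x, R_x^{-1}, L_x R_x^{-1})\<close> is an autotopism.\<close>

lemma atp_L: "atp (\<lambda>u. x \<cdot> u) (\<lambda>v. v \<oslash> x) (\<lambda>w. x \<cdot> (w \<oslash> x))"
  unfolding atp_def using buch[of x] by (metis mul_ld rd_mul)

lemma atp_Linv: "atp (\<lambda>u. x \<setminus> u) (\<lambda>v. v \<cdot> x) (\<lambda>w. (x \<setminus> w) \<cdot> x)"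
  unfolding atp_def using buch[of x] by (metis mul_ld rd_mul)

text \<open>Two uses of the law express left inner mappings by right translations as well. So
  \<open>linn\<close> and its inverse \<open>linn'\<close> both occur as components of composites of
  the autotopisms \<open>atp_L\<close> and \<open>atp_Linv\<close>.\<close>

lemma linn_R: "linn x y z = ((z \<cdot> (x \<cdot> y)) \<oslash> y) \<oslash> x"
proof -
  have "linn x y z = (y \<setminus> ((y \<cdot> z) \<cdot> x)) \<oslash> x"
  proof -
    let ?w = "(y \<setminus> ((y \<cdot> z) \<cdot> x)) \<oslash> x"
    have "y \<cdot> (?w \<cdot> x) = (y \<cdot> z) \<cdot> x" by simp
    hence "x \<setminus> ((x \<cdot> y) \<cdot> ?w) = y \<cdot> z" using buch[of x y ?w] by simp
    hence "(x \<cdot> y) \<cdot> ?w = x \<cdot> (y \<cdot> z)" by (metis mul_ld)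
    thus ?thesis by (simp add: linn_def ld_eq_iff)
  qed
  moreover have "y \<setminus> ((y \<cdot> z) \<cdot> x) = (z \<cdot> (x \<cdot> y)) \<oslash> y" by (rule buch)
  ultimately show ?thesis by simp
qed

definition linn' :: "'q \<Rightarrow> 'q \<Rightarrow> 'q \<Rightarrow> 'q" where
  "linn' x y z = ((z \<cdot> x) \<cdot> y) \<oslash> (x \<cdot> y)"

lemma linn_linn' [simp]: "linn x y (linn' x y z) = z"
  by (simp add: linn_R linn'_def)
lemma linn'_linn [simp]: "linn' x y (linn x y z) = z"
  by (simp add: linn_R linn'_def)
lemma linn'_L: "linn' x y z = y \<setminus> (x \<setminus> ((x \<cdot> y) \<cdot> z))"
proof -
  have "linn x y (y \<setminus> (x \<setminus> ((x \<cdot> y) \<cdot> z))) = z" by (simp add: linn_def)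
  thus ?thesis by (metis linn'_linn)
qed

text \<open>Companions: \<open>comp_r x y\<close> makes \<open>linn x y\<close> a right
  pseudo-automorphism, and \<open>comp_l x y\<close> makes its inverse a left one.\<close>

definition comp_r :: "'q \<Rightarrow> 'q \<Rightarrow> 'q" where "comp_r x y = ((\<epsilon> \<oslash> y) \<oslash> x) \<cdot> (x \<cdot> y)"
definition comp_l :: "'q \<Rightarrow> 'q \<Rightarrow> 'q" where "comp_l x y = (x \<cdot> y) \<cdot> (y \<setminus> (x \<setminus> \<epsilon>))"

text \<open>Composing the autotopisms of \<open>L_{xy}^{-1}\<close>, \<open>L_x\<close> and
  \<open>L_y\<close> gives one with first component \<open>linn x y\<close>. Putting
  \<open>\<epsilon>\<close> for one argument identifies the other two components.\<close>

lemma linn_comp_r: "linn x y u \<cdot> (linn x y v \<cdot> comp_r x y) = linn x y (u \<cdot> v) \<cdot> comp_r x y"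
proof -
  let ?p = "x \<cdot> y" and ?B = "\<lambda>v. ((v \<oslash> y) \<oslash> x) \<cdot> (x \<cdot> y)"
  obtain H where H: "atp (linn x y) ?B H"
    using atp_comp[OF atp_Linv[of ?p] atp_comp[OF atp_L[of x] atp_L[of y]]]
    unfolding linn_def by blast
  have a: "linn x y u \<cdot> ?B v = H (u \<cdot> v)" for u v using H by (simp add: atp_def)
  have "?B v = H v" for v using a[of \<epsilon> v] by simp
  moreover have "H v = linn x y v \<cdot> comp_r x y" for v using a[of v \<epsilon>] by (simp add: comp_r_def)
  ultimately show ?thesis using a by metis
qed

lemma linn'_comp_l: "(comp_l x y \<cdot> linn' x y u) \<cdot> linn' x y v = comp_l x y \<cdot> linn' x y (u \<cdot> v)"
proof -
  let ?p = "x \<cdot> y" and ?F = "\<lambda>u. (x \<cdot> y) \<cdot> (y \<setminus> (x \<setminus> u))"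
  obtain H where H: "atp ?F (linn' x y) H"
    using atp_comp[OF atp_L[of ?p] atp_comp[OF atp_Linv[of y] atp_Linv[of x]]]
    unfolding linn'_def by blast
  have a: "?F u \<cdot> linn' x y v = H (u \<cdot> v)" for u v using H by (simp add: atp_def)
  have "linn' x y \<epsilon> = \<epsilon>" by (simp add: linn'_def)
  hence "?F v = H v" for v using a[of v \<epsilon>] by simp
  moreover have "H v = comp_l x y \<cdot> linn' x y v" for v using a[of \<epsilon> v] by (simp add: comp_l_def)
  ultimately show ?thesis using a by metis
qed

lemma linn_comp_l: "linn x y (comp_l x y \<setminus> u) \<cdot> v = linn x y (comp_l x y \<setminus> (u \<cdot> linn' x y v))"
proof -
  have "(u) \<cdot> linn' x y v = comp_l x y \<cdot> linn' x y (linn x y (comp_l x y \<setminus> u) \<cdot> v)"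
    using linn'_comp_l[of x y "linn x y (comp_l x y \<setminus> u)" v] by simp
  thus ?thesis by simp
qed

text \<open>The left and right companion laws describe the same mapping. Any discrepancy between
  them is a map commuting with all left or all right translations, hence a translation by a nuclear
  element, hence trivial. It follows that \<open>comp_r x y\<close> commutes with everything, and
  the law then puts it into the middle nucleus.\<close>

lemma comp_trivial:
  assumes N: "nuc = {\<epsilon>}"
  shows "comp_r x y = \<epsilon>"
proof -
  let ?A = "linn x y" and ?A' = "linn' x y" and ?b = "comp_r x y" and ?c = "comp_l x y"
  have nuc1: "n = \<epsilon>" if "\<And>a w. (a \<cdot> w) \<cdot> n = a \<cdot> (w \<cdot> n)" for n
    using nucI3[of n] that N by blast
  \<comment> \<open>The candidates \<open>?m\<close> and \<open>?m'\<close> define the same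
    operation sending \<open>a, z\<close> to \<open>(a \<cdot> (z \<cdot> m)) \<oslash> m\<close>.
    So \<open>r\<close>, which divides by one and multiplies by the other, commutes with left
    translations.\<close>
  have I: "?A (?c \<setminus> s) = ?A s \<cdot> ?b" for s
  proof -
    let ?m = "?A (?c \<setminus> s)" and ?m' = "?A s \<cdot> ?b"
    have E1: "(?A u \<cdot> (z \<cdot> ?m)) \<oslash> ?m = ?A ((u \<cdot> (?A' z \<cdot> s)) \<oslash> s)" for u z
    proof -
      let ?w = "?A (s \<setminus> ((s \<cdot> u) \<cdot> ?A' z))"
      have "?m \<cdot> ?A u = ?A (?c \<setminus> (s \<cdot> u))" by (simp add: linn_comp_l)
      hence "(?m \<cdot> ?A u) \<cdot> z = ?A (?c \<setminus> ((s \<cdot> u) \<cdot> ?A' z))" by (simp add: linn_comp_l)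
      also have "\<dots> = ?m \<cdot> ?w" by (simp add: linn_comp_l)
      finally have "?m \<setminus> ((?m \<cdot> ?A u) \<cdot> z) = ?w" by simp
      thus ?thesis using buch[of ?m "?A u" z] buch[of s u "?A' z"] by simp
    qed
    have E2: "(?A u \<cdot> (z \<cdot> ?m')) \<oslash> ?m' = ?A ((u \<cdot> (?A' z \<cdot> s)) \<oslash> s)" for u z
    proof -
      have "z \<cdot> ?m' = ?A (?A' z \<cdot> s) \<cdot> ?b" using linn_comp_r[of x y "?A' z" s] by simp
      hence "?A u \<cdot> (z \<cdot> ?m') = ?A (u \<cdot> (?A' z \<cdot> s)) \<cdot> ?b" by (simp add: linn_comp_r)
      also have "\<dots> = ?A ((u \<cdot> (?A' z \<cdot> s)) \<oslash> s) \<cdot> ?m'" by (simp add: linn_comp_r)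
      finally show ?thesis by simp
    qed
    have E: "(a \<cdot> (z \<cdot> ?m)) \<oslash> ?m = (a \<cdot> (z \<cdot> ?m')) \<oslash> ?m'" for a z
      using E1[of "?A' a" z] E2[of "?A' a" z] by simp
    define r where "r w = (w \<oslash> ?m) \<cdot> ?m'" for w
    have r: "r (a \<cdot> w) = a \<cdot> r w" for a w
      using E[of a "w \<oslash> ?m"] by (simp add: r_def)
    have r1: "r a = a \<cdot> r \<epsilon>" for a using r[of a \<epsilon>] by simp
    have "r \<epsilon> = \<epsilon>" by (rule nuc1) (metis r r1)
    thus "?m = ?m'" by (metis r1 r_def mul_e rd_mul rd_self e_mul)
  qed
  \<comment> \<open>A composite autotopism whose middle component is the identity: its first
    component is left multiplication by a nuclear element.\<close>
  have II: "?A (?c \<cdot> w) = ?b \<setminus> ?A w" for w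
  proof -
    obtain H where H: "atp (\<lambda>u. ?b \<cdot> ?A (?c \<cdot> ?A' u)) (\<lambda>v. v) H"
    proof -
      have 1: "atp ?A (\<lambda>v. ?A v \<cdot> ?b) (\<lambda>v. ?A v \<cdot> ?b)" by (simp add: atp_def linn_comp_r)
      have 2: "atp (\<lambda>u. ?c \<cdot> ?A' u) ?A' (\<lambda>u. ?c \<cdot> ?A' u)" by (simp add: atp_def linn'_comp_l)
      show ?thesis using that atp_comp[OF atp_L[of ?b] atp_comp[OF 1 2]] by simp
    qed
    define F where "F u = ?b \<cdot> ?A (?c \<cdot> ?A' u)" for u
    have a: "F u \<cdot> v = H (u \<cdot> v)" for u v using H by (simp add: F_def atp_def)
    have FH: "F u = H u" for u using a[of u \<epsilon>] by simp
    have F1: "F u = F \<epsilon> \<cdot> u" for u using a[of \<epsilon> u] FH by simp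
    have "F \<epsilon> \<in> nuc" by (rule nucI1) (metis F1 FH a)
    hence "F \<epsilon> = \<epsilon>" using N by blast
    hence "F u = u" for u using F1[of u] by simp
    from this[of "?A w"] show ?thesis by (metis F_def ld_mul linn'_linn)
  qed
  \<comment> \<open>For \<open>s = ?A' a\<close>, I gives \<open>a \<cdot> ?b\<close> and II gives
    \<open>?b \<cdot> a\<close> as the value of \<open>?A (?c \<setminus> s)\<close>.\<close>
  have comm: "?b \<cdot> a = a \<cdot> ?b" for a
    using II[of "?c \<setminus> ?A' a"] I[of "?A' a"] by (metis mul_ld linn_linn')
  have "?b \<in> nuc"
  proof (rule nucI2)
    fix y z
    have "(?b \<cdot> y) \<cdot> ((z \<cdot> ?b) \<oslash> ?b) = ?b \<cdot> ((y \<cdot> (z \<cdot> ?b)) \<oslash> ?b)"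
      using atp_L[of ?b] unfolding atp_def by blast
    thus "(y \<cdot> ?b) \<cdot> z = y \<cdot> (?b \<cdot> z)" by (simp add: comm)
  qed
  thus ?thesis using N by blast
qed

inductive_set lmlt :: "('q \<Rightarrow> 'q) set" where
  id: "(\<lambda>u. u) \<in> lmlt"
| L: "f \<in> lmlt \<Longrightarrow> (\<lambda>u. x \<cdot> f u) \<in> lmlt"
| Linv: "f \<in> lmlt \<Longrightarrow> (\<lambda>u. x \<setminus> f u) \<in> lmlt"

lemma lmlt_comp: "f \<in> lmlt \<Longrightarrow> g \<in> lmlt \<Longrightarrow> (\<lambda>u. f (g u)) \<in> lmlt"
  by (induction rule: lmlt.induct) (auto intro: lmlt.intros)

text \<open>Conjugating \<open>L_w\<close> by \<open>R_z\<close> gives \<open>L_i^{-1} L_v\<close>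
  with \<open>i = z \<setminus> \<epsilon>\<close> and \<open>v = z \<setminus> w\<close>. So right
  translations normalise the left multiplication group \<open>lmlt\<close>.\<close>

lemma lmlt_conj_L: "(w \<cdot> (u \<oslash> z)) \<cdot> z = (z \<setminus> \<epsilon>) \<setminus> ((z \<setminus> w) \<cdot> u)"
proof -
  have 1: "(z \<setminus> (w \<cdot> v)) \<cdot> z = (z \<setminus> w) \<cdot> (v \<cdot> z)" for w v
    using buch[of z "z \<setminus> w" v] by (metis mul_ld rd_mul)
  have "(z \<setminus> \<epsilon>) \<cdot> ((w \<cdot> (u \<oslash> z)) \<cdot> z) = (z \<setminus> (w \<cdot> (u \<oslash> z))) \<cdot> z"
    using 1[of \<epsilon> "w \<cdot> (u \<oslash> z)"] by simp
  also have "\<dots> = (z \<setminus> w) \<cdot> u" using 1[of w "u \<oslash> z"] by simp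
  finally show ?thesis by (metis ld_mul)
qed

lemma lmlt_conj: "f \<in> lmlt \<Longrightarrow> (\<lambda>u. f (u \<oslash> z) \<cdot> z) \<in> lmlt"
proof (induction rule: lmlt.induct)
  case id thus ?case by (simp add: lmlt.id)
next
  case (L f x)
  have "(x \<cdot> f (u \<oslash> z)) \<cdot> z = (z \<setminus> \<epsilon>) \<setminus> ((z \<setminus> x) \<cdot> (f (u \<oslash> z) \<cdot> z))" for u
    using lmlt_conj_L[of x "f (u \<oslash> z) \<cdot> z" z] by simp
  thus ?case using lmlt.Linv[OF lmlt.L[OF L.IH]] by presburger
next
  case (Linv f x)
  have "(x \<setminus> f (u \<oslash> z)) \<cdot> z = (z \<setminus> x) \<setminus> ((z \<setminus> \<epsilon>) \<cdot> (f (u \<oslash> z) \<cdot> z))" for u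
    using lmlt_conj_L[of x "(x \<setminus> f (u \<oslash> z)) \<cdot> z" z] by (simp add: ld_eq_iff)
  thus ?case using lmlt.Linv[OF lmlt.L[OF Linv.IH]] by presburger
qed

text \<open>Without companions the left inner mappings are automorphisms, so every element of
  \<open>lmlt\<close> is a left translation after a multiplicative map. For
  \<open>a = z \<setminus> linn x y z\<close> the translation \<open>R_a\<close> also lies in
  \<open>lmlt\<close>. Hence \<open>L_a^{-1} R_a\<close>, which fixes \<open>\<epsilon>\<close>, is
  multiplicative, and this makes \<open>a\<close> nuclear. So \<open>a\<close> is trivial and
  \<open>linn x y\<close> fixes \<open>z\<close>.\<close>

lemma group_if_nuc_trivial:
  assumes N: "nuc = {\<epsilon>}"
  shows "(x \<cdot> y) \<cdot> z = x \<cdot> (y \<cdot> z)"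
proof -
  have aut: "linn x y (u \<cdot> v) = linn x y u \<cdot> linn x y v" for x y u v
    using linn_comp_r[of x y u v] by (simp add: comp_trivial[OF N])
  have aut': "linn x y (u \<setminus> v) = linn x y u \<setminus> linn x y v" for x y u v
    using aut[of x y u "u \<setminus> v"] by (simp add: ld_eq_iff)
  have lm: "\<exists>\<phi>. (\<forall>u v. \<phi> (u \<cdot> v) = \<phi> u \<cdot> \<phi> v) \<and> (\<forall>u. f u = f \<epsilon> \<cdot> \<phi> u)" if "f \<in> lmlt" for f
    using that
  proof (induction rule: lmlt.induct)
    case id thus ?case by (intro exI[of _ "\<lambda>u. u"]) simp
  next
    case (L f x)
    then obtain \<phi> where h: "\<And>u v. \<phi> (u \<cdot> v) = \<phi> u \<cdot> \<phi> v" and f: "\<And>u. f u = f \<epsilon> \<cdot> \<phi> u" by blast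
    have 1: "x \<cdot> f u = (x \<cdot> f \<epsilon>) \<cdot> linn x (f \<epsilon>) (\<phi> u)" for u
      by (subst f) (simp add: linn_eq)
    show ?case
      by (intro exI[of _ "\<lambda>u. linn x (f \<epsilon>) (\<phi> u)"] conjI allI) (simp add: h aut, rule 1)
  next
    case (Linv f x)
    then obtain \<phi> where h: "\<And>u v. \<phi> (u \<cdot> v) = \<phi> u \<cdot> \<phi> v" and f: "\<And>u. f u = f \<epsilon> \<cdot> \<phi> u" by blast
    let ?l = "linn' x (x \<setminus> f \<epsilon>)"
    have h': "?l (u \<cdot> v) = ?l u \<cdot> ?l v" for u v
      using aut[of x "x \<setminus> f \<epsilon>" "?l u" "?l v"] by (metis linn'_linn linn_linn')
    have "x \<cdot> ((x \<setminus> f \<epsilon>) \<cdot> ?l (\<phi> u)) = f \<epsilon> \<cdot> \<phi> u" for u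
      using linn_eq[of x "x \<setminus> f \<epsilon>" "?l (\<phi> u)"] by simp
    hence 1: "x \<setminus> f u = (x \<setminus> f \<epsilon>) \<cdot> ?l (\<phi> u)" for u using f by (metis ld_mul)
    show ?case by (intro exI[of _ "\<lambda>u. ?l (\<phi> u)"] conjI allI) (simp add: h h', rule 1)
  qed
  define a where "a = z \<setminus> linn x y z"
  have za: "z \<cdot> a = linn x y z" by (simp add: a_def)
  have lmA: "linn x y \<in> lmlt" for x y
    using lmlt.Linv[OF lmlt.L[OF lmlt.L[OF lmlt.id]]] unfolding linn_def[abs_def] by blast
  have lmA': "linn' x y \<in> lmlt" for x y
    using lmlt.Linv[OF lmlt.Linv[OF lmlt.L[OF lmlt.id]]] unfolding linn'_L[abs_def] by blast
  \<comment> \<open>The automorphism \<open>linn x y\<close> conjugates \<open>R_z\<close> to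
    \<open>R_{za}\<close>, and \<open>R_{za}\<close> after \<open>linn' z a\<close> is
    \<open>R_a R_z\<close>. Solving for \<open>R_a\<close> leaves only elements of
    \<open>lmlt\<close> and their conjugates by \<open>R_z\<close>.\<close>
  have Ra: "(\<lambda>u. u \<cdot> a) \<in> lmlt"
  proof -
    have "u \<cdot> a = linn x y (linn' x y ((linn' z a (u \<oslash> z) \<cdot> z) \<oslash> z) \<cdot> z)" for u
    proof -
      let ?w = "linn' z a (u \<oslash> z)"
      have "linn x y (linn' x y ?w \<cdot> z) = ?w \<cdot> (z \<cdot> a)" by (simp add: aut za)
      also have "\<dots> = u \<cdot> a" by (simp add: linn'_def)
      finally show ?thesis by simp
    qed
    thus ?thesis
      using lmlt_comp[OF lmA lmlt_comp[OF lmlt_conj[OF lmA'] lmlt_conj[OF lmA'[of z a], of z]], of x y x y z]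
      by presburger
  qed
  define j where "j u = a \<setminus> (u \<cdot> a)" for u
  obtain \<phi> where h: "\<And>u v. \<phi> (u \<cdot> v) = \<phi> u \<cdot> \<phi> v" and f: "\<And>u. j u = j \<epsilon> \<cdot> \<phi> u"
    using lm[OF lmlt.Linv[OF Ra, of a]] unfolding j_def by blast
  have jh: "j (u \<cdot> v) = j u \<cdot> j v" for u v using f h by (simp add: j_def)
  have aj: "a \<cdot> j u = u \<cdot> a" for u by (simp add: j_def)
  have ja: "j a = a" by (simp add: j_def)
  have flex: "(a \<cdot> u) \<cdot> a = a \<cdot> (u \<cdot> a)" for u
    using aj[of "a \<cdot> u"] by (simp add: jh ja aj)
  have flex': "a \<cdot> (w \<oslash> a) = (a \<cdot> w) \<oslash> a" for w
    using flex[of "w \<oslash> a"] by (metis mul_rd rd_mul)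
  \<comment> \<open>The autotopism of \<open>L_a\<close>, read through \<open>j\<close> and
    flexibility at \<open>a\<close>.\<close>
  have mid: "(u \<cdot> a) \<cdot> Z = u \<cdot> (a \<cdot> Z)" for u Z
  proof -
    have "(a \<cdot> j u) \<cdot> ((Z \<cdot> a) \<oslash> a) = a \<cdot> ((j u \<cdot> (Z \<cdot> a)) \<oslash> a)"
      using atp_L[of a] unfolding atp_def by blast
    moreover have "j (a \<cdot> Z) = Z \<cdot> a"
      using flex[of Z] by (simp add: j_def)
    ultimately have "(u \<cdot> a) \<cdot> Z = (a \<cdot> j (u \<cdot> (a \<cdot> Z))) \<oslash> a"
      by (simp add: aj jh flex')
    thus ?thesis by (simp add: aj)
  qed
  have "a \<in> nuc" using mid by (rule nucI2)
  hence "a = \<epsilon>" using N by blast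
  hence "linn x y z = z" using za by simp
  thus ?thesis using linn_eq[of x y z] by simp
qed

end

section \<open>Formal calculus of associators with error bits\<close>

locale associator_calculus =
  fixes mul :: "'q \<Rightarrow> 'q \<Rightarrow> 'q"  (infixl \<open>\<cdot>\<close> 70)
    and R :: "'e::ab_group_add set"
    and act :: "'q \<Rightarrow> 'e \<Rightarrow> 'e"
    and f :: "'q \<Rightarrow> 'q \<Rightarrow> 'q \<Rightarrow> 'e"
    and nu :: "'b::ab_group_add \<Rightarrow> 'e"
    and t :: "'q \<Rightarrow> 'q \<Rightarrow> 'q \<Rightarrow> 'q \<Rightarrow> 'q \<Rightarrow> 'b"
  assumes two: "(c::'b) + c = 0"
    and R_zero: "0 \<in> R"
    and R_diff: "a \<in> R \<Longrightarrow> b \<in> R \<Longrightarrow> a - b \<in> R"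
    and act_add: "act x (a + b) = act x a + act x b"
    and act_R: "act x a \<in> R \<longleftrightarrow> a \<in> R"
    and nu_R: "nu i + nu j - nu (i + j) \<in> R"
    and act_nu: "act x (nu i) - nu i \<in> R"
    and t1: "t (x \<cdot> x') y z u v = t x y z u v + t x' y z u v"
    and t_cyc: "t x y z u v = t y z x u v"
    and t4: "t x y z (u \<cdot> u') v = t x y z u v + t x y z u' v"
    and t5: "t x y z u (v \<cdot> v') = t x y z u v + t x y z u v'"
    and act_mul: "act (u \<cdot> v) (f x y z) - act v (act u (f x y z)) - nu (t x y z v u) \<in> R"
    and pentagon: "f x y (z \<cdot> u) + f (x \<cdot> y) z u - f y z u - f x (y \<cdot> z) u - act u (f x y z)
        - nu (t x y z u (x \<cdot> (y \<cdot> z)) + t x y z (x \<cdot> (y \<cdot> z)) u + t y z u x (y \<cdot> (z \<cdot> u))) \<in> R"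
    and rot: "f y z x + act x (f x y z) - nu (t x y z (y \<cdot> z) x) \<in> R"
begin

text \<open>The additive group modulo \<open>R\<close> stands for an abelian group containing the
  associators \<open>f\<close>, \<open>act\<close> for conjugation, and \<open>nu\<close> for the
  embedding of bits as powers of a central involution. \<open>D b d\<close> says that
  \<open>d\<close> vanishes up to the error \<open>b\<close>. As \<open>nu\<close> is additive and
  fixed by the action modulo \<open>R\<close>, errors add up along a derivation.\<close>

definition D :: "'b \<Rightarrow> 'e \<Rightarrow> bool" where "D b d \<longleftrightarrow> d - nu b \<in> R"

lemma two': "(c::'b) + (c + d) = d"
  using two[of c] by (simp add: add.assoc[symmetric])

lemma R_uminus: "a \<in> R \<Longrightarrow> - a \<in> R" using R_diff[OF R_zero, of a] by simp
lemma R_add: "a \<in> R \<Longrightarrow> b \<in> R \<Longrightarrow> a + b \<in> R" using R_diff[of a "- b"] R_uminus[of b] by simp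
lemma act_zero [simp]: "act x 0 = 0" using act_add[of x 0 0] by simp
lemma act_uminus: "act x (- a) = - act x a"
  using act_add[of x a "- a"] by (simp add: eq_neg_iff_add_eq_0 add.commute)
lemma act_diff: "act x (a - b) = act x a - act x b"
  using act_add[of x a "- b"] by (simp add: act_uminus)

lemma nu0: "nu 0 \<in> R" using nu_R[of 0 0] by simp
lemma nu_double: "nu b + nu b \<in> R" using R_add[OF nu_R[of b b] nu0] by (simp add: two)

lemma D_add: "D b d \<Longrightarrow> D b' d' \<Longrightarrow> D (b + b') (d + d')"
  unfolding D_def using R_add[OF R_add nu_R[of b b'], of "d - nu b" "d' - nu b'"]
  by (simp add: algebra_simps two two')
lemma D_uminus: "D b d \<Longrightarrow> D b (- d)"
  unfolding D_def using R_uminus[OF R_add[OF _ nu_double[of b]], of "d - nu b"]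
  by (simp add: algebra_simps two two')
lemma D_diff: "D b d \<Longrightarrow> D b' d' \<Longrightarrow> D (b + b') (d - d')"
  using D_add[of b d b' "- d'"] D_uminus[of b' d'] by simp
lemma D_act: "D b (act x d) \<longleftrightarrow> D b d"
proof -
  have "act x d - nu b = act x (d - nu b) + (act x (nu b) - nu b)" by (simp add: act_diff)
  thus ?thesis unfolding D_def by (metis act_R act_nu R_add R_diff add_diff_cancel)
qed
lemma D_actI: "D b d \<Longrightarrow> D b (act x d)" by (simp add: D_act)
lemma D_cong: "D b d \<Longrightarrow> d = d' \<Longrightarrow> b = b' \<Longrightarrow> D b' d'" by simp

lemma t2: "t x (y \<cdot> y') z u v = t x y z u v + t x y' z u v"
  by (metis t_cyc t1)
lemma t3: "t x y (z \<cdot> z') u v = t x y z u v + t x y z' u v"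
  by (metis t_cyc t1)
lemmas t_lin = t1 t2 t3 t4 t5
lemmas act_simps = act_add act_diff act_uminus

lemma Dmul: "D (t x y z v u) (act (u \<cdot> v) (f x y z) - act v (act u (f x y z)))"
  using act_mul by (simp add: D_def)

lemma Dpent: "D (t x y z u x + t x y z u y + t x y z u z + t x y z x u + t x y z y u + t x y z z u
      + t y z u x y + t y z u x z + t y z u x u)
    (f x y (z \<cdot> u) + f (x \<cdot> y) z u - f y z u - f x (y \<cdot> z) u - act u (f x y z))"
  using pentagon[of x y z u] by (simp add: D_def t_lin algebra_simps two two')

lemma Drot: "D (t x y z y x + t x y z z x) (f y z x + act x (f x y z))"
  using rot by (simp add: D_def t_lin)

lemma Drot2: "D (t x y z y x + t x y z z x + t x y z z y + t x y z x y)
    (f z x y - act y (act x (f x y z)))"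
  by (rule D_cong[OF D_diff[OF Drot[of y z x] D_actI[OF Drot[of x y z], of y]]])
    (simp_all add: act_simps t_cyc[of y z x] t_cyc[of z x y] algebra_simps two two')

lemma Drot3: "D (t x y z x y + t x y z x z + t x y z y x + t x y z y z + t x y z z x + t x y z z y)
    (f x y z + act z (act y (act x (f x y z))))"
  by (rule D_cong[OF D_diff[OF Drot[of z x y] D_actI[OF Drot2[of x y z], of z]]])
    (simp_all add: act_simps t_cyc[of z x y] algebra_simps two two')

text \<open>The pentagon with two of its terms rotated, so that every product stands in the first
  argument; \<open>b1\<close> collects the error.\<close>

definition T1 where "T1 x y z u = f (z \<cdot> u) x y + act y (act x (f (x \<cdot> y) z u)) - act y (act x (f y z u))
    - act y (act x (act u (f x y z))) + act y (f (y \<cdot> z) u x)"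

definition b1 where "b1 x y z u =
  (let w = z \<cdot> u in t x y w y x + t x y w w x + t x y w w y + t x y w x y)
  + (t x y z u x + t x y z u y + t x y z u z + t x y z x u + t x y z y u + t x y z z u
      + t y z u x y + t y z u x z + t y z u x u)
  + (let w = y \<cdot> z in t x w u w x + t x w u u x)"

lemma DT1: "D (b1 x y z u) (T1 x y z u)"
  unfolding b1_def Let_def
  by (rule D_cong[OF D_add[OF D_add[OF Drot2[of x y "z \<cdot> u"] D_actI[OF D_actI[OF Dpent[of x y z u], of x], of y]]
        D_actI[OF Drot[of x "y \<cdot> z" u], of y]]])
    (simp_all add: T1_def act_simps algebra_simps two two')

text \<open>\<open>T1 x y z u\<close>, moved by \<open>z\<close>, and \<open>T1 y z u x\<close>
  share the terms with products \<open>y \<cdot> z\<close> and \<open>z \<cdot> u\<close>. Their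
  difference retains only \<open>x \<cdot> y\<close> and \<open>u \<cdot> x\<close>.\<close>

lemma DT2: "D (b1 x y z u + b1 y z u x + (t x z u z x + t x z u u x)
   + (let p = u \<cdot> x in t p y z p y + t p y z p z + t p y z y p + t p y z y z + t p y z z p + t p y z z y + t p y z x u))
  (f (x \<cdot> y) z u - f x z u + act u (f (u \<cdot> x) y z) - act u (f x y z))"
proof -
  note D_add[OF D_diff[OF D_diff[OF D_actI[OF DT1[of x y z u], of z] DT1[of y z u x]]
      D_actI[OF D_actI[OF Drot[of x z u], of y], of z]]
      D_diff[OF Drot3[of "u \<cdot> x" y z] D_actI[OF D_actI[OF Dmul[of "u \<cdot> x" y z x u], of y], of z]]]
  hence "D (b1 x y z u + b1 y z u x + (t x z u z x + t x z u u x)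
      + ((let p = u \<cdot> x in t p y z p y + t p y z p z + t p y z y p + t p y z y z + t p y z z p + t p y z z y)
      + t (u \<cdot> x) y z x u))
     (act z (act y (act x (f (x \<cdot> y) z u - f x z u + act u (f (u \<cdot> x) y z) - act u (f x y z)))))"
    by (rule D_cong) (simp add: T1_def act_simps algebra_simps, simp add: Let_def add.assoc)
  thus ?thesis by (simp add: D_act Let_def add.assoc)
qed

text \<open>The deviation of \<open>f\<close> from additivity in its first argument.\<close>

definition Ebar where "Ebar x y z u = f (x \<cdot> y) z u - f x z u - f y z u"

definition b2 where "b2 x y z u = t x z u y u + t x z u y z + t u y z u x + t u y z x u + t x y z u y + t x y z u z"

text \<open>Subtracting one rotation from \<open>DT2\<close> completes both remaining product terms
  to deviations from additivity.\<close>

lemma DEcyc: "D (b2 x y z u) (Ebar x y z u + act u (Ebar u x y z))"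
  by (rule D_cong[OF D_diff[OF DT2[of x y z u] Drot[of u y z]]])
    (simp_all add: Ebar_def act_simps algebra_simps two two' Let_def b1_def b2_def t_lin
      t_cyc[of x y u] t_cyc[of y u x] t_cyc[of y x u] t_cyc[of x u y] t_cyc[of x z u] t_cyc[of z u x] t_cyc[of z x u] t_cyc[of x u z] t_cyc[of y z u] t_cyc[of z u y] t_cyc[of z y u] t_cyc[of y u z] t_cyc[of y z x] t_cyc[of z x y] t_cyc[of z y x] t_cyc[of y x z])

definition b3 where "b3 x y z u = t u x y y z + t u x z y u + t u y z x u + t u y z x y + t u y z x z
    + t x y z u x + t x y z u y + t x y z u z + t x y z x u + t x y z y u + t x y z z u"

text \<open>\<open>DEcyc\<close> at \<open>z, u, x, y\<close> removes from \<open>T1\<close> both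
  product terms other than that of \<open>x \<cdot> y\<close>, and rotations align the rest. Thus
  the deviation from additivity equals the effect of \<open>u\<close> on \<open>f x y z\<close>, up
  to an explicit error.\<close>

lemma DE: "D (b3 x y z u) (Ebar x y z u - act u (f x y z) + f x y z)"
proof -
  note D_diff[OF D_diff[OF D_diff[OF D_diff[OF D_diff[OF DT1[of x y z u] DEcyc[of z u x y]]
      Drot2[of x y z]] Drot2[of x y u]] D_actI[OF Drot[of x y u], of y]] D_actI[OF Drot[of x z u], of y]]
  hence "D (b3 x y z u) (act y (act x (Ebar x y z u - act u (f x y z) + f x y z)))"
    by (rule D_cong) (simp add: Ebar_def T1_def act_simps algebra_simps,
      simp add: ac_simps two two' Let_def b1_def b2_def b3_def t_lin
        t_cyc[of x y u] t_cyc[of y u x] t_cyc[of y x u] t_cyc[of x u y] t_cyc[of x z u] t_cyc[of z u x] t_cyc[of z x u] t_cyc[of x u z] t_cyc[of y z u] t_cyc[of z u y] t_cyc[of z y u] t_cyc[of y u z] t_cyc[of y z x] t_cyc[of z x y] t_cyc[of z y x] t_cyc[of y x z])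
  thus ?thesis by (simp add: D_act)
qed

text \<open>The first-argument rule rotated into the third argument. The error bit stays anonymous
  because \<open>t_relation\<close> uses it in a difference where it cancels.\<close>

lemma D3: "\<exists>b. D b (f x y (w \<cdot> z) - f x y z - act z (f x y w))"
proof -
  obtain b where "D b ((f w x y - act y (act x (f x y w))) + (f z x y - act y (act x (f x y z)))
      - (f (w \<cdot> z) x y - act y (act x (f x y (w \<cdot> z))))
      + (Ebar w z x y + act y (Ebar y w z x)) - act y (Ebar y w z x + act x (Ebar x y w z))
      + act y (act x (Ebar x y w z - act z (f x y w) + f x y w)))"
    using D_add[OF D_diff[OF D_add[OF D_diff[OF D_add[OF Drot2[of x y w] Drot2[of x y z]] Drot2[of x y "w \<cdot> z"]]
      DEcyc[of w z x y]] D_actI[OF DEcyc[of y w z x], of y]] D_actI[OF D_actI[OF DE[of x y w z], of x], of y]] by blast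
  hence "D b (act y (act x (f x y (w \<cdot> z) - f x y z - act z (f x y w))))"
    by (simp add: Ebar_def act_simps algebra_simps)
  thus ?thesis by (auto simp: D_act)
qed

end

text \<open>Rebracketing the first argument multiplies it by an associator, which changes
  \<open>f\<close> by the bit \<open>t\<close>. Injectivity of \<open>nu\<close> turns a congruence
  between errors into an equation of bits.\<close>

locale associator_calculus_defect = associator_calculus mul R act f nu t
  for mul :: "'q \<Rightarrow> 'q \<Rightarrow> 'q"  (infixl \<open>\<cdot>\<close> 70)
    and R :: "'e::ab_group_add set" and act f nu t +
  assumes defect: "f ((x \<cdot> y) \<cdot> w) z u - f (x \<cdot> (y \<cdot> w)) z u - nu (t x y w z u) \<in> R"
    and nu_inj: "nu i \<in> R \<Longrightarrow> i = 0"
begin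

text \<open>Take \<open>DE\<close> over the four products occurring in
  \<open>(x \<cdot> y) \<cdot> w\<close> and \<open>x \<cdot> (y \<cdot> w)\<close>. The deviations
  telescope to the defect. The action terms form \<open>act u ?G - ?G\<close>, where
  \<open>?G\<close> is a bit by the pentagon and \<open>D3\<close> and is therefore fixed by
  \<open>u\<close>. Only error bits remain.\<close>

lemma t_relation:
  "t u w z x y + t u x w y z + t u x y w z + t u y z x w + t w x y z u + t w z y u x + t w z y x u
   + t x y z u w + t x y z w u = 0"
proof -
  let ?G = "f (x \<cdot> y) w z + f x y z - f x (y \<cdot> w) z - f y w z"
  obtain c where c: "D c ?G"
  proof -
    obtain b where b: "D b (f x y (w \<cdot> z) - f x y z - act z (f x y w))" using D3 by blast
    show ?thesis
      by (rule that, rule D_cong[OF D_diff[OF Dpent[of x y w z] b] _ refl]) (simp add: algebra_simps two two')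
  qed
  have def: "D (t x y w z u) (f ((x \<cdot> y) \<cdot> w) z u - f (x \<cdot> (y \<cdot> w)) z u)"
    using defect by (simp add: D_def)
  note D_diff[OF D_diff[OF D_add[OF D_diff[OF D_diff[OF D_add[OF DE[of "x \<cdot> y" w z u] DE[of x y z u]]
      DE[of x "y \<cdot> w" z u]] DE[of y w z u]] D_actI[OF c, of u]] c] def]
  hence "D (t u w z x y + t u x w y z + t u x y w z + t u y z x w + t w x y z u + t w z y u x + t w z y x u
   + t x y z u w + t x y z w u) 0"
    by (rule D_cong) (simp add: Ebar_def act_simps algebra_simps,
      simp add: ac_simps two two' b3_def t_lin
        t_cyc[of w x u] t_cyc[of x u w] t_cyc[of x w u] t_cyc[of w u x] t_cyc[of w y u] t_cyc[of y u w] t_cyc[of y w u] t_cyc[of w u y] t_cyc[of w z u] t_cyc[of z u w] t_cyc[of z w u] t_cyc[of w u z] t_cyc[of x y u] t_cyc[of y u x] t_cyc[of y x u] t_cyc[of x u y] t_cyc[of x z u] t_cyc[of z u x] t_cyc[of z x u] t_cyc[of x u z] t_cyc[of y z u] t_cyc[of z u y] t_cyc[of z y u] t_cyc[of y u z] t_cyc[of x y w] t_cyc[of y w x] t_cyc[of y x w] t_cyc[of x w y] t_cyc[of x z w] t_cyc[of z w x] t_cyc[of z x w] t_cyc[of x w z] t_cyc[of y z w] t_cyc[of z w y] t_cyc[of z y w] t_cyc[of y w z] t_cyc[of y z x] t_cyc[of z x y] t_cyc[of z y x] t_cyc[of y x z])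
  hence "nu (t u w z x y + t u x w y z + t u x y w z + t u y z x w + t w x y z u + t w z y u x + t w z y x u
   + t x y z u w + t x y z w u) \<in> R" using R_uminus by (fastforce simp: D_def)
  thus ?thesis by (rule nu_inj)
qed

text \<open>A certificate from linear algebra in characteristic two: in the sum of nine permuted
  instances of \<open>t_relation\<close>, read modulo \<open>t_cyc\<close>, every term but the
  desired one occurs an even number of times.\<close>

theorem t_zero: "t x y z u v = 0"
proof -
  have "t x y z u v =
    (t x v u y z + t x y v z u + t x y z v u + t x z u y v + t v y z u x + t v u z x y + t v u z y x + t y z u x v + t y z u v x)
    + (t x y v u z + t x u y z v + t x u z y v + t x z v u y + t y u z v x + t y v z x u + t y v z u x + t u z v x y + t u z v y x)
    + (t u v z x y + t u x v y z + t u x y v z + t u y z x v + t v x y z u + t v z y u x + t v z y x u + t x y z u v + t x y z v u)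
    + (t v z u x y + t v x z y u + t v x y z u + t v y u x z + t z x y u v + t z u y v x + t z u y x v + t x y u v z + t x y u z v)
    + (t z v y u x + t z u v x y + t z u x v y + t z x y u v + t v u x y z + t v y x z u + t v y x u z + t u x y z v + t u x y v z)
    + (t v y x z u + t v z y u x + t v z u y x + t v u x z y + t y z u x v + t y x u v z + t y x u z v + t z u x v y + t z u x y v)
    + (t z v u y x + t z y v x u + t z y x v u + t z x u y v + t v y x u z + t v u x z y + t v u x y z + t y x u z v + t y x u v z)
    + (t u v x z y + t u z v y x + t u z y v x + t u y x z v + t v z y x u + t v x y u z + t v x y z u + t z y x u v + t z y x v u)
    + (t y x z u v + t y u x v z + t y u v x z + t y v z u x + t x u v z y + t x z v y u + t x z v u y + t u v z y x + t u v z x y)"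
    by (simp add: algebra_simps two two' t_cyc[of v x u] t_cyc[of x u v] t_cyc[of x v u] t_cyc[of v u x] t_cyc[of v y u] t_cyc[of y u v] t_cyc[of y v u] t_cyc[of v u y] t_cyc[of v z u] t_cyc[of z u v] t_cyc[of z v u] t_cyc[of v u z] t_cyc[of x y u] t_cyc[of y u x] t_cyc[of y x u] t_cyc[of x u y] t_cyc[of x z u] t_cyc[of z u x] t_cyc[of z x u] t_cyc[of x u z] t_cyc[of y z u] t_cyc[of z u y] t_cyc[of z y u] t_cyc[of y u z] t_cyc[of x y v] t_cyc[of y v x] t_cyc[of y x v] t_cyc[of x v y] t_cyc[of x z v] t_cyc[of z v x] t_cyc[of z x v] t_cyc[of x v z] t_cyc[of y z v] t_cyc[of z v y] t_cyc[of z y v] t_cyc[of y v z] t_cyc[of y z x] t_cyc[of z x y] t_cyc[of z y x] t_cyc[of y x z])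
  thus ?thesis unfolding t_relation by simp
qed

end

declare add_bit_eq_xor [simp del]
lemma bit_two [simp]: "(a::bit) + a = 0" by (cases a) simp_all

section \<open>Conjugation on the nucleus, and central involutions\<close>

context total_buchsteiner begin

text \<open>Conjugating the autotopism \<open>(L_a, id, L_a)\<close> by that of
  \<open>L_v^{-1}\<close> leaves the identity in the middle.\<close>

lemma nuc_conj: assumes a: "a \<in> nuc" shows "v \<setminus> (a \<cdot> v) \<in> nuc"
proof -
  define F where "F u = v \<setminus> (a \<cdot> (v \<cdot> u))" for u
  define H where "H u = (v \<setminus> (a \<cdot> (v \<cdot> (u \<oslash> v)))) \<cdot> v" for u
  have at: "(v \<setminus> s) \<cdot> (w \<cdot> v) = (v \<setminus> (s \<cdot> w)) \<cdot> v" for s w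
    by (rule atp_Linv[unfolded atp_def, rule_format])
  have FH: "F u \<cdot> W = H (u \<cdot> W)" for u W
  proof -
    have "u \<cdot> W = (v \<setminus> ((v \<cdot> u) \<cdot> (W \<oslash> v))) \<cdot> v" using at[of "v \<cdot> u" "W \<oslash> v"] by simp
    hence "(v \<cdot> u) \<cdot> (W \<oslash> v) = v \<cdot> ((u \<cdot> W) \<oslash> v)" by simp
    moreover have "F u \<cdot> W = (v \<setminus> ((a \<cdot> (v \<cdot> u)) \<cdot> (W \<oslash> v))) \<cdot> v"
      using at[of "a \<cdot> (v \<cdot> u)" "W \<oslash> v"] by (simp add: F_def)
    ultimately show ?thesis by (simp add: H_def nucD(1)[OF a])
  qed
  have "F u = H u" for u using FH[of u \<epsilon>] by simp
  hence F: "F u \<cdot> W = F (u \<cdot> W)" for u W using FH by simp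
  have "F u = F \<epsilon> \<cdot> u" for u using F[of \<epsilon> u] by simp
  hence "F \<epsilon> \<in> nuc" using F by (intro nucI1) metis
  thus ?thesis by (simp add: F_def)
qed

text \<open>Conjugation in the opposite direction is conjugation by the right inverse of
  \<open>v\<close>.\<close>

lemma nuc_conj': assumes a: "a \<in> nuc" shows "(v \<cdot> a) \<oslash> v \<in> nuc"
proof -
  define i where "i = v \<setminus> \<epsilon>"
  define c where "c = i \<setminus> (a \<cdot> i)"
  have c: "c \<in> nuc" unfolding c_def by (rule nuc_conj[OF a])
  have "(v \<cdot> a) \<cdot> i = v \<cdot> (i \<cdot> c)" by (simp add: nucD(2)[OF a] c_def)
  also have "\<dots> = (v \<cdot> i) \<cdot> c" by (simp add: nucD(3)[OF c])
  also have "\<dots> = c \<cdot> (v \<cdot> i)" by (simp add: i_def)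
  also have "\<dots> = (c \<cdot> v) \<cdot> i" by (simp add: nucD(1)[OF c])
  finally show ?thesis using c by simp
qed

definition ass :: "'q \<Rightarrow> 'q \<Rightarrow> 'q \<Rightarrow> 'q" where "ass x y z = (x \<cdot> (y \<cdot> z)) \<setminus> ((x \<cdot> y) \<cdot> z)"
lemma ass_eq: "(x \<cdot> y) \<cdot> z = (x \<cdot> (y \<cdot> z)) \<cdot> ass x y z" by (simp add: ass_def)

definition cj :: "'q \<Rightarrow> 'q \<Rightarrow> 'q" where "cj v a = v \<setminus> (a \<cdot> v)"
lemma cj_eq: "a \<cdot> v = v \<cdot> cj v a" by (simp add: cj_def)

end

locale involution_loop = total_buchsteiner mul ld rd e
  for mul :: "'q \<Rightarrow> 'q \<Rightarrow> 'q"  (infixl \<open>\<cdot>\<close> 70)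
    and ld :: "'q \<Rightarrow> 'q \<Rightarrow> 'q"  (infixl \<open>\<setminus>\<close> 70)
    and rd :: "'q \<Rightarrow> 'q \<Rightarrow> 'q"  (infixl \<open>\<oslash>\<close> 70)
    and e :: 'q  (\<open>\<epsilon>\<close>)
    and k :: 'q +
  assumes k_nuc: "k \<in> nuc" and k_comm: "k \<cdot> x = x \<cdot> k" and kk: "k \<cdot> k = \<epsilon>" and k_ne: "k \<noteq> \<epsilon>"
begin

text \<open>Powers of \<open>k\<close> with bits as exponents; the rewrite rules below move central
  factors to the end of each product and add them modulo 2.\<close>

definition sc :: "'q \<Rightarrow> bit \<Rightarrow> 'q"  (infixl \<open>\<star>\<close> 70) where "x \<star> b = (if b = 0 then x else x \<cdot> k)"

lemma sc0 [simp]: "x \<star> 0 = x" by (simp add: sc_def)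
lemma sc_ml [simp]: "(x \<star> b) \<cdot> y = x \<cdot> y \<star> b"
  by (cases b) (simp_all add: sc_def nucD[OF k_nuc] k_comm[symmetric])
lemma sc_mr [simp]: "x \<cdot> (y \<star> b) = x \<cdot> y \<star> b"
  by (cases b) (simp_all add: sc_def nucD[OF k_nuc])
lemma sc_sc [simp]: "x \<star> b \<star> c = x \<star> (b + c)"
  by (cases b; cases c; simp add: sc_def nucD[OF k_nuc] kk)
lemma sc_inj [simp]: "x \<star> b = x \<star> c \<longleftrightarrow> b = c"
  by (cases b; cases c; simp add: sc_def k_ne) (metis k_ne mul_eq_left)
lemma sc_inj' [simp]: "x \<star> b = y \<star> b \<longleftrightarrow> x = y" by (simp add: sc_def)
lemma sc_eq_self [simp]: "x \<star> b = x \<longleftrightarrow> b = 0" using sc_inj[of x b 0] by simp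
lemma sc_cancel: "x \<star> b = y \<star> c \<longleftrightarrow> x = y \<star> (b + c)"
  by (metis add.commute bit_two sc_sc sc0 add.assoc add_0)
lemma sc_ld [simp]: "x \<setminus> (y \<star> b) = x \<setminus> y \<star> b" by (simp add: ld_eq_iff)
lemma sc_rd [simp]: "(y \<star> b) \<oslash> x = y \<oslash> x \<star> b" by (simp add: rd_eq_iff)
lemma sc_ld' [simp]: "(x \<star> b) \<setminus> y = x \<setminus> y \<star> b" by (simp add: ld_eq_iff)

end

section \<open>Extensions by a central involution of a loop with nuclear associators\<close>

locale central_ext = involution_loop mul ld rd e k +
  q: total_buchsteiner mul' ld' rd' e'
  for mul :: "'q \<Rightarrow> 'q \<Rightarrow> 'q"  (infixl \<open>\<cdot>\<close> 70)
    and ld :: "'q \<Rightarrow> 'q \<Rightarrow> 'q"  (infixl \<open>\<setminus>\<close> 70)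
    and rd :: "'q \<Rightarrow> 'q \<Rightarrow> 'q"  (infixl \<open>\<oslash>\<close> 70)
    and e :: 'q  (\<open>\<epsilon>\<close>)
    and k :: 'q
    and mul' :: "'r \<Rightarrow> 'r \<Rightarrow> 'r" and ld' rd' and e' :: 'r +
  fixes \<pi> :: "'q \<Rightarrow> 'r"
  assumes \<pi>_mul: "\<pi> (x \<cdot> y) = mul' (\<pi> x) (\<pi> y)"
    and \<pi>_surj: "surj \<pi>"
    and \<pi>_eq: "\<pi> x = \<pi> y \<longleftrightarrow> y = x \<or> y = x \<cdot> k"
    and ass_q: "q.ass r1 r2 r3 \<in> q.nuc"
begin

lemma \<pi>_ld: "\<pi> (x \<setminus> y) = ld' (\<pi> x) (\<pi> y)" by (metis \<pi>_mul mul_ld q.ld_mul)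
lemma \<pi>_rd: "\<pi> (x \<oslash> y) = rd' (\<pi> x) (\<pi> y)" by (metis \<pi>_mul rd_mul q.mul_rd)
lemma \<pi>_e: "\<pi> \<epsilon> = e'" by (metis \<pi>_ld ld_self q.ld_self)
lemma \<pi>_sc: "\<pi> (x \<star> b) = \<pi> x" unfolding sc_def using \<pi>_eq by simp metis
lemma \<pi>_ass: "\<pi> (ass x y z) = q.ass (\<pi> x) (\<pi> y) (\<pi> z)" by (simp add: ass_def q.ass_def \<pi>_mul \<pi>_ld)
lemma \<pi>_cj: "\<pi> (cj x y) = q.cj (\<pi> x) (\<pi> y)" by (simp add: cj_def q.cj_def \<pi>_mul \<pi>_ld)
lemma \<pi>_eqD: "\<pi> x = \<pi> y \<Longrightarrow> \<exists>b. y = x \<star> b"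
  unfolding \<pi>_eq by (metis sc_def one_neq_zero)

definition N0 :: "'q set" where "N0 = {a. \<pi> a \<in> q.nuc}"
text \<open>For a triple whose bracketings agree in the quotient, in particular one with an entry in
  \<open>N0\<close>, this is the exponent of \<open>k\<close> by which the bracketings
  differ.\<close>

definition B :: "'q \<Rightarrow> 'q \<Rightarrow> 'q \<Rightarrow> bit" where "B x y z = (if (x \<cdot> y) \<cdot> z = x \<cdot> (y \<cdot> z) then 0 else 1)"

lemma B_rot: "B x y z = B y z x" unfolding B_def using assoc_rot[of x y z] by simp
lemma B_eq: "\<pi> ((x \<cdot> y) \<cdot> z) = \<pi> (x \<cdot> (y \<cdot> z)) \<Longrightarrow> (x \<cdot> y) \<cdot> z = x \<cdot> (y \<cdot> z) \<star> (B x y z)"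
proof -
  assume "\<pi> ((x \<cdot> y) \<cdot> z) = \<pi> (x \<cdot> (y \<cdot> z))"
  then obtain b where "x \<cdot> (y \<cdot> z) = (x \<cdot> y) \<cdot> z \<star> b" using \<pi>_eqD by blast
  thus ?thesis by (cases b) (auto simp: B_def sc_def nucD(3)[OF k_nuc] kk)
qed

lemma r1: "a \<in> N0 \<Longrightarrow> (a \<cdot> x) \<cdot> y = a \<cdot> (x \<cdot> y) \<star> (B a x y)"
  by (rule B_eq) (simp add: N0_def \<pi>_mul q.nucD)
lemma r2: "a \<in> N0 \<Longrightarrow> (x \<cdot> a) \<cdot> y = x \<cdot> (a \<cdot> y) \<star> (B a y x)"
  using B_eq[of x a y] by (simp add: N0_def \<pi>_mul q.nucD B_rot[of x a y])
lemma r3: "a \<in> N0 \<Longrightarrow> (x \<cdot> y) \<cdot> a = x \<cdot> (y \<cdot> a) \<star> (B a x y)"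
  using B_eq[of x y a] by (simp add: N0_def \<pi>_mul q.nucD B_rot[of a x y] B_rot[of x y a])

lemma N0_mul: "a \<in> N0 \<Longrightarrow> b \<in> N0 \<Longrightarrow> a \<cdot> b \<in> N0" by (simp add: N0_def \<pi>_mul q.nuc_mul)
lemma N0_cj: "a \<in> N0 \<Longrightarrow> cj v a \<in> N0" by (simp add: N0_def \<pi>_cj q.cj_def q.nuc_conj)
lemma N0_ass: "ass x y z \<in> N0" by (simp add: N0_def \<pi>_ass ass_q)
lemma N0_sc: "a \<star> b \<in> N0 \<longleftrightarrow> a \<in> N0" by (simp add: N0_def \<pi>_sc)

text \<open>When an inner mapping only multiplies by powers of \<open>k\<close> and its companion is
  such a power, the pseudo-automorphism law says that the exponent is additive. This gives the
  linearity of \<open>B\<close>.\<close>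

lemma linn_shift:
  assumes "\<And>z. linn x y z = z \<star> (n z)" "comp_r x y = \<epsilon> \<star> b"
  shows "n (u \<cdot> v) = n u + n v"
  using linn_comp_r[of x y u v] by (simp add: assms add.commute)

lemma B_lin3: assumes "a \<in> N0" shows "B a x (u \<cdot> v) = B a x u + B a x v"
proof (rule linn_shift)
  show "linn a x z = z \<star> (B a x z)" for z
    using r1[OF assms, of x z] by (simp add: linn_def ld_eq_iff)
  have "\<epsilon> = ((\<epsilon> \<oslash> x) \<oslash> a \<cdot> a) \<cdot> x" by simp
  also have "\<dots> = comp_r a x \<star> (B a x ((\<epsilon> \<oslash> x) \<oslash> a))"
    unfolding comp_r_def by (rule r2[OF assms])
  finally show "comp_r a x = \<epsilon> \<star> (B a x ((\<epsilon> \<oslash> x) \<oslash> a))"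
    by (metis bit_two sc_sc sc0)
qed

lemma B_lin2: assumes "a \<in> N0" shows "B a (u \<cdot> v) x = B a u x + B a v x"
proof (rule linn_shift)
  show "linn x a z = z \<star> (B a z x)" for z
    using r2[OF assms, of x z] by (simp add: linn_def ld_eq_iff)
  have "\<epsilon> = ((\<epsilon> \<oslash> a) \<oslash> x \<cdot> x) \<cdot> a" by simp
  also have "\<dots> = comp_r x a \<star> (B a ((\<epsilon> \<oslash> a) \<oslash> x) x)"
    unfolding comp_r_def by (rule r3[OF assms])
  finally show "comp_r x a = \<epsilon> \<star> (B a ((\<epsilon> \<oslash> a) \<oslash> x) x)"
    by (metis bit_two sc_sc sc0)
qed

lemma B_trivial [simp]: "B \<epsilon> x y = 0" "B x \<epsilon> y = 0" "B x y \<epsilon> = 0" by (simp_all add: B_def)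

lemma bit_solve: "(a::bit) = b + c \<Longrightarrow> c = b + a" by (simp add: add.assoc[symmetric])
lemma bit_solve': "(a::bit) = b + c \<Longrightarrow> b = c + a" by (simp add: add.left_commute)

lemma B_ld3: "a \<in> N0 \<Longrightarrow> B a x (u \<setminus> v) = B a x u + B a x v"
  using bit_solve[OF B_lin3[of a x u "u \<setminus> v"]] by simp
lemma B_ld2: "a \<in> N0 \<Longrightarrow> B a (u \<setminus> v) x = B a u x + B a v x"
  using bit_solve[OF B_lin2[of a u "u \<setminus> v" x]] by simp
lemma B_rd3: "a \<in> N0 \<Longrightarrow> B a x (v \<oslash> u) = B a x u + B a x v"
  using bit_solve'[OF B_lin3[of a x "v \<oslash> u" u]] by simp
lemma B_rd2: "a \<in> N0 \<Longrightarrow> B a (v \<oslash> u) x = B a u x + B a v x"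
  using bit_solve'[OF B_lin2[of a "v \<oslash> u" u x]] by simp
lemmas B_lin = B_lin2 B_lin3 B_ld2 B_ld3 B_rd2 B_rd3

lemma bit_two' [simp]: "(a::bit) + (a + b) = b" by (simp add: add.assoc[symmetric])

text \<open>A map additive over products and with values in bits cannot see the bracketing, so it
  kills associators.\<close>

lemma B_ass: "a \<in> N0 \<Longrightarrow> B a u (ass x y z) = 0" "a \<in> N0 \<Longrightarrow> B a (ass x y z) u = 0"
  by (simp_all add: ass_def B_lin ac_simps)

lemma B_mul1: assumes a: "a \<in> N0" and b: "b \<in> N0" shows "B (a \<cdot> b) x z = B a x z + B b x z"
proof -
  have "((a \<cdot> b) \<cdot> x) \<cdot> z = (a \<cdot> (b \<cdot> (x \<cdot> z))) \<star> (B a b x + B a (b \<cdot> x) z + B b x z)"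
    by (simp add: r1[OF a, of b x] r1[OF a, of "b \<cdot> x" z] r1[OF b] ac_simps)
  moreover have "((a \<cdot> b) \<cdot> x) \<cdot> z = (a \<cdot> (b \<cdot> (x \<cdot> z))) \<star> (B a b (x \<cdot> z) + B (a \<cdot> b) x z)"
    by (subst r1[OF N0_mul[OF a b]]) (simp add: r1[OF a, of b])
  ultimately have "B a b x + B a (b \<cdot> x) z + B b x z = B a b (x \<cdot> z) + B (a \<cdot> b) x z" by simp
  from bit_solve[OF this] show ?thesis by (simp add: B_lin a b ac_simps)
qed

text \<open>Up to bits, right multiplication by the conjugate is right multiplication by
  \<open>a\<close> transported along \<open>q\<close>, and \<open>g\<close> is left multiplication
  by \<open>x\<close> transported likewise. Comparing how the two pairs fail to commute gives the
  identity once linearity has cancelled the side terms.\<close>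

lemma B_cj: assumes a: "a \<in> N0" shows "B (cj v a) x w = B a x w"
proof -
  let ?a = "cj v a"
  have a': "?a \<in> N0" by (rule N0_cj[OF a])
  define s where "s = v \<setminus> \<epsilon>"
  define q where "q w = v \<cdot> (w \<oslash> v)" for w
  define g where "g w = (v \<setminus> (x \<cdot> q w)) \<cdot> v" for w
  have P1: "w \<cdot> ?a = (v \<setminus> (q w \<cdot> a)) \<cdot> v \<star> (B ?a (w \<oslash> v) v)" for w
  proof -
    have "(w \<oslash> v) \<cdot> (v \<cdot> ?a) = (v \<setminus> (q w \<cdot> a)) \<cdot> v"
      using buch[of v "w \<oslash> v" a] by (metis q_def cj_eq rd_mul)
    thus ?thesis using r3[OF a', of "w \<oslash> v" v] by simp
  qed
  have lm: "(v \<setminus> (c \<cdot> d)) \<cdot> v = (v \<setminus> c) \<cdot> (d \<cdot> v)" for c d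
    using buch[of v "v \<setminus> c" d] by (metis mul_ld rd_mul)
  have qv: "q w \<cdot> v = s \<setminus> w" for w
    using lm[of \<epsilon> "q w"] by (simp add: s_def q_def) (metis ld_mul)
  have g: "g w = (v \<setminus> x) \<cdot> (s \<setminus> w)" for w by (simp add: g_def lm qv)
  have "(s \<setminus> w) \<cdot> ?a = s \<setminus> (w \<cdot> ?a) \<star> (B ?a s (s \<setminus> w))"
    using r3[OF a', of s "s \<setminus> w"] by (simp add: ld_eq_iff)
  hence 1: "g w \<cdot> ?a = g (w \<cdot> ?a) \<star> (B ?a s (s \<setminus> w) + B ?a (v \<setminus> x) (s \<setminus> w))"
    by (simp add: g r3[OF a', of "v \<setminus> x"])
  have qg: "q (g w) = x \<cdot> q w" by (simp add: g_def q_def[of "_ \<cdot> v"])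
  have 2: "g w \<cdot> ?a = (v \<setminus> (x \<cdot> (q w \<cdot> a))) \<cdot> v \<star> (B a x (q w) + B ?a (g w \<oslash> v) v)"
    by (simp add: P1[of "g w"] qg r3[OF a])
  have "q (w \<cdot> ?a) = q w \<cdot> a \<star> (B ?a (w \<oslash> v) v)"
    unfolding q_def[of "w \<cdot> ?a"] by (subst P1) simp
  hence 3: "g (w \<cdot> ?a) = (v \<setminus> (x \<cdot> (q w \<cdot> a))) \<cdot> v \<star> (B ?a (w \<oslash> v) v)"
    by (simp add: g_def[of "w \<cdot> ?a"])
  have "B a x (q w) + B ?a (g w \<oslash> v) v = B ?a (w \<oslash> v) v + (B ?a s (s \<setminus> w) + B ?a (v \<setminus> x) (s \<setminus> w))"
    using 1 unfolding 2 3 by simp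
  hence "B a x w + (B a x v + B a x v) + B ?a (g w \<oslash> v) v
      = B ?a (w \<oslash> v) v + (B ?a s (s \<setminus> w) + B ?a (v \<setminus> x) (s \<setminus> w))"
    by (simp add: q_def B_lin a ac_simps)
  thus ?thesis by (simp add: g B_lin a' s_def ac_simps)
qed

text \<open>Moving \<open>a\<close> past \<open>u\<close> and then past \<open>v\<close> costs three
  bits: \<open>B a u v\<close>, \<open>B a v u\<close> and again \<open>B a u v\<close>. The outer
  two cancel.\<close>

lemma cj_mul_bit: assumes a: "a \<in> N0" shows "cj (u \<cdot> v) a = cj v (cj u a) \<star> (B a v u)"
proof -
  let ?b = "cj u a" and ?c = "cj v (cj u a)"
  have b: "?b \<in> N0" "?c \<in> N0" using N0_cj a by auto
  have "a \<cdot> (u \<cdot> v) = (a \<cdot> u) \<cdot> v \<star> (B a u v)" by (simp add: r1[OF a])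
  also have "(a \<cdot> u) \<cdot> v = u \<cdot> (v \<cdot> ?c) \<star> (B a v u)"
    by (simp add: cj_eq[of a u] r2[OF b(1)] cj_eq[of ?b v] B_cj a)
  also have "u \<cdot> (v \<cdot> ?c) = (u \<cdot> v) \<cdot> ?c \<star> (B a u v)"
    by (simp add: r3[OF b(2)] B_cj a b)
  finally have "a \<cdot> (u \<cdot> v) = (u \<cdot> v) \<cdot> (?c \<star> B a v u)" by (simp add: ac_simps)
  thus ?thesis by (simp add: cj_def[of "u \<cdot> v"])
qed

lemma cj_sc: "cj v (a \<star> b) = cj v a \<star> b" by (simp add: cj_def)

text \<open>Both bracketings of \<open>x, y, z\<close> conjugate an element of \<open>N0\<close> in
  the same way, the bits of \<open>cj_mul_bit\<close> being equal. The associator is their quotient,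
  so it conjugates trivially.\<close>

lemma ass_comm: assumes a: "a \<in> N0" shows "a \<cdot> ass x y z = ass x y z \<cdot> a"
proof -
  define w where "w = x \<cdot> (y \<cdot> z)"
  define a0 where "a0 = (w \<cdot> a) \<oslash> w"
  have "\<pi> a0 = rd' (mul' (\<pi> w) (\<pi> a)) (\<pi> w)" by (simp add: a0_def \<pi>_mul \<pi>_rd)
  hence a0: "a0 \<in> N0" using a by (simp add: N0_def q.nuc_conj')
  have aa: "a = cj w a0" by (simp add: cj_def a0_def)
  have 1: "cj ((x \<cdot> y) \<cdot> z) a0 = cj z (cj y (cj x a0)) \<star> (B a0 z x + B a0 z y + B a0 y x)"
    using a0 by (simp add: cj_mul_bit N0_cj B_lin cj_sc ac_simps)
  have 2: "cj (x \<cdot> (y \<cdot> z)) a0 = cj z (cj y (cj x a0)) \<star> (B a0 z x + B a0 z y + B a0 y x)"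
    using a0 by (simp add: cj_mul_bit N0_cj B_lin cj_sc B_cj ac_simps)
  have "cj ((x \<cdot> y) \<cdot> z) a0 = cj (ass x y z) (cj w a0)"
    by (simp add: ass_eq[of x y z] w_def[symmetric] cj_mul_bit a0 B_ass)
  hence "cj (ass x y z) a = a" using 1 2 aa w_def by simp
  thus ?thesis using cj_eq[of a "ass x y z"] by simp
qed

end

section \<open>Formal integer combinations presenting a finite abelian group\<close>

definition gen :: "'a \<Rightarrow> 'a \<Rightarrow> int" where "gen a = (\<lambda>x. if x = a then 1 else 0)"

context comm_group begin

definition ev :: "('a \<Rightarrow> int) \<Rightarrow> 'a" where "ev F = finprod G (\<lambda>a. a [^] F a) (carrier G)"
text \<open>The calculus needs a type that is an additive group, while associators live in a
  commutative subgroup of a loop. That subgroup is replaced by integer-valued functions modulo the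
  kernel of evaluation.\<close>

definition relators :: "('a \<Rightarrow> int) set" where "relators = {F. ev F = \<one>}"

lemma ev_closed: "ev F \<in> carrier G" unfolding ev_def by (rule finprod_closed) auto

lemma ev_add: "ev (F + H) = ev F \<otimes> ev H"
proof -
  have "ev (F + H) = finprod G (\<lambda>a. a [^] F a \<otimes> a [^] H a) (carrier G)"
    unfolding ev_def by (rule finprod_cong') (auto simp: int_pow_mult)
  thus ?thesis unfolding ev_def by (simp add: Pi_def)
qed

lemma ev_zero: "ev 0 = \<one>" unfolding ev_def by (simp add: finprod_one_eqI)

lemma ev_diff: "ev (F - H) = ev F \<otimes> inv (ev H)"
  using ev_add[of "F - H" H] by (simp add: ev_closed m_assoc)

lemma ev_gen: "finite (carrier G) \<Longrightarrow> a \<in> carrier G \<Longrightarrow> ev (gen a) = a"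
proof -
  assume "finite (carrier G)" "a \<in> carrier G"
  moreover have "ev (gen a) = (\<Otimes>j\<in>carrier G. if a = j then j else \<one>)"
    unfolding ev_def gen_def by (rule finprod_cong') auto
  ultimately show ?thesis by (simp add: finprod_singleton)
qed

lemma ev_pushforward:
  assumes fin: "finite (carrier G)" and c: "c \<in> hom G G" and b: "bij_betw c (carrier G) (carrier G)"
    and F: "\<And>a. a \<in> carrier G \<Longrightarrow> F' (c a) = F a"
  shows "ev F' = c (ev F)"
proof -
  interpret c: group_hom G G c using c by unfold_locales
  have cc: "c a \<in> carrier G" if "a \<in> carrier G" for a using that by simp
  have "ev F' = finprod G (\<lambda>a. a [^] F' a) (c ` carrier G)" using b by (simp add: ev_def bij_betw_def)
  also have "\<dots> = finprod G (\<lambda>a. c a [^] F' (c a)) (carrier G)"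
    using b by (intro finprod_reindex) (auto simp: bij_betw_def cc)
  also have "\<dots> = finprod G (\<lambda>a. c (a [^] F a)) (carrier G)"
    by (rule finprod_cong') (auto simp: F c.hom_int_pow cc)
  also have "\<dots> = c (finprod G (\<lambda>a. a [^] F a) (carrier G))"
  proof -
    have "finprod G (\<lambda>a. c (a [^] F a)) A = c (finprod G (\<lambda>a. a [^] F a) A)" if "A \<subseteq> carrier G" "finite A" for A
      using that(2,1) by (induction A rule: finite_induct) (auto simp: Pi_def subset_iff)
    thus ?thesis using fin by blast
  qed
  finally show ?thesis by (simp add: ev_def)
qed

lemma relators_zero: "0 \<in> relators" by (simp add: relators_def ev_zero)
lemma relators_diff: "F \<in> relators \<Longrightarrow> H \<in> relators \<Longrightarrow> F - H \<in> relators"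
  by (simp add: relators_def ev_diff)
lemma relators_mult:
  "finite (carrier G) \<Longrightarrow> a \<in> carrier G \<Longrightarrow> b \<in> carrier G \<Longrightarrow> gen a + gen b - gen (a \<otimes> b) \<in> relators"
  by (simp add: relators_def ev_add ev_diff ev_gen)
lemma relators_eq:
  "finite (carrier G) \<Longrightarrow> a \<in> carrier G \<Longrightarrow> b \<in> carrier G \<Longrightarrow> gen a - gen b \<in> relators \<longleftrightarrow> a = b"
  by (simp add: relators_def ev_diff ev_gen) (metis inv_closed inv_equality inv_inv r_inv)

end

context total_buchsteiner begin

lemma cj_inj [simp]: "cj v a = cj v b \<longleftrightarrow> a = b" by (metis cj_eq mul_rcancel)
definition ci :: "'q \<Rightarrow> 'q \<Rightarrow> 'q" where "ci v b = (v \<cdot> b) \<oslash> v"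
lemma cj_ci [simp]: "cj v (ci v b) = b" by (simp add: cj_def ci_def)
lemma ci_cj [simp]: "ci v (cj v b) = b" by (simp add: cj_def ci_def)

end

section \<open>The coefficient group of the associators and the laws they satisfy\<close>

context central_ext begin

text \<open>An abelian group that contains all associators and \<open>k\<close>, is stable under
  conjugation, and associates freely with elements of \<open>N0\<close>.\<close>

definition EE :: "'q set" where
  "EE = {c \<in> N0. (\<forall>a\<in>N0. c \<cdot> a = a \<cdot> c) \<and> (\<forall>a\<in>N0. \<forall>x. B a x c = 0 \<and> B a c x = 0)}"

lemma N0_ci: "a \<in> N0 \<Longrightarrow> ci v a \<in> N0"
  by (simp add: N0_def ci_def \<pi>_mul \<pi>_rd q.nuc_conj')

lemma EE_N0: "c \<in> EE \<Longrightarrow> c \<in> N0" by (simp add: EE_def)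
lemma EE_comm: "c \<in> EE \<Longrightarrow> a \<in> N0 \<Longrightarrow> c \<cdot> a = a \<cdot> c" by (simp add: EE_def)
lemma EE_B:
  assumes "c \<in> EE" "a \<in> N0"
  shows "B a x c = 0" "B a c x = 0" "B c a x = 0" "B c x a = 0"
  using assms B_rot[of c a x] B_rot[of a c x] by (simp_all add: EE_def)

lemma EE_ass: "ass x y z \<in> EE"
proof -
  have "\<forall>a\<in>N0. ass x y z \<cdot> a = a \<cdot> ass x y z" using ass_comm by metis
  thus ?thesis by (simp add: EE_def N0_ass B_ass)
qed

lemma EE_mul: assumes c: "c \<in> EE" and d: "d \<in> EE" shows "c \<cdot> d \<in> EE"
proof -
  note n = EE_N0[OF c] EE_N0[OF d]
  have "(c \<cdot> d) \<cdot> a = a \<cdot> (c \<cdot> d)" if a: "a \<in> N0" for a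
  proof -
    have "(c \<cdot> d) \<cdot> a = c \<cdot> (a \<cdot> d)" using r1[OF n(1), of d a] c d a by (simp only: EE_B EE_comm sc0)
    also have "\<dots> = (a \<cdot> c) \<cdot> d" using r1[OF n(1), of a d] c d a n by (simp only: EE_B EE_comm sc0)
    also have "\<dots> = a \<cdot> (c \<cdot> d)" using r1[OF a, of c d] c d a n by (simp only: EE_B sc0)
    finally show ?thesis .
  qed
  moreover have "B a x (c \<cdot> d) = 0" "B a (c \<cdot> d) x = 0" if "a \<in> N0" for a x
    using that c d by (simp_all add: B_lin EE_B)
  ultimately show ?thesis using N0_mul[OF n] by (simp add: EE_def)
qed

lemma EE_ld: assumes c: "c \<in> EE" shows "c \<setminus> \<epsilon> \<in> EE"
proof -
  note n = EE_N0[OF c]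
  have i: "c \<setminus> \<epsilon> \<in> N0"
  proof -
    have "\<pi> (c \<setminus> \<epsilon>) \<in> q.nuc"
    proof -
      have c': "\<pi> c \<in> q.nuc" using n by (simp add: N0_def)
      have ce: "mul' (\<pi> c) (\<pi> (c \<setminus> \<epsilon>)) = e'" by (simp add: \<pi>_ld \<pi>_e)
      moreover have "mul' (mul' (\<pi> (c \<setminus> \<epsilon>)) r) s = mul' (\<pi> (c \<setminus> \<epsilon>)) (mul' r s)" for r s
      proof -
        have "mul' (\<pi> c) (mul' (mul' (\<pi> (c \<setminus> \<epsilon>)) r) s) = mul' r s"
          by (simp add: q.nucD(1)[OF c', symmetric] ce)
        also have "\<dots> = mul' (\<pi> c) (mul' (\<pi> (c \<setminus> \<epsilon>)) (mul' r s))"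
          by (simp add: q.nucD(1)[OF c', symmetric] ce)
        finally show ?thesis by simp
      qed
      ultimately show ?thesis by (intro q.nucI1)
    qed
    thus ?thesis by (simp add: N0_def)
  qed
  have "(c \<setminus> \<epsilon>) \<cdot> a = a \<cdot> (c \<setminus> \<epsilon>)" if a: "a \<in> N0" for a
  proof -
    have "c \<cdot> ((c \<setminus> \<epsilon>) \<cdot> a) = a" using r1[OF n, of "c \<setminus> \<epsilon>" a] c a i by (simp add: EE_B)
    moreover have "c \<cdot> (a \<cdot> (c \<setminus> \<epsilon>)) = a"
      using r1[OF n, of a "c \<setminus> \<epsilon>"] r1[OF a, of c "c \<setminus> \<epsilon>"] c a i by (simp add: EE_comm[OF c a] EE_B)
    ultimately show ?thesis by (metis mul_lcancel)
  qed
  moreover have "B a x (c \<setminus> \<epsilon>) = 0" "B a (c \<setminus> \<epsilon>) x = 0" if "a \<in> N0" for a x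
    using that c by (simp_all add: B_lin EE_B)
  ultimately show ?thesis using i by (simp add: EE_def)
qed

lemma EE_e: "\<epsilon> \<in> EE" using EE_mul[OF EE_ass[of \<epsilon> \<epsilon> \<epsilon>] EE_ass[of \<epsilon> \<epsilon> \<epsilon>]] by (simp add: ass_def)

lemma cj_hom:
  assumes c: "c \<in> EE" and a: "a \<in> N0"
  shows "cj v (c \<cdot> a) = cj v c \<cdot> cj v a" "cj v c \<cdot> cj v a = cj v a \<cdot> cj v c"
proof -
  note n = EE_N0[OF c]
  let ?c = "cj v c" and ?a = "cj v a"
  have nc: "?c \<in> N0" "?a \<in> N0" using N0_cj n a by auto
  have z: "B a v ?c = 0" "B a ?c v = 0" using a c by (simp_all add: cj_def B_lin EE_B)
  have "(c \<cdot> a) \<cdot> v = c \<cdot> (v \<cdot> ?a)" using r1[OF n, of a v] c a by (simp add: cj_eq[of a v] EE_B)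
  also have "\<dots> = (v \<cdot> ?c) \<cdot> ?a" using r1[OF n, of v ?a] c nc by (simp add: cj_eq[of c v] EE_B)
  also have "\<dots> = v \<cdot> (?c \<cdot> ?a)" using r2[OF nc(1), of v ?a] c nc by (simp add: B_cj n EE_B)
  finally have 1: "(c \<cdot> a) \<cdot> v = v \<cdot> (?c \<cdot> ?a)" .
  have "(a \<cdot> c) \<cdot> v = a \<cdot> (v \<cdot> ?c)" using r1[OF a, of c v] c a by (simp add: cj_eq[of c v] EE_B)
  also have "\<dots> = (v \<cdot> ?a) \<cdot> ?c" using r1[OF a, of v ?c] z by (simp add: cj_eq[of a v])
  also have "\<dots> = v \<cdot> (?a \<cdot> ?c)" using r2[OF nc(2), of v ?c] z by (simp add: B_cj a)
  finally have 2: "(a \<cdot> c) \<cdot> v = v \<cdot> (?a \<cdot> ?c)" .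
  show "cj v (c \<cdot> a) = ?c \<cdot> ?a" using 1 by (simp add: cj_def)
  show "?c \<cdot> ?a = ?a \<cdot> ?c" using 1 2 EE_comm[OF c a] by simp
qed

lemma EE_cj: assumes c: "c \<in> EE" shows "cj v c \<in> EE"
proof -
  have "cj v c \<cdot> a = a \<cdot> cj v c" if a: "a \<in> N0" for a
    using cj_hom(2)[OF c N0_ci[OF a, of v], of v] by simp
  moreover have "B a x (cj v c) = 0" "B a (cj v c) x = 0" if a: "a \<in> N0" for a x
    using a c by (simp_all add: cj_def B_lin EE_B)
  ultimately show ?thesis using N0_cj[OF EE_N0[OF c]] by (simp add: EE_def)
qed

lemma EE_ci: assumes c: "c \<in> EE" and fin: "finite (UNIV :: 'q set)" shows "ci v c \<in> EE"
proof -
  have "cj v ` EE = EE"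
    using EE_cj by (intro endo_inj_surj finite_subset[OF subset_UNIV fin]) (auto simp: inj_on_def)
  then obtain d where "d \<in> EE" "c = cj v d" using c by blast
  thus ?thesis by simp
qed

lemma EE_sc: assumes "c \<in> EE" shows "c \<star> b \<in> EE"
proof -
  have k: "B a x k = 0" "B a k x = 0" for a x
    using nucD[OF k_nuc] by (simp_all add: B_def)
  have "k \<in> N0" using N0_sc[of \<epsilon> 1] EE_N0[OF EE_e] by (simp add: sc_def)
  hence "k \<in> EE" by (simp add: EE_def k k_comm)
  thus ?thesis using assms by (simp add: sc_def EE_mul)
qed

lemma mulE: "c \<in> EE \<Longrightarrow> d \<in> N0 \<Longrightarrow> (w \<cdot> c) \<cdot> d = w \<cdot> (c \<cdot> d)"
  using r2[OF EE_N0, of c w d] by (simp add: EE_B)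

lemma w_conj: assumes c: "c \<in> EE"
  shows "(w \<cdot> c) \<cdot> u = (w \<cdot> u) \<cdot> cj u c \<star> (B c u w + B c w u)"
proof -
  note n = EE_N0[OF c]
  have "(w \<cdot> c) \<cdot> u = w \<cdot> (u \<cdot> cj u c) \<star> B c u w" by (simp add: r2[OF n] cj_eq[of c u])
  also have "w \<cdot> (u \<cdot> cj u c) = (w \<cdot> u) \<cdot> cj u c \<star> B c w u"
    using r3[OF N0_cj[OF n], of w u u] by (simp add: B_cj n)
  finally show ?thesis by (simp add: ac_simps)
qed

definition tt where "tt x y z u v = B (ass x y z) u v"

text \<open>Rebracketing \<open>x, y, z, u\<close> along the two sides of the pentagon. The bits
  come from carrying \<open>ass x y z\<close> past \<open>u\<close> and \<open>ass y z u\<close> out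
  of a product with \<open>x\<close>.\<close>

lemma ass_pentagon:
  "ass x y (z \<cdot> u) \<cdot> ass (x \<cdot> y) z u = ass y z u \<cdot> ass x (y \<cdot> z) u \<cdot> cj u (ass x y z)
    \<star> (tt x y z u (x \<cdot> (y \<cdot> z)) + tt x y z (x \<cdot> (y \<cdot> z)) u + tt y z u x (y \<cdot> (z \<cdot> u)))"
proof -
  define c where "c = ass x y z" define g where "g = ass y z u" define h where "h = ass x (y \<cdot> z) u"
  define w where "w = x \<cdot> (y \<cdot> z)" define W where "W = x \<cdot> (y \<cdot> (z \<cdot> u))"
  have E: "c \<in> EE" "g \<in> EE" "h \<in> EE" "cj u c \<in> EE" by (simp_all add: c_def g_def h_def EE_ass EE_cj)
  note n = E[THEN EE_N0]
  have "((x \<cdot> y) \<cdot> z) \<cdot> u = (w \<cdot> u) \<cdot> cj u c \<star> (B c u w + B c w u)"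
    by (simp add: ass_eq[of x y z] c_def[symmetric] w_def[symmetric] w_conj[OF E(1)])
  also have "w \<cdot> u = (x \<cdot> ((y \<cdot> (z \<cdot> u)) \<cdot> g)) \<cdot> h"
    by (simp add: w_def h_def g_def ass_eq[of x "y \<cdot> z" u] ass_eq[of y z u])
  also have "x \<cdot> ((y \<cdot> (z \<cdot> u)) \<cdot> g) = W \<cdot> g \<star> B g x (y \<cdot> (z \<cdot> u))"
    using r3[OF n(2), of x "y \<cdot> (z \<cdot> u)"] by (simp add: W_def)
  finally have "((x \<cdot> y) \<cdot> z) \<cdot> u = W \<cdot> (g \<cdot> h \<cdot> cj u c \<star> (B c u w + B c w u + B g x (y \<cdot> (z \<cdot> u))))"
    using n by (simp add: mulE E EE_mul ac_simps)
  moreover have "((x \<cdot> y) \<cdot> z) \<cdot> u = W \<cdot> (ass x y (z \<cdot> u) \<cdot> ass (x \<cdot> y) z u)"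
    by (simp add: ass_eq[of "x \<cdot> y" z u] ass_eq[of x y "z \<cdot> u"] W_def mulE EE_ass EE_N0)
  ultimately show ?thesis unfolding tt_def c_def g_def h_def w_def by (metis mul_lcancel)
qed

text \<open>The Buchsteiner law with both of its sides written through associators; the bit is the
  cost of carrying \<open>ass x y z\<close> past \<open>x\<close>.\<close>

lemma ass_rot: "ass y z x \<cdot> cj x (ass x y z) = \<epsilon> \<star> tt x y z (y \<cdot> z) x"
proof -
  define c where "c = ass x y z" define g where "g = ass y z x"
  have E: "c \<in> EE" "g \<in> EE" "cj x c \<in> EE" by (simp_all add: c_def g_def EE_ass EE_cj)
  note n = E[THEN EE_N0]
  have "(x \<cdot> y) \<cdot> z = x \<cdot> ((y \<cdot> z) \<cdot> c \<star> B c x (y \<cdot> z))"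
    using r3[OF n(1), of x "y \<cdot> z"] by (simp add: ass_eq[of x y z] c_def[symmetric])
  hence "((y \<cdot> z) \<cdot> c \<star> B c x (y \<cdot> z)) \<cdot> x = y \<cdot> (z \<cdot> x)"
    using buch[of x y z] by (metis ld_mul rd_mul)
  hence "((y \<cdot> z) \<cdot> x) \<cdot> cj x c \<star> B c (y \<cdot> z) x = y \<cdot> (z \<cdot> x)"
    by (simp add: w_conj[OF E(1)] ac_simps)
  hence "(y \<cdot> (z \<cdot> x)) \<cdot> (g \<cdot> cj x c) = y \<cdot> (z \<cdot> x) \<star> B c (y \<cdot> z) x"
    using n by (simp add: ass_eq[of y z x] g_def[symmetric] mulE E sc_cancel[of _ _ _ 0, simplified])
  hence "(y \<cdot> (z \<cdot> x)) \<cdot> (g \<cdot> cj x c) = (y \<cdot> (z \<cdot> x)) \<cdot> (\<epsilon> \<star> B c (y \<cdot> z) x)" by simp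
  thus ?thesis unfolding c_def g_def tt_def by (metis mul_lcancel)
qed

text \<open>Carrying \<open>c\<close> to the right end of both bracketings produces bits that cancel
  by linearity, except for one \<open>B c y z\<close>.\<close>

lemma ass_defect: assumes c: "c \<in> EE" shows "ass (w \<cdot> c) y z = ass w y z \<star> B c y z"
proof -
  define c1 where "c1 = cj y c" define c2 where "c2 = cj z c1"
  note E = c EE_cj[OF c, of y, folded c1_def] EE_cj[OF EE_cj[OF c, of y], of z, folded c1_def, folded c2_def]
  note n = E[THEN EE_N0]
  define X where "X = ass w y z"
  have X: "X \<in> EE" by (simp add: X_def EE_ass)
  have b: "B c1 = B c" unfolding c1_def using B_cj[OF n(1)] by blast
  have "((w \<cdot> c) \<cdot> y) \<cdot> z = (((w \<cdot> y) \<cdot> z) \<cdot> c2) \<star> (B c z (w \<cdot> y) + B c (w \<cdot> y) z + (B c y w + B c w y))"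
    by (simp add: w_conj[OF c, of w y, folded c1_def] w_conj[OF E(2), of "w \<cdot> y" z, folded c2_def] b ac_simps)
  also have "((w \<cdot> y) \<cdot> z) \<cdot> c2 = ((w \<cdot> (y \<cdot> z)) \<cdot> c2) \<cdot> X"
    using n X by (simp add: ass_eq[of w y z] X_def[symmetric] mulE E EE_N0 EE_comm[OF E(3)])
  finally have 1: "((w \<cdot> c) \<cdot> y) \<cdot> z
     = ((w \<cdot> (y \<cdot> z)) \<cdot> c2) \<cdot> X \<star> (B c z (w \<cdot> y) + B c (w \<cdot> y) z + (B c y w + B c w y))" .
  have 2: "(w \<cdot> c) \<cdot> (y \<cdot> z) = ((w \<cdot> (y \<cdot> z)) \<cdot> c2) \<star> (B c z y + (B c (y \<cdot> z) w + B c w (y \<cdot> z)))"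
    by (simp add: w_conj[OF c] cj_mul_bit[OF n(1)] c1_def[symmetric] c2_def[symmetric])
  have "ass (w \<cdot> c) y z = X \<star> (B c z (w \<cdot> y) + B c (w \<cdot> y) z + (B c y w + B c w y)
      + (B c z y + (B c (y \<cdot> z) w + B c w (y \<cdot> z))))"
    unfolding ass_def[of "w \<cdot> c"] 1 2 by (simp add: ac_simps)
  thus ?thesis using n by (simp add: B_lin X_def ac_simps)
qed

end

section \<open>Vanishing of the error bits\<close>

context central_ext begin

lemma B_sc [simp]: "B (a \<star> b) x y = B a x y" by (simp add: B_def)

text \<open>Applying \<open>B _ u v\<close> to the pentagon and to the rotation rule gives an
  error-free instance of the calculus with trivial action and bit values. There \<open>DE\<close>
  reduces to additivity in the first argument.\<close>

lemma tt_lin1: "tt (x \<cdot> x') y z u v = tt x y z u v + tt x' y z u v"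
proof -
  have p: "tt x y (z \<cdot> w) u v + tt (x \<cdot> y) z w u v + tt y z w u v + tt x (y \<cdot> z) w u v + tt x y z u v = 0"
    for x y z w
  proof -
    have "B (ass x y (z \<cdot> w) \<cdot> ass (x \<cdot> y) z w) u v
        = B (ass y z w \<cdot> ass x (y \<cdot> z) w \<cdot> cj w (ass x y z)) u v"
      by (simp add: ass_pentagon)
    hence "tt x y (z \<cdot> w) u v + tt (x \<cdot> y) z w u v = tt y z w u v + tt x (y \<cdot> z) w u v + tt x y z u v"
      by (simp add: B_mul1 EE_N0 EE_ass EE_mul EE_cj B_cj tt_def)
    thus ?thesis by (simp add: ac_simps)
  qed
  have r: "tt y z x u v + tt x y z u v = 0" for x y z
  proof -
    have "B (ass y z x \<cdot> cj x (ass x y z)) u v = 0" by (simp add: ass_rot)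
    thus ?thesis by (simp add: B_mul1 EE_N0 EE_ass EE_cj B_cj tt_def)
  qed
  have A: "associator_calculus mul {0::bit} (\<lambda>_ a. a) (\<lambda>x y z. tt x y z u v) (\<lambda>_::bit. 0) (\<lambda>_ _ _ _ _. 0)"
    apply unfold_locales
               apply (simp; fail)+
     apply (simp, rule p)
    apply (simp only: diff_zero singleton_iff, rule r)
    done
  have "tt (x \<cdot> x') y z u v + tt x y z u v + tt x' y z u v = 0"
    using associator_calculus.DE[OF A, of x x' y z]
    by (simp add: associator_calculus.D_def[OF A] associator_calculus.Ebar_def[OF A] ac_simps)
  thus ?thesis by (metis bit_two add.assoc add_0_right)
qed

lemma tt_rot: "tt x y z u v = tt y z x u v"
proof -
  have "B (ass y z x \<cdot> cj x (ass x y z)) u v = 0" by (simp add: ass_rot)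
  hence "tt y z x u v + tt x y z u v = 0" by (simp add: B_mul1 EE_N0 EE_ass EE_cj B_cj tt_def)
  thus ?thesis by (metis bit_two add.assoc add_0 add_0_right)
qed

text \<open>\<open>EE\<close> under conjugation is a model of the calculus with defect in which the
  error bits are \<open>tt\<close>. Their vanishing says exactly that associators are
  nuclear.\<close>

theorem ass_nuc:
  assumes fin: "finite (UNIV :: 'q set)"
  shows "ass x y z \<in> nuc"
proof -
  define G where "G = \<lparr>carrier = EE, monoid.mult = (\<cdot>), one = \<epsilon>\<rparr>"
  have Gs: "carrier G = EE" "monoid.mult G = (\<cdot>)" "one G = \<epsilon>" by (simp_all add: G_def)
  have cg: "comm_group G"
  proof (rule comm_groupI)
    show "\<exists>y\<in>carrier G. y \<otimes>\<^bsub>G\<^esub> x = \<one>\<^bsub>G\<^esub>" if "x \<in> carrier G" for x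
      using that EE_ld[of x] EE_comm[of "x \<setminus> \<epsilon>" x] by (metis Gs EE_N0 mul_ld)
    show "x \<otimes>\<^bsub>G\<^esub> y \<otimes>\<^bsub>G\<^esub> z = x \<otimes>\<^bsub>G\<^esub> (y \<otimes>\<^bsub>G\<^esub> z)"
      if "x \<in> carrier G" "y \<in> carrier G" "z \<in> carrier G" for x y z using that by (simp add: Gs mulE EE_N0)
    show "x \<otimes>\<^bsub>G\<^esub> y = y \<otimes>\<^bsub>G\<^esub> x" if "x \<in> carrier G" "y \<in> carrier G" for x y
      using that EE_comm[of x y] by (simp add: Gs EE_N0)
  qed (simp_all add: Gs EE_mul EE_e)
  let ?R = "comm_group.relators G"
  have finG: "finite (carrier G)" by (rule finite_subset[OF subset_UNIV fin])
  \<comment> \<open>Pushforward of coefficients along \<open>cj v\<close>, written with its inverse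
    \<open>ci v\<close>.\<close>
  define act where "act v F = (\<lambda>b. F (ci v b) :: int)" for v and F :: "'q \<Rightarrow> int"
  have actgen: "act v (gen a) = gen (cj v a)" for v a
    by (auto simp: act_def gen_def fun_eq_iff)
  have actR: "act v F \<in> ?R \<longleftrightarrow> F \<in> ?R" for v F
  proof -
    have "comm_group.ev G (act v F) = cj v (comm_group.ev G F)"
    proof (rule comm_group.ev_pushforward[OF cg finG])
      show "cj v \<in> hom G G" by (simp add: hom_def Gs EE_cj cj_hom(1) EE_N0)
      show "bij_betw (cj v) (carrier G) (carrier G)"
        by (rule bij_betwI[of _ _ _ "ci v"]) (simp_all add: Gs EE_cj EE_ci[OF _ fin])
    qed (simp add: act_def)
    moreover have "cj v \<epsilon> = \<epsilon>" by (simp add: cj_def)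
    ultimately show ?thesis unfolding comm_group.relators_def[OF cg] by (metis (mono_tags) Gs(3) cj_inj mem_Collect_eq)
  qed
  have mult: "a \<in> EE \<Longrightarrow> b \<in> EE \<Longrightarrow> gen a + gen b - gen (a \<cdot> b) \<in> ?R" for a b
    using comm_group.relators_mult[OF cg finG, of a b] by (simp add: Gs)
  have scE: "\<epsilon> \<star> b \<in> EE" for b by (simp add: EE_sc EE_e)
  have sub: "F \<in> ?R \<Longrightarrow> H \<in> ?R \<Longrightarrow> K = F - H \<Longrightarrow> K \<in> ?R" for F H K
    using comm_group.relators_diff[OF cg] by simp
  have neg: "F \<in> ?R \<Longrightarrow> - F \<in> ?R" for F
    using sub[OF comm_group.relators_zero[OF cg], of F "- F"] by simp
  have sc_split: "a \<star> b = a \<cdot> (\<epsilon> \<star> b)" for a b by simp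
  \<comment> \<open>Powers of \<open>k\<close> must stay separate factors here, so that
    \<open>rel\<close>-type congruences can split them off as
    \<open>gen (\<epsilon> \<star> b)\<close>.\<close>
  note [simp del] = sc_mr sc_ml
  have A: "associator_calculus_defect mul ?R act (\<lambda>x y z. gen (ass x y z)) (\<lambda>b. gen (\<epsilon> \<star> b)) tt"
  proof unfold_locales
    show "gen (\<epsilon> \<star> i) + gen (\<epsilon> \<star> j) - gen (\<epsilon> \<star> (i + j)) \<in> ?R" for i j
      using mult[OF scE scE, of i j] by (simp add: sc_split[symmetric])
    show "act x (gen (\<epsilon> \<star> i)) - gen (\<epsilon> \<star> i) \<in> ?R" for x i
      by (simp add: actgen cj_sc comm_group.relators_zero[OF cg]) (simp add: cj_def comm_group.relators_zero[OF cg])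
    show "act (u \<cdot> v) (gen (ass x y z)) - act v (act u (gen (ass x y z))) - gen (\<epsilon> \<star> tt x y z v u) \<in> ?R"
      for u v x y z
    proof -
      have "cj (u \<cdot> v) (ass x y z) = cj v (cj u (ass x y z)) \<cdot> (\<epsilon> \<star> tt x y z v u)"
        by (simp add: cj_mul_bit EE_N0 EE_ass tt_def sc_split[symmetric])
      thus ?thesis using neg[OF mult[OF EE_cj[OF EE_cj[OF EE_ass]] scE, of v u x y z "tt x y z v u"]]
        by (simp add: actgen algebra_simps)
    qed
    show "gen (ass x y (z \<cdot> u)) + gen (ass (x \<cdot> y) z u) - gen (ass y z u) - gen (ass x (y \<cdot> z) u)
         - act u (gen (ass x y z))
         - gen (\<epsilon> \<star> (tt x y z u (x \<cdot> (y \<cdot> z)) + tt x y z (x \<cdot> (y \<cdot> z)) u + tt y z u x (y \<cdot> (z \<cdot> u)))) \<in> ?R"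
      for x y z u
    proof -
      define b where "b = tt x y z u (x \<cdot> (y \<cdot> z)) + tt x y z (x \<cdot> (y \<cdot> z)) u + tt y z u x (y \<cdot> (z \<cdot> u))"
      let ?g = "ass y z u" and ?h = "ass x (y \<cdot> z) u" and ?c = "cj u (ass x y z)"
      have eq: "ass x y (z \<cdot> u) \<cdot> ass (x \<cdot> y) z u = ?g \<cdot> ?h \<cdot> ?c \<cdot> (\<epsilon> \<star> b)"
        by (simp add: ass_pentagon b_def sc_split[symmetric])
      have m: "?g \<cdot> ?h \<in> EE" "?g \<cdot> ?h \<cdot> ?c \<in> EE" "?c \<in> EE" by (simp_all add: EE_mul EE_ass EE_cj)
      show ?thesis unfolding b_def[symmetric] actgen
        by (rule sub[OF sub[OF sub[OF mult[OF EE_ass EE_ass, of x y "z \<cdot> u" "x \<cdot> y" z u]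
            mult[OF EE_ass EE_ass, of y z u x "y \<cdot> z" u] refl] mult[OF m(1,3)] refl] mult[OF m(2) scE, of b]])
          (simp add: eq algebra_simps)
    qed
    show "gen (ass y z x) + act x (gen (ass x y z)) - gen (\<epsilon> \<star> tt x y z (y \<cdot> z) x) \<in> ?R" for y z x
      using mult[OF EE_ass EE_cj[OF EE_ass], of y z x x x y z] by (simp add: actgen ass_rot)
    show "gen (ass (x \<cdot> y \<cdot> w) z u) - gen (ass (x \<cdot> (y \<cdot> w)) z u) - gen (\<epsilon> \<star> tt x y w z u) \<in> ?R"
      for x y w z u
    proof -
      have "ass (x \<cdot> y \<cdot> w) z u = ass (x \<cdot> (y \<cdot> w)) z u \<cdot> (\<epsilon> \<star> tt x y w z u)"
        by (simp add: ass_eq[of x y w] ass_defect EE_ass tt_def sc_split[symmetric])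
      thus ?thesis using neg[OF mult[OF EE_ass scE, of "x \<cdot> (y \<cdot> w)" z u "tt x y w z u"]]
        by (simp add: algebra_simps)
    qed
    show "i = 0" if "gen (\<epsilon> \<star> i) \<in> ?R" for i
    proof -
      have "gen (\<epsilon> \<star> i) - gen \<epsilon> \<in> ?R"
        using comm_group.relators_diff[OF cg that] mult[OF EE_e EE_e] by simp
      hence "\<epsilon> \<star> i = \<epsilon>" using comm_group.relators_eq[OF cg finG] scE EE_e by (simp add: Gs)
      thus ?thesis by simp
    qed
    show "act x F \<in> ?R \<longleftrightarrow> F \<in> ?R" for x F by (rule actR)
    show "act x (F + H) = act x F + act x H" for x F H by (simp add: act_def fun_eq_iff)
    show "tt x y z u v = tt y z x u v" for x y z u v by (rule tt_rot)
    show "tt (x \<cdot> x') y z u v = tt x y z u v + tt x' y z u v" for x x' y z u v by (rule tt_lin1)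
  qed (simp_all add: comm_group.relators_zero[OF cg] comm_group.relators_diff[OF cg] tt_def B_lin EE_N0 EE_ass)
  show ?thesis
  proof (rule nucI1)
    fix u v
    have "B (ass x y z) u v = 0" using associator_calculus_defect.t_zero[OF A] by (simp add: tt_def)
    thus "(ass x y z \<cdot> u) \<cdot> v = ass x y z \<cdot> (u \<cdot> v)" using r1[OF EE_N0[OF EE_ass], of x y z u v] by simp
  qed
qed

end

section \<open>Counting: central involutions in loops of 2-power order\<close>

lemma even_card_partition:
  assumes "finite X" "pairwise disjnt C" "\<Union> C = X" "\<And>c. c \<in> C \<Longrightarrow> even (card c)"
  shows "even (card X)"
proof -
  have "card (\<Union> C) = sum card C"
    using assms by (intro card_Union_disjoint) (auto intro: finite_subset)
  moreover have "even (sum card C)" using assms(4) by (intro dvd_sum) auto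
  ultimately show ?thesis using assms(3) by simp
qed

lemma even_card_involution:
  assumes "finite X" "\<And>x. x \<in> X \<Longrightarrow> i x \<in> X \<and> i (i x) = x \<and> i x \<noteq> x"
  shows "even (card X)"
proof (rule even_card_partition[OF assms(1), of "(\<lambda>x. {x, i x}) ` X"])
  show "pairwise disjnt ((\<lambda>x. {x, i x}) ` X)"
    unfolding pairwise_def disjnt_def
  proof (intro ballI impI)
    fix A B assume "A \<in> (\<lambda>x. {x, i x}) ` X" "B \<in> (\<lambda>x. {x, i x}) ` X" "A \<noteq> B"
    then obtain x y where xy: "x \<in> X" "y \<in> X" "A = {x, i x}" "B = {y, i y}" "A \<noteq> B" by blast
    have i: "i (i x) = x" "i (i y) = y" using assms(2) xy(1,2) by blast+
    have "x \<noteq> y" using xy(3-5) by blast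
    moreover have "x \<noteq> i y" using xy(3-5) i by (metis insert_commute)
    moreover have "i x \<noteq> y" using xy(3-5) i by (metis insert_commute)
    moreover have "i x \<noteq> i y" using i calculation(1) by metis
    ultimately show "A \<inter> B = {}" using xy by blast
  qed
  show "\<Union> ((\<lambda>x. {x, i x}) ` X) = X" using assms(2) by blast
  show "even (card c)" if "c \<in> (\<lambda>x. {x, i x}) ` X" for c
    using that assms(2) by fastforce
qed

lemma card_eq_fibres:
  assumes "finite A" "\<And>b. b \<in> f ` A \<Longrightarrow> card {a \<in> A. f a = b} = c"
  shows "card A = card (f ` A) * c"
proof -
  have "card A = (\<Sum>b\<in>f ` A. \<Sum>a\<in>{a \<in> A. f a = b}. 1)"
    using sum.image_gen[OF assms(1), of "\<lambda>_. 1::nat" f] by simp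
  also have "\<dots> = (\<Sum>b\<in>f ` A. c)" by (rule sum.cong) (simp_all add: assms(2))
  finally show ?thesis by simp
qed

context total_buchsteiner begin

lemma cj_mul: "n \<in> nuc \<Longrightarrow> cj (x \<cdot> y) n = cj y (cj x n)"
proof -
  assume n: "n \<in> nuc"
  have n': "cj x n \<in> nuc" "cj y (cj x n) \<in> nuc" using nuc_conj n by (auto simp: cj_def)
  have "n \<cdot> (x \<cdot> y) = (x \<cdot> y) \<cdot> cj y (cj x n)"
    by (metis cj_eq n n' nucD)
  thus ?thesis by (simp add: cj_def[of "x \<cdot> y"])
qed

lemma cj_nuc: "n \<in> nuc \<Longrightarrow> cj x n \<in> nuc" by (simp add: cj_def nuc_conj)
lemma cj_e [simp]: "cj \<epsilon> n = n" "cj x \<epsilon> = \<epsilon>" by (simp_all add: cj_def)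

lemma nuc_ld: assumes n: "n \<in> nuc" shows "n \<setminus> \<epsilon> \<in> nuc"
proof (rule nucI1)
  fix r s
  have "n \<cdot> ((n \<setminus> \<epsilon> \<cdot> r) \<cdot> s) = n \<cdot> (n \<setminus> \<epsilon> \<cdot> (r \<cdot> s))"
    by (simp add: nucD(1)[OF n, symmetric])
  thus "n \<setminus> \<epsilon> \<cdot> r \<cdot> s = n \<setminus> \<epsilon> \<cdot> (r \<cdot> s)" by simp
qed

lemma nuc_inv: "n \<in> nuc \<Longrightarrow> n \<setminus> \<epsilon> \<cdot> n = \<epsilon>"
  by (metis mul_ld nucD(1) e_mul mul_e mul_lcancel)

lemma card_nuc_coset: "card ((\<lambda>n. x \<cdot> n) ` nuc) = card nuc"
  by (rule card_image) (simp add: inj_on_def)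

text \<open>Lagrange's theorem holds for the nucleus because its left cosets partition the
  loop.\<close>

lemma card_nuc_dvd:
  assumes fin: "finite (UNIV :: 'q set)"
  shows "card nuc dvd card (UNIV :: 'q set)"
proof -
  define f where "f x = (\<lambda>n. x \<cdot> n) ` nuc" for x
  have "{a \<in> UNIV. f a = f x} = f x" for x
  proof (intro equalityI subsetI)
    fix a assume "a \<in> {a \<in> UNIV. f a = f x}"
    moreover have "a \<in> f a" unfolding f_def by (rule image_eqI[of _ _ \<epsilon>]) simp_all
    ultimately show "a \<in> f x" by simp
  next
    fix a assume "a \<in> f x"
    then obtain n where n: "n \<in> nuc" "a = x \<cdot> n" by (auto simp: f_def)
    have "f a = f x"
    proof (intro equalityI subsetI)
      fix b assume "b \<in> f a"
      then obtain m where "m \<in> nuc" "b = (x \<cdot> n) \<cdot> m" using n by (auto simp: f_def)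
      thus "b \<in> f x" unfolding f_def using n by (intro image_eqI[of _ _ "n \<cdot> m"]) (simp_all add: nuc_mul nucD)
    next
      fix b assume "b \<in> f x"
      then obtain m where m: "m \<in> nuc" "b = x \<cdot> m" by (auto simp: f_def)
      have "(x \<cdot> n) \<cdot> (n \<setminus> \<epsilon> \<cdot> m) = x \<cdot> (n \<cdot> (n \<setminus> \<epsilon> \<cdot> m))" by (simp add: nucD(2)[OF n(1)])
      also have "\<dots> = b" by (simp add: nucD(1)[OF n(1), symmetric] m)
      finally show "b \<in> f a" unfolding f_def using n m
        by (intro image_eqI[of _ _ "n \<setminus> \<epsilon> \<cdot> m"]) (simp_all add: nuc_mul nuc_ld)
    qed
    thus "a \<in> {a \<in> UNIV. f a = f x}" by simp
  qed
  hence "card {a \<in> UNIV. f a = b} = card nuc" if "b \<in> f ` UNIV" for b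
    using that card_nuc_coset by (auto simp: f_def)
  from card_eq_fibres[OF fin this] show ?thesis by simp
qed

text \<open>Orbit-stabiliser for conjugation of nuclear elements: the fibres of the orbit map are
  right translates of the stabiliser.\<close>

lemma card_orbit_dvd:
  assumes fin: "finite (UNIV :: 'q set)" and n: "n \<in> nuc"
  shows "card (range (\<lambda>x. cj x n)) dvd card (UNIV :: 'q set)"
proof -
  have fib: "{a. cj a n = cj x n} = (\<lambda>s. s \<cdot> x) ` {s. cj s n = n}" for x
  proof (intro equalityI subsetI)
    fix a assume a: "a \<in> {a. cj a n = cj x n}"
    have "cj x (cj (a \<oslash> x) n) = cj x n" using a cj_mul[OF n, of "a \<oslash> x" x] by simp
    hence "cj (a \<oslash> x) n = n" by simp
    thus "a \<in> (\<lambda>s. s \<cdot> x) ` {s. cj s n = n}" by (intro image_eqI[of _ _ "a \<oslash> x"]) simp_all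
  qed (use n in \<open>auto simp: cj_mul\<close>)
  have "card {a \<in> UNIV. cj a n = b} = card {s. cj s n = n}" if b: "b \<in> range (\<lambda>x. cj x n)" for b
  proof -
    obtain x where "b = cj x n" using b by blast
    thus ?thesis using fib[of x] by (simp add: card_image inj_on_def)
  qed
  from card_eq_fibres[OF fin this] show ?thesis by simp
qed

text \<open>The class equation. The nucleus has even order and its nontrivial conjugation orbits
  have even size, so the fixed elements are even in number; inversion then pairs off those with
  nontrivial square.\<close>

lemma central_involution:
  assumes card: "card (UNIV :: 'q set) = 2 ^ m" and ne: "nuc \<noteq> {\<epsilon>}"
  obtains k where "k \<in> nuc" "\<And>x. k \<cdot> x = x \<cdot> k" "k \<cdot> k = \<epsilon>" "k \<noteq> \<epsilon>"
proof -
  have fin: "finite (UNIV :: 'q set)" by (rule card_ge_0_finite) (simp add: card)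
  have finite: "finite A" for A :: "'q set" by (rule finite_subset[OF subset_UNIV fin])
  have pow: "d = 1 \<or> even d" if "d dvd card (UNIV :: 'q set)" for d
    using that coprime_common_divisor[of d "2 ^ m" d] unfolding card by (cases "even d") auto
  define orb where "orb n = range (\<lambda>x. cj x n)" for n
  define F where "F = {n \<in> nuc. \<forall>x. cj x n = n}"
  have nO: "n \<in> orb n" for n unfolding orb_def by (rule range_eqI[of _ _ \<epsilon>]) simp
  have Oeq: "orb m = orb n" if nm: "n \<in> nuc" "m \<in> orb n" for m n
  proof -
    obtain x where x: "m = cj x n" using nm by (auto simp: orb_def)
    have "cj y m = cj (x \<cdot> y) n" for y using nm x by (simp add: cj_mul)
    moreover have "cj y n = cj (x \<setminus> y) m" for y using cj_mul[OF nm(1), of x "x \<setminus> y"] x by simp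
    ultimately show ?thesis unfolding orb_def by (metis (no_types, lifting) rangeE range_eqI subsetI subset_antisym)
  qed
  have evn: "even (card nuc)"
  proof -
    have "card nuc \<noteq> 1" using ne e_nuc by (metis card_1_singletonE singletonD)
    thus ?thesis using pow[OF card_nuc_dvd[OF fin]] by blast
  qed
  have "even (card (nuc - F))"
  proof (rule even_card_partition[OF finite, of "orb ` (nuc - F)"])
    show "pairwise disjnt (orb ` (nuc - F))"
      unfolding pairwise_def disjnt_def
    proof (intro ballI impI)
      fix A B assume "A \<in> orb ` (nuc - F)" "B \<in> orb ` (nuc - F)" "A \<noteq> B"
      then obtain m n where mn: "m \<in> nuc" "n \<in> nuc" "A = orb m" "B = orb n" "A \<noteq> B" by blast
      show "A \<inter> B = {}"
      proof (rule ccontr)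
        assume "A \<inter> B \<noteq> {}"
        then obtain l where "l \<in> orb m" "l \<in> orb n" using mn by blast
        thus False using Oeq[of m l] Oeq[of n l] mn by simp
      qed
    qed
    have sub: "orb n \<subseteq> nuc - F" if n: "n \<in> nuc - F" for n
    proof
      fix m assume m: "m \<in> orb n"
      hence "m \<in> nuc" using n by (auto simp: orb_def cj_nuc)
      moreover have "m \<notin> F"
      proof
        assume "m \<in> F"
        hence "orb m = {m}" by (auto simp: orb_def F_def)
        hence "n = m" using Oeq[OF _ m] nO[of n] n by auto
        thus False using \<open>m \<in> F\<close> n by blast
      qed
      ultimately show "m \<in> nuc - F" by blast
    qed
    show "\<Union> (orb ` (nuc - F)) = nuc - F" using sub nO by blast
    show "even (card c)" if c: "c \<in> orb ` (nuc - F)" for c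
    proof -
      obtain n where n: "n \<in> nuc" "n \<notin> F" "c = orb n" using c by blast
      have "card c \<noteq> 1"
      proof
        assume "card c = 1"
        hence "orb n = {n}" using n nO[of n] by (metis card_1_singletonE singletonD)
        hence "cj x n = n" for x unfolding orb_def by (metis rangeI singletonD)
        thus False using n by (simp add: F_def)
      qed
      thus ?thesis using pow[OF card_orbit_dvd[OF fin n(1)]] n by (auto simp: orb_def)
    qed
  qed
  moreover have "card nuc = card F + card (nuc - F)"
    using card_Un_disjoint[of F "nuc - F"] finite by (simp add: F_def Un_absorb1 Collect_mono Int_Diff)
  ultimately have evF: "even (card F)" using evn by simp
  have inv: "cj x (n \<setminus> \<epsilon>) = n \<setminus> \<epsilon>" if n: "n \<in> F" for x n
  proof -
    have nn: "n \<in> nuc" and c: "x \<cdot> n = n \<cdot> x" using n cj_eq[of n x] by (auto simp: F_def)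
    have "n \<cdot> (n \<setminus> \<epsilon> \<cdot> x) = n \<cdot> (x \<cdot> (n \<setminus> \<epsilon>))"
      by (metis c e_mul mul_e mul_ld nn nucD(1,2))
    hence "n \<setminus> \<epsilon> \<cdot> x = x \<cdot> (n \<setminus> \<epsilon>)" by simp
    thus ?thesis by (simp add: cj_def)
  qed
  have invinv: "n \<setminus> \<epsilon> \<setminus> \<epsilon> = n" if "n \<in> nuc" for n
    using nuc_inv[OF that] by (simp add: ld_eq_iff)
  \<comment> \<open>The self-inverse fixed elements: even in number and including
    \<open>\<epsilon>\<close>, so there is another one.\<close>
  define S where "S = {n \<in> F. n \<cdot> n = \<epsilon>}"
  have "even (card (F - S))"
  proof (rule even_card_involution[OF finite, of _ "\<lambda>n. n \<setminus> \<epsilon>"])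
    fix n assume n: "n \<in> F - S"
    hence nn: "n \<in> nuc" by (simp add: F_def)
    have "n \<setminus> \<epsilon> \<noteq> n" using n by (auto simp: S_def ld_eq_iff)
    moreover have "n \<setminus> \<epsilon> \<notin> S"
    proof
      assume "n \<setminus> \<epsilon> \<in> S"
      hence "n \<setminus> \<epsilon> \<setminus> \<epsilon> = n \<setminus> \<epsilon>" by (auto simp: S_def ld_eq_iff)
      thus False using invinv[OF nn] calculation by simp
    qed
    ultimately show "n \<setminus> \<epsilon> \<in> F - S \<and> n \<setminus> \<epsilon> \<setminus> \<epsilon> = n \<and> n \<setminus> \<epsilon> \<noteq> n"
      using n nn inv by (auto simp: F_def nuc_ld invinv)
  qed
  moreover have "card F = card S + card (F - S)"
    using card_Un_disjoint[of S "F - S"] finite by (simp add: S_def Un_absorb1 Collect_mono Int_Diff)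
  ultimately have "even (card S)" using evF by simp
  moreover have "\<epsilon> \<in> S" by (simp add: S_def F_def)
  ultimately have "S \<noteq> {\<epsilon>}" "\<epsilon> \<in> S" by auto
  then obtain k where k: "k \<in> S" "k \<noteq> \<epsilon>" by blast
  show ?thesis
  proof (rule that[of k])
    show "k \<cdot> x = x \<cdot> k" for x using k cj_eq[of k x] by (simp add: S_def F_def)
  qed (use k in \<open>auto simp: S_def F_def\<close>)
qed

end

section \<open>Descent through central quotients up to order 32\<close>

lemma buchsteiner_step:
  fixes mul :: "'q::finite \<Rightarrow> 'q \<Rightarrow> 'q"
  assumes IH: "\<And>(mul' :: 'r::finite \<Rightarrow> 'r \<Rightarrow> 'r) ld' rd' e' x y z. total_buchsteiner mul' ld' rd' e' \<Longrightarrow>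
      total_buchsteiner.ass mul' ld' x y z \<in> total_loop.nuc mul'"
    and Q: "total_buchsteiner mul ld rd e"
    and card: "card (UNIV :: 'q set) = 2 ^ m" and half: "card (UNIV :: 'q set) = 2 * card (UNIV :: 'r set)"
  shows "total_buchsteiner.ass mul ld x y z \<in> total_loop.nuc mul"
proof -
  interpret total_buchsteiner mul ld rd e by (rule Q)
  show ?thesis
  proof (cases "nuc = {e}")
    case True
    have "ass x y z = e" unfolding ass_def using group_if_nuc_trivial[OF True] by simp
    thus ?thesis using e_nuc by metis
  next
    case False
    obtain k where k: "k \<in> nuc" "\<And>x. mul k x = mul x k" "mul k k = e" "k \<noteq> e"
      by (rule central_involution[OF card False]) (rule that)
    define p where "p x = {x, mul x k}" for x
    have xkk: "mul (mul x k) k = x" for x by (simp add: nucD(3)[OF k(1)] k(3))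
    have ne: "mul x k \<noteq> x" for x using k(4) by simp
    have peq: "p x = p y \<longleftrightarrow> y = x \<or> y = mul x k" for x y
      unfolding p_def using xkk by (metis doubleton_eq_iff)
    have "card (UNIV :: 'q set) = card (range p) * 2"
    proof (rule card_eq_fibres)
      fix b assume "b \<in> range p"
      then obtain x where "b = p x" by blast
      hence "{a \<in> UNIV. p a = b} = {x, mul x k}" using peq by (auto simp: p_def xkk)
      thus "card {a \<in> UNIV. p a = b} = 2" using ne[of x, symmetric] by (simp only: card_2_iff) blast
    qed simp
    hence "card (range p) = card (UNIV :: 'r set)" using half by simp
    then obtain h where h: "bij_betw h (range p) (UNIV :: 'r set)"
      using finite_same_card_bij[of "range p" "UNIV :: 'r set"] by auto
    define \<pi> where "\<pi> x = h (p x)" for x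
    have pieq: "\<pi> x = \<pi> y \<longleftrightarrow> y = x \<or> y = mul x k" for x y
      unfolding \<pi>_def peq[symmetric] using h by (auto simp: bij_betw_def inj_on_def)
    have surj: "surj \<pi>" using h unfolding \<pi>_def bij_betw_def by (metis image_image)
    define sec where "sec = Hilbert_Choice.inv \<pi>"
    have ps [simp]: "\<pi> (sec r) = r" for r using surj by (simp add: sec_def surj_f_inv_f)
    have sp: "sec (\<pi> x) = x \<or> sec (\<pi> x) = mul x k" for x using pieq[of x "sec (\<pi> x)"] by simp
    have pk: "\<pi> (mul x k) = \<pi> x" for x using pieq[of x "mul x k"] by simp
    define mul' where "mul' r s = \<pi> (mul (sec r) (sec s))" for r s
    define ld' where "ld' r s = \<pi> (ld (sec r) (sec s))" for r s
    define rd' where "rd' r s = \<pi> (rd (sec r) (sec s))" for r s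
    have kl: "mul (mul x k) y = mul (mul x y) k" for x y by (metis k(1,2) nucD(2,3))
    have kr: "mul x (mul y k) = mul (mul x y) k" for x y by (simp add: nucD[OF k(1)])
    have pm: "\<pi> (mul x y) = mul' (\<pi> x) (\<pi> y)" for x y
    proof -
      have "\<pi> (mul (mul x k) (mul y k)) = \<pi> (mul x y)" "\<pi> (mul x (mul y k)) = \<pi> (mul x y)"
        "\<pi> (mul (mul x k) y) = \<pi> (mul x y)" using kl[of x "mul y k"] kl[of x y] kr[of x y] pk by metis+
      thus ?thesis unfolding mul'_def using sp[of x] sp[of y] by metis
    qed
    have pl: "\<pi> (ld x y) = ld' (\<pi> x) (\<pi> y)" for x y
    proof -
      have 1: "ld (mul x k) y = mul (ld x y) k" "ld x (mul y k) = mul (ld x y) k" for x y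
        unfolding ld_eq_iff kr by (simp_all add: kl[of x "ld x y"] xkk)
      have "\<pi> (ld (mul x k) (mul y k)) = \<pi> (ld x y)" "\<pi> (ld x (mul y k)) = \<pi> (ld x y)"
        "\<pi> (ld (mul x k) y) = \<pi> (ld x y)" unfolding 1 pk by (rule refl)+
      thus ?thesis unfolding ld'_def using sp[of x] sp[of y] by metis
    qed
    have pr: "\<pi> (rd x y) = rd' (\<pi> x) (\<pi> y)" for x y
    proof -
      have 1: "rd y (mul x k) = mul (rd y x) k" "rd (mul y k) x = mul (rd y x) k" for x y
        unfolding rd_eq_iff kr by (simp_all add: kl[of "rd y x" x] xkk)
      have "\<pi> (rd (mul x k) (mul y k)) = \<pi> (rd x y)" "\<pi> (rd x (mul y k)) = \<pi> (rd x y)"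
        "\<pi> (rd (mul x k) y) = \<pi> (rd x y)" unfolding 1 pk by (rule refl)+
      thus ?thesis unfolding rd'_def using sp[of x] sp[of y] by metis
    qed
    have Q': "total_buchsteiner mul' ld' rd' (\<pi> e)"
    proof unfold_locales
      fix r s t
      obtain x where [simp]: "r = \<pi> x" using surj by (rule surjE)
      obtain y where [simp]: "s = \<pi> y" using surj by (rule surjE)
      obtain z where [simp]: "t = \<pi> z" using surj by (rule surjE)
      show "mul' r (ld' r s) = s" "ld' r (mul' r s) = s" "mul' (rd' s r) r = s" "rd' (mul' s r) r = s"
        "mul' r (\<pi> e) = r" "mul' (\<pi> e) r = r"
        "ld' r (mul' (mul' r s) t) = rd' (mul' s (mul' t r)) r"
        by (simp_all flip: pm pl pr add: buch)
    qed
    have i: "involution_loop mul ld rd e k"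
      by (intro involution_loop.intro involution_loop_axioms.intro; fact Q k(1) k(2) k(3) k(4))
    have "central_ext mul ld rd e k mul' ld' rd' (\<pi> e) \<pi>"
      by (intro central_ext.intro central_ext_axioms.intro; fact i Q' pm surj pieq IH[OF Q'])
    from central_ext.ass_nuc[OF this] show ?thesis by simp
  qed
qed

lemma card_UNIV_prod: "card (UNIV :: ('x \<times> 'y) set) = card (UNIV :: 'x set) * card (UNIV :: 'y set)"
  by (simp add: UNIV_Times_UNIV[symmetric] card_cartesian_product del: UNIV_Times_UNIV)

text \<open>Loops live on whole types and each central quotient lives on a type of half the size.
  The induction on the order is therefore unrolled along powers of \<open>bool\<close>.\<close>

theorem buchsteiner_ass_nuc_32:
  fixes mul :: "bool \<times> bool \<times> bool \<times> bool \<times> bool \<Rightarrow> _"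
  assumes "total_buchsteiner mul ld rd e"
  shows "total_buchsteiner.ass mul ld x y z \<in> total_loop.nuc mul"
proof -
  have 0: "total_buchsteiner.ass mul ld x y z \<in> total_loop.nuc mul" if "total_buchsteiner mul ld rd e"
    for mul :: "unit \<Rightarrow> unit \<Rightarrow> unit" and ld rd e x y z
  proof -
    interpret total_buchsteiner mul ld rd e by (rule that)
    show ?thesis by (simp add: nuc_def)
  qed
  note [simp] = card_UNIV_prod
  have 1: "total_buchsteiner.ass mul ld x y z \<in> total_loop.nuc mul" if "total_buchsteiner mul ld rd e"
    for mul :: "bool \<Rightarrow> bool \<Rightarrow> bool" and ld rd e x y z
    by (rule buchsteiner_step[where m = 1, OF 0 that]) simp_all
  have 2: "total_buchsteiner.ass mul ld x y z \<in> total_loop.nuc mul" if "total_buchsteiner mul ld rd e"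
    for mul :: "bool \<times> bool \<Rightarrow> bool \<times> bool \<Rightarrow> bool \<times> bool" and ld rd e x y z
    by (rule buchsteiner_step[where m = 2, OF 1 that]) simp_all
  have 3: "total_buchsteiner.ass mul ld x y z \<in> total_loop.nuc mul" if "total_buchsteiner mul ld rd e"
    for mul :: "bool \<times> bool \<times> bool \<Rightarrow> bool \<times> bool \<times> bool \<Rightarrow> bool \<times> bool \<times> bool" and ld rd e x y z
    by (rule buchsteiner_step[where m = 3, OF 2 that]) simp_all
  have 4: "total_buchsteiner.ass mul ld x y z \<in> total_loop.nuc mul" if "total_buchsteiner mul ld rd e"
    for mul :: "bool \<times> bool \<times> bool \<times> bool \<Rightarrow> bool \<times> bool \<times> bool \<times> bool \<Rightarrow> bool \<times> bool \<times> bool \<times> bool" and ld rd e x y z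
    by (rule buchsteiner_step[where m = 4, OF 3 that]) simp_all
  show ?thesis by (rule buchsteiner_step[where m = 5, OF 4 assms]) simp_all
qed

section \<open>Exact calculus: associators as a module over the loop\<close>

locale associator_module = total_loop mul ld rd e +
  associator_calculus mul R act f "\<lambda>_ :: bit. 0" "\<lambda>_ _ _ _ _. 0"
  for mul :: "'q \<Rightarrow> 'q \<Rightarrow> 'q"  (infixl \<open>\<cdot>\<close> 70)
    and ld :: "'q \<Rightarrow> 'q \<Rightarrow> 'q"  (infixl \<open>\<setminus>\<close> 70)
    and rd :: "'q \<Rightarrow> 'q \<Rightarrow> 'q"  (infixl \<open>\<oslash>\<close> 70)
    and e :: 'q  (\<open>\<epsilon>\<close>)
    and R :: "'e::ab_group_add set" and act f +
  assumes act_hom: "act (u \<cdot> v) a = act v (act u a)"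
    and act_e [simp]: "act \<epsilon> a = a"
begin

definition cong (infix \<open>\<approx>\<close> 50) where "a \<approx> b \<longleftrightarrow> a - b \<in> R"

lemma cg_refl [simp]: "a \<approx> a" by (simp add: cong_def R_zero)
lemma cg_sym: "a \<approx> b \<Longrightarrow> b \<approx> a" using R_uminus[of "a - b"] by (simp add: cong_def)
lemma cg_trans [trans]: "a \<approx> b \<Longrightarrow> b \<approx> c \<Longrightarrow> a \<approx> c" using R_add[of "a - b" "b - c"] by (simp add: cong_def)
lemma cg_add: "a \<approx> b \<Longrightarrow> c \<approx> d \<Longrightarrow> a + c \<approx> b + d"
  using R_add[of "a - b" "c - d"] by (simp add: cong_def algebra_simps)
lemma cg_diff: "a \<approx> b \<Longrightarrow> c \<approx> d \<Longrightarrow> a - c \<approx> b - d"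
  using R_diff[of "a - b" "c - d"] by (simp add: cong_def algebra_simps)
lemma cg_uminus: "a \<approx> b \<Longrightarrow> - a \<approx> - b" using cg_diff[of 0 0 a b] by simp
lemma cg_act: "act u a \<approx> act u b \<longleftrightarrow> a \<approx> b" by (simp add: cong_def act_R flip: act_diff)
lemma cg_actI: "a \<approx> b \<Longrightarrow> act u a \<approx> act u b" by (simp add: cg_act)
lemma cg_D: "a \<approx> b \<longleftrightarrow> D c (a - b)" by (simp add: cong_def D_def)
lemma D_iff: "D c d \<longleftrightarrow> d \<in> R" by (simp add: D_def)
lemma cg_by: "a \<approx> b \<Longrightarrow> a - b = c - d \<Longrightarrow> c \<approx> d" by (simp add: cong_def)

lemma act_inv [simp]: "act u (act (\<epsilon> \<oslash> u) a) = a" by (simp flip: act_hom)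

text \<open>The effect of \<open>u\<close> on an associator; by \<open>mul1\<close> it is also the
  deviation from additivity. The following lemmas show that it is symmetric in all four
  arguments.\<close>

definition h where "h x y z u = act u (f x y z) - f x y z"

lemma mul1: "f (x \<cdot> y) z u \<approx> f x z u + f y z u + h x y z u"
  using DE[of x y z u] by (simp add: cong_def D_iff Ebar_def h_def algebra_simps)

lemma rot1: "f y z x \<approx> - act x (f x y z)"
  using Drot[of y z x] by (simp add: cong_def D_iff)

lemma rot3: "f x y z \<approx> - act z (act y (act x (f x y z)))"
  using Drot3[of x y z] by (simp add: cong_def D_iff)

lemma mul3: "f x y (w \<cdot> z) \<approx> f x y z + act z (f x y w)"
  using D3[of x y w z] by (simp add: cong_def D_iff algebra_simps)

lemma h_cyc: "h x y z u \<approx> - act u (h u x y z)"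
proof -
  have 1: "h x y z u \<approx> Ebar x y z u" for x y z u
    using cg_sym[OF mul1[of x y z u]] by (simp add: cong_def Ebar_def algebra_simps)
  have 2: "Ebar x y z u \<approx> - act u (Ebar u x y z)" using DEcyc[of x y z u] by (simp add: cong_def D_iff)
  show ?thesis by (rule cg_trans[OF 1 cg_trans[OF 2 cg_uminus[OF cg_actI[OF cg_sym[OF 1]]]]])
qed

text \<open>After a cyclic shift of \<open>h\<close>, \<open>u\<close> becomes an argument and
  \<open>z\<close> the acting element; rotating back turns the action of \<open>z\<close> into that
  of its conjugate \<open>z'\<close>.\<close>

lemma star: assumes z: "z \<cdot> u = u \<cdot> z'" shows "h x y z u \<approx> act z' (f x y u) - f x y u"
proof -
  have "act u (h u x y z) = act z' (act u (f u x y)) - act u (f u x y)"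
    by (simp add: h_def act_diff z flip: act_hom)
  moreover have r: "act u (f u x y) \<approx> - f x y u" using cg_uminus[OF rot1[of x y u]] by (simp add: cg_sym)
  ultimately have "act u (h u x y z) \<approx> act z' (- f x y u) - (- f x y u)"
    using cg_diff[OF cg_actI[OF r, of z'] r] by simp
  from cg_trans[OF h_cyc cg_uminus[OF this]] show ?thesis by (simp add: act_uminus)
qed

text \<open>Evaluate \<open>h x y z (u \<cdot> w)\<close> twice: as a cocycle in the acting element,
  and by \<open>star\<close> with the third-argument rule \<open>mul3\<close>.\<close>

lemma conj_inv:
  assumes 1: "z \<cdot> w = w \<cdot> z3" and 2: "z \<cdot> (u \<cdot> w) = (u \<cdot> w) \<cdot> z2"
  shows "act z3 (f x y w) \<approx> act z2 (f x y w)"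
proof -
  define z1 where "z1 = u \<setminus> (z \<cdot> u)"
  have z1: "z \<cdot> u = u \<cdot> z1" by (simp add: z1_def)
  have Z: "act z2 (act w b) = act w (act z1 b)" for b
  proof -
    obtain a where b: "b = act u a" by (metis act_inv)
    have "act z2 (act w (act u a)) = act w (act u (act z a))" using 2 by (metis act_hom)
    also have "act u (act z a) = act z1 (act u a)" using z1 by (metis act_hom)
    finally show ?thesis by (simp add: b)
  qed
  have "h x y z (u \<cdot> w) = act w (h x y z u) + h x y z w" by (simp add: h_def act_hom act_diff)
  moreover have 3: "act w (h x y z u) + h x y z w \<approx>
      act w (act z1 (f x y u) - f x y u) + (act z3 (f x y w) - f x y w)"
    by (intro cg_add cg_actI star z1 1)
  moreover have 4: "act z2 (f x y (u \<cdot> w)) - f x y (u \<cdot> w) \<approx>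
      act z2 (f x y w + act w (f x y u)) - (f x y w + act w (f x y u))"
    by (intro cg_diff cg_actI mul3)
  ultimately have "act w (act z1 (f x y u) - f x y u) + (act z3 (f x y w) - f x y w) \<approx>
      act z2 (f x y w + act w (f x y u)) - (f x y w + act w (f x y u))"
    using cg_trans[OF cg_sym[OF 3] cg_trans[OF _ 4]] star[OF 2, of x y] by simp
  thus ?thesis by (simp add: act_add act_diff Z cong_def algebra_simps)
qed

text \<open>In \<open>conj_inv\<close>, choose \<open>z\<close> and \<open>u\<close> to be
  conjugated by \<open>w\<close> to \<open>r \<cdot> t\<close> and \<open>r\<close>. The two sides
  then act by \<open>r\<close> and \<open>t\<close> in opposite orders.\<close>

lemma comm: "act t (act r (f x y w)) \<approx> act r (act t (f x y w))"
proof -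
  define z where "z = (w \<cdot> (r \<cdot> t)) \<oslash> w"
  define u where "u = (w \<cdot> r) \<oslash> w"
  define z2 where "z2 = (u \<cdot> w) \<setminus> (z \<cdot> (u \<cdot> w))"
  have 1: "z \<cdot> w = w \<cdot> (r \<cdot> t)" and 2: "z \<cdot> (u \<cdot> w) = (u \<cdot> w) \<cdot> z2" and 3: "u \<cdot> w = w \<cdot> r"
    by (simp_all add: z_def u_def z2_def)
  have "act z2 b = act r (act t b)" for b
  proof -
    obtain a where b: "b = act r (act w a)" by (metis act_inv)
    have "act z2 (act r (act w a)) = act r (act w (act z a))" using 2 unfolding 3 by (metis act_hom)
    also have "act w (act z a) = act t (act r (act w a))" using 1 by (metis act_hom)
    finally show ?thesis by (simp add: b)
  qed
  thus ?thesis using conj_inv[OF 1 2, of x y] by (simp add: act_hom)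
qed

lemma comm3: "act t (act s (act r (f x y w))) \<approx> act s (act t (act r (f x y w)))"
proof -
  let ?m = "f x y w"
  have "act t (act s (act r ?m)) \<approx> act r (act t (act s ?m))"
    using comm[of "s \<cdot> t" r x y w] by (simp add: act_hom)
  also have "\<dots> \<approx> act r (act s (act t ?m))" by (intro cg_actI comm)
  also have "\<dots> \<approx> act s (act t (act r ?m))"
    using comm[of r "t \<cdot> s" x y w] by (simp add: act_hom)
  finally show ?thesis .
qed

lemma h_swap34: "h x y z u \<approx> h x y u z"
proof -
  define z' where "z' = u \<setminus> (z \<cdot> u)"
  have z': "z \<cdot> u = u \<cdot> z'" by (simp add: z'_def)
  have "act z' (act u (act (\<epsilon> \<oslash> u) (f x y u))) = act u (act z (act (\<epsilon> \<oslash> u) (f x y u)))"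
    using z' by (metis act_hom)
  also have "\<dots> \<approx> act z (act u (act (\<epsilon> \<oslash> u) (f x y u)))" by (rule comm3)
  finally have "act z' (f x y u) - f x y u \<approx> act z (f x y u) - f x y u"
    by (intro cg_diff) simp_all
  thus ?thesis using cg_trans[OF star[OF z']] by (simp add: h_def[of _ _ _ z])
qed

lemma h_swap23: "h x y z u \<approx> h x z y u"
proof -
  have "h x y z u \<approx> - act u (h u x y z)" by (rule h_cyc)
  also have "\<dots> \<approx> - act u (h u x z y)" by (intro cg_uminus cg_actI h_swap34)
  also have "\<dots> \<approx> h x z y u" by (rule cg_sym[OF h_cyc])
  finally show ?thesis .
qed

lemma h_swap12_act: "h x y z u \<approx> - act y (h y x z u)"
  by (rule cg_trans[OF h_swap23 cg_trans[OF h_swap34 h_cyc]])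

lemma h_comm: "act t (act s (h x y z u)) \<approx> act s (act t (h x y z u))"
  using cg_diff[OF comm3[of t s u x y z] comm[of t s x y z]] by (simp add: h_def act_diff)

lemma h_act_act: "h x y z u \<approx> act y (act x (h x y z u))"
  using cg_trans[OF h_swap12_act[of x y z u] cg_uminus[OF cg_actI[OF h_swap12_act[of y x z u], of y]]]
  by (simp add: act_uminus)

text \<open>The symmetries found so far show that acting by \<open>y\<close> and then
  \<open>z\<close> fixes \<open>h x y z u\<close>. Three rotations show that acting by
  \<open>x\<close>, \<open>y\<close> and \<open>z\<close> in turn negates it.\<close>

lemma h_act1: "act x (h x y z u) \<approx> - h x y z u"
proof -
  let ?h = "h x y z u"
  have "?h \<approx> - act y (h y x z u)" by (rule h_swap12_act)
  also have "\<dots> \<approx> - act y (act z (act y (h y x z u)))"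
  proof (intro cg_uminus cg_actI)
    have "h y x z u \<approx> h y z x u" by (rule h_swap23)
    also have "\<dots> \<approx> act z (act y (h y z x u))" by (rule h_act_act)
    also have "\<dots> \<approx> act z (act y (h y x z u))" by (intro cg_actI h_swap23)
    finally show "h y x z u \<approx> act z (act y (h y x z u))" .
  qed
  also have "\<dots> \<approx> - act z (act y (act y (h y x z u)))"
  proof -
    have "act y (act z (act y m)) - act z (act y (act y m)) \<in> R" if "m = h y x z u" for m
    proof -
      have "act z (act y (act y m)) \<approx> act y (act z (act y m))"
        using cg_diff[OF comm3[of "y" "z" "u \<cdot> y" y x z] comm3[of y z y y x z]]
        by (simp add: that h_def act_diff act_hom cg_sym)
      thus ?thesis using cg_sym by (simp add: cong_def)
    qed
    thus ?thesis using cg_uminus by (simp add: cong_def)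
  qed
  also have "\<dots> \<approx> act z (act y ?h)"
    using cg_actI[OF cg_actI[OF cg_sym[OF h_swap12_act[of x y z u]], of y], of z] by (simp add: act_uminus)
  finally have 1: "?h \<approx> act z (act y ?h)" .
  have "?h \<approx> - act z (act y (act x ?h))"
  proof -
    let ?m = "f x y z"
    have "act u ?m \<approx> - act u (act z (act y (act x ?m)))" using cg_actI[OF rot3[of x y z], of u] by (simp add: act_uminus)
    also have "\<dots> \<approx> - act z (act y (act x (act u ?m)))"
      using cg_uminus[OF comm[of u "x \<cdot> y \<cdot> z" x y z]] by (simp add: act_hom)
    finally have "act u ?m \<approx> - act z (act y (act x (act u ?m)))" .
    thus ?thesis by (rule cg_by[OF cg_diff[OF _ rot3[of x y z]]]) (simp add: h_def act_diff)
  qed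
  also have "\<dots> \<approx> - act x (act z (act y ?h))"
  proof (rule cg_uminus)
    have "act z (act y (act x ?h)) = act (y \<cdot> z) (act x ?h)" by (simp add: act_hom)
    also have "\<dots> \<approx> act x (act (y \<cdot> z) ?h)" by (rule h_comm)
    finally show "act z (act y (act x ?h)) \<approx> act x (act z (act y ?h))" by (simp add: act_hom)
  qed
  also have "\<dots> \<approx> - act x ?h" by (rule cg_uminus[OF cg_actI[OF cg_sym[OF 1]]])
  finally show ?thesis using cg_uminus cg_sym by fastforce
qed

lemma h_swap12: "h x y z u \<approx> h y x z u"
  using cg_trans[OF h_swap12_act cg_uminus[OF h_act1]] by simp

lemma mul1_comm: "f (x \<cdot> y) z u \<approx> f (y \<cdot> x) z u"
proof -
  have "f (x \<cdot> y) z u \<approx> f x z u + f y z u + h x y z u" by (rule mul1)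
  also have "\<dots> \<approx> f y z u + f x z u + h y x z u"
    using cg_add[OF cg_refl h_swap12, of "f x z u + f y z u"] by (simp add: add.commute)
  also have "\<dots> \<approx> f (y \<cdot> x) z u" by (rule cg_sym[OF mul1])
  finally show ?thesis .
qed

text \<open>Actions commute on associators, so a commutator \<open>k\<close> acts trivially on
  \<open>f (y \<cdot> x) z u\<close>. By symmetry \<open>h\<close> vanishes with \<open>k\<close> as
  an argument, and \<open>f\<close> is additive on
  \<open>(y \<cdot> x) \<cdot> k = x \<cdot> y\<close>. But \<open>f\<close> does not distinguish
  \<open>x \<cdot> y\<close> from \<open>y \<cdot> x\<close>.\<close>

lemma commutator_zero: "f ((y \<cdot> x) \<setminus> (x \<cdot> y)) z u \<approx> 0"
proof -
  define k where "k = (y \<cdot> x) \<setminus> (x \<cdot> y)"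
  have k: "(y \<cdot> x) \<cdot> k = x \<cdot> y" by (simp add: k_def)
  let ?m = "f (y \<cdot> x) z u" and ?r = "\<epsilon> \<oslash> (y \<cdot> x)"
  have "act k ?m = act k (act (y \<cdot> x) (act ?r ?m))" by simp
  also have "\<dots> = act y (act x (act ?r ?m))" using k by (metis act_hom)
  also have "\<dots> \<approx> act x (act y (act ?r ?m))" by (rule comm3)
  also have "\<dots> = ?m" by (metis act_inv act_hom)
  finally have "h (y \<cdot> x) z u k \<approx> 0" by (simp add: h_def cong_def)
  moreover have "h (y \<cdot> x) k z u \<approx> h (y \<cdot> x) z u k" by (rule cg_trans[OF h_swap23 h_swap34])
  ultimately have "h (y \<cdot> x) k z u \<approx> 0" by (rule cg_trans[rotated])
  from cg_add[OF cg_refl this, of "?m + f k z u"] have 1: "f ((y \<cdot> x) \<cdot> k) z u \<approx> ?m + f k z u"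
    using cg_trans[OF mul1] by simp
  have "?m \<approx> ?m + f k z u" using cg_trans[OF mul1_comm[of y x z u] 1[unfolded k]] .
  thus ?thesis unfolding k_def[symmetric] by (simp add: cong_def R_uminus) (metis R_uminus minus_minus)
qed

lemma mul3': "f x y (w \<cdot> v) \<approx> f x y w + f x y v + h x y w v"
  using mul3[of x y w v] by (simp add: h_def algebra_simps)

lemma mul2: "f x (w \<cdot> v) z \<approx> f x w z + f x v z + h x w v z"
proof -
  have "f x (w \<cdot> v) z \<approx> - act z (f z x (w \<cdot> v))" by (rule rot1)
  also have "\<dots> \<approx> - act z (f z x w + f z x v + h z x w v)" by (intro cg_uminus cg_actI mul3')
  also have "\<dots> = - act z (f z x w) + - act z (f z x v) + - act z (h z x w v)" by (simp add: act_add)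
  also have "\<dots> \<approx> f x w z + f x v z + h x w v z"
    by (intro cg_add cg_sym[OF rot1] cg_sym[OF h_cyc])
  finally show ?thesis .
qed

text \<open>The antisymmetric part in the first two arguments. The \<open>h\<close> terms cancel in
  it, so unlike \<open>f\<close> it is additive; its vanishing will mean conjugacy
  closedness.\<close>

definition s where "s x y z = f x y z - f y x z"

lemma s_self [simp]: "s x x z = 0" by (simp add: s_def)
lemma s_swap: "s y x z = - s x y z" by (simp add: s_def)

lemma s_mul1: "s (x \<cdot> u) y z \<approx> s x y z + s u y z"
proof -
  have "h x u y z \<approx> h y x u z" by (rule cg_trans[OF h_swap23 h_swap12])
  from cg_add[OF cg_diff[OF mul1[of x u y z] mul2[of y x u z]] this]
  show ?thesis by (simp add: s_def cong_def algebra_simps)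
qed

lemma s_mul3: "s x y (w \<cdot> v) \<approx> s x y w + s x y v"
  using cg_add[OF cg_diff[OF mul3'[of x y w v] mul3'[of y x w v]] h_swap12[of x y w v]]
  by (simp add: s_def cong_def algebra_simps)

lemma s_xyx: "s x y x \<approx> f (x \<cdot> x) y x"
proof -
  have "f (x \<cdot> x) y x \<approx> f x y x + f x y x + h x x y x" by (rule mul1)
  also have "\<dots> \<approx> f x y x + f x y x + h x y x x" by (intro cg_add cg_refl h_swap23)
  also have "\<dots> = f x y x - - act x (f x y x)" by (simp add: h_def)
  also have "\<dots> \<approx> s x y x" unfolding s_def by (intro cg_diff cg_refl cg_sym[OF rot1])
  finally show ?thesis by (rule cg_sym)
qed

text \<open>\<open>c\<close> will be the map to nuclear cosets. A nonzero \<open>s x y z\<close>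
  forces \<open>\<epsilon>\<close>, \<open>x\<close>, \<open>y\<close> and
  \<open>x \<cdot> y\<close> into four different classes, so they exhaust all classes. Then
  \<open>z\<close> lies in one of them, and \<open>s x y\<close> vanishes on each.\<close>

lemma s_zero_if_small:
  assumes f: "\<And>x x' y z. c x = c x' \<Longrightarrow> f x y z = f x' y z \<and> f y x z = f y x' z \<and> f y z x = f y z x'"
    and e: "\<And>y z. f \<epsilon> y z \<approx> 0 \<and> f y \<epsilon> z \<approx> 0 \<and> f y z \<epsilon> \<approx> 0"
    and c: "\<And>x y z. c (x \<cdot> y) = c (x \<cdot> z) \<longleftrightarrow> c y = c z" "\<And>x y z. c (y \<cdot> x) = c (z \<cdot> x) \<longleftrightarrow> c y = c z"
    and fin: "finite (range c)" and card: "card (range c) \<le> 4"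
  shows "s x y z \<approx> 0"
proof (rule ccontr)
  assume ne: "\<not> s x y z \<approx> 0"
  have sc: "s x y z = s x' y z" "s y x z = s y x' z" "s y z x = s y z x'" if "c x = c x'" for x x' y z
    using f[OF that] by (simp_all add: s_def)
  have se: "s \<epsilon> y z \<approx> 0" "s y \<epsilon> z \<approx> 0" "s y z \<epsilon> \<approx> 0" for y z
    using e cg_diff[of _ 0 _ 0] by (simp_all add: s_def)
  have cx: "c (x \<cdot> y) = c x \<longleftrightarrow> c y = c \<epsilon>" "c (x \<cdot> y) = c y \<longleftrightarrow> c x = c \<epsilon>" for x y
    using c(1)[of x y \<epsilon>] c(2)[of x y \<epsilon>] by simp_all
  have 1: "c x \<noteq> c \<epsilon>" "c y \<noteq> c \<epsilon>" using ne sc se by metis+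
  have 2: "c x \<noteq> c y" using ne sc s_self cg_refl by metis
  have s_sq: "s (x \<cdot> x) x z \<approx> 0" for x z using s_mul1[of x x x z] by simp
  have 3: "c (x \<cdot> y) \<noteq> c \<epsilon>"
  proof
    assume "c (x \<cdot> y) = c \<epsilon>"
    hence "s (x \<cdot> y) y z = s \<epsilon> y z" by (rule sc)
    moreover have "s (x \<cdot> y) y z \<approx> s x y z" using s_mul1[of x y y z] by simp
    ultimately show False using ne se cg_sym cg_trans by metis
  qed
  have "card {c \<epsilon>, c x, c y, c (x \<cdot> y)} = 4" using 1 2 3 cx[of x y] by auto
  hence G: "range c = {c \<epsilon>, c x, c y, c (x \<cdot> y)}"
    using card fin by (intro card_seteq[symmetric]) auto
  \<comment> \<open>The square of \<open>x\<close> lies in the class of \<open>\<epsilon>\<close>,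
    where \<open>s_xyx\<close> applies, or in that of \<open>y\<close>, where \<open>s y x\<close>
    agrees with \<open>s (x \<cdot> x) x\<close>, which vanishes by alternation.\<close>
  have sq: "s x y x \<approx> 0" if xy: "c x \<noteq> c \<epsilon>" "c x \<noteq> c y" "range c = {c \<epsilon>, c x, c y, c (x \<cdot> y)}" for x y
  proof -
    have "c (x \<cdot> x) \<in> {c \<epsilon>, c x, c y, c (x \<cdot> y)}" using xy(3) by blast
    moreover have "c (x \<cdot> x) \<noteq> c x" "c (x \<cdot> x) \<noteq> c (x \<cdot> y)" using xy cx c by metis+
    ultimately consider "c (x \<cdot> x) = c \<epsilon>" | "c (x \<cdot> x) = c y" by blast
    thus ?thesis
    proof cases
      case 1
      hence "f (x \<cdot> x) y x = f \<epsilon> y x" using f by blast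
      thus ?thesis using s_xyx[of x y] e cg_trans by metis
    next
      case 2
      hence "s (x \<cdot> x) x x = s y x x" by (rule sc)
      thus ?thesis using s_sq[of x x] s_swap[of x y x] cg_uminus by fastforce
    qed
  qed
  have x0: "s x y x \<approx> 0" using sq[of x y] 1 2 G by blast
  have "c (y \<cdot> x) = c (x \<cdot> y)"
  proof -
    have "c (y \<cdot> x) \<in> {c \<epsilon>, c x, c y, c (x \<cdot> y)}" using G by blast
    moreover have "c (y \<cdot> x) \<noteq> c x" "c (y \<cdot> x) \<noteq> c y" using 1 cx by metis+
    moreover have "c (y \<cdot> x) \<noteq> c \<epsilon>"
    proof
      assume "c (y \<cdot> x) = c \<epsilon>"
      hence "s (y \<cdot> x) y z = s \<epsilon> y z" by (rule sc)
      moreover have "s (y \<cdot> x) y z \<approx> s x y z" using s_mul1[of y x y z] by simp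
      ultimately show False using ne se cg_sym cg_trans by metis
    qed
    ultimately show ?thesis by blast
  qed
  hence "s y x y \<approx> 0" using sq[of y x] 1 2 G by (metis insert_commute)
  hence y0: "s x y y \<approx> 0" using cg_uminus[of "s y x y" 0] s_swap[of x y y] by simp
  have xy0: "s x y (x \<cdot> y) \<approx> 0" using cg_trans[OF s_mul3 cg_add[OF x0 y0]] by simp
  have "c z \<in> {c \<epsilon>, c x, c y, c (x \<cdot> y)}" using G by blast
  thus False using ne x0 y0 xy0 se sc(3) by (metis (no_types, lifting) empty_iff insert_iff)
qed

end

section \<open>The centre of the nucleus as a conjugation-invariant abelian group\<close>

context total_buchsteiner begin

lemma cj_nuc_hom: assumes "m \<in> nuc" "n \<in> nuc" shows "cj v (m \<cdot> n) = cj v m \<cdot> cj v n"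
proof -
  have "(m \<cdot> n) \<cdot> v = v \<cdot> (cj v m \<cdot> cj v n)"
    using cj_nuc[OF assms(1), of v] cj_nuc[OF assms(2), of v] assms by (metis cj_eq nucD(1,3))
  thus ?thesis by (simp add: cj_def)
qed

lemma nuc_move: "n \<in> nuc \<Longrightarrow> (x \<cdot> n) \<cdot> y = (x \<cdot> y) \<cdot> cj y n"
  by (simp add: nucD(2) cj_eq[of n y] nucD(3)[OF cj_nuc])

definition cent where "cent = {c \<in> nuc. \<forall>n\<in>nuc. c \<cdot> n = n \<cdot> c}"

lemma centD: "c \<in> cent \<Longrightarrow> c \<in> nuc" "c \<in> cent \<Longrightarrow> n \<in> nuc \<Longrightarrow> c \<cdot> n = n \<cdot> c"
  by (simp_all add: cent_def)

lemma cent_mul: assumes c: "c \<in> cent" and d: "d \<in> cent" shows "c \<cdot> d \<in> cent"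
proof -
  have "(c \<cdot> d) \<cdot> n = n \<cdot> (c \<cdot> d)" if n: "n \<in> nuc" for n
  proof -
    have "(c \<cdot> d) \<cdot> n = c \<cdot> (n \<cdot> d)" by (simp only: nucD(3)[OF n, of c d] centD(2)[OF d n])
    also have "\<dots> = (n \<cdot> c) \<cdot> d" by (simp only: nucD(3)[OF centD(1)[OF d], of c n, symmetric] centD(2)[OF c n])
    also have "\<dots> = n \<cdot> (c \<cdot> d)" by (rule nucD(1)[OF n])
    finally show ?thesis .
  qed
  thus ?thesis using nuc_mul[OF centD(1)[OF c] centD(1)[OF d]] unfolding cent_def by blast
qed

lemma cent_e: "\<epsilon> \<in> cent" by (simp add: cent_def)

lemma cent_ld: assumes c: "c \<in> cent" shows "c \<setminus> \<epsilon> \<in> cent"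
proof -
  have i: "c \<setminus> \<epsilon> \<in> nuc" "c \<in> nuc" using centD(1)[OF c] by (simp_all add: nuc_ld)
  have "(c \<setminus> \<epsilon>) \<cdot> n = n \<cdot> (c \<setminus> \<epsilon>)" if n: "n \<in> nuc" for n
  proof -
    have "c \<cdot> ((c \<setminus> \<epsilon>) \<cdot> n) = n" using nucD(1)[OF i(2), of "c \<setminus> \<epsilon>" n] by simp
    moreover have "c \<cdot> (n \<cdot> (c \<setminus> \<epsilon>)) = n" by (metis centD(2) c i n nucD(1) mul_ld mul_e)
    ultimately show ?thesis by (metis mul_lcancel)
  qed
  thus ?thesis using i unfolding cent_def by blast
qed

lemma ci_nuc: "a \<in> nuc \<Longrightarrow> ci v a \<in> nuc" by (simp add: ci_def nuc_conj')

lemma cent_cj: assumes c: "c \<in> cent" shows "cj v c \<in> cent"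
proof -
  have "cj v c \<cdot> n = n \<cdot> cj v c" if n: "n \<in> nuc" for n
    using cj_nuc_hom[OF centD(1)[OF c] ci_nuc[OF n], of v v] cj_nuc_hom[OF ci_nuc[OF n] centD(1)[OF c], of v v]
      centD(2)[OF c ci_nuc[OF n], of v] unfolding cj_ci by metis
  thus ?thesis using cj_nuc[OF centD(1)[OF c]] unfolding cent_def by blast
qed

lemma cent_ci: assumes c: "c \<in> cent" shows "ci v c \<in> cent"
proof -
  have n: "ci v c \<in> nuc" using centD(1)[OF c] by (rule ci_nuc)
  have "ci v c \<cdot> m = m \<cdot> ci v c" if m: "m \<in> nuc" for m
  proof -
    have "cj v (ci v c \<cdot> m) = cj v (m \<cdot> ci v c)"
      unfolding cj_nuc_hom[OF n m] cj_nuc_hom[OF m n] cj_ci by (rule centD(2)[OF c cj_nuc[OF m]])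
    thus ?thesis unfolding cj_inj .
  qed
  thus ?thesis using n unfolding cent_def by blast
qed

end

section \<open>Loops with nuclear associators\<close>

locale nuclear_buchsteiner = total_buchsteiner mul ld rd e
  for mul :: "'q \<Rightarrow> 'q \<Rightarrow> 'q"  (infixl \<open>\<cdot>\<close> 70)
    and ld :: "'q \<Rightarrow> 'q \<Rightarrow> 'q"  (infixl \<open>\<setminus>\<close> 70)
    and rd :: "'q \<Rightarrow> 'q \<Rightarrow> 'q"  (infixl \<open>\<oslash>\<close> 70)
    and e :: 'q  (\<open>\<epsilon>\<close>) +
  assumes ass_nuc: "ass x y z \<in> nuc" and fin: "finite (UNIV :: 'q set)"
begin

text \<open>On the nucleus conjugation is a genuine action, so the two bracketings of
  \<open>x, y, z\<close> conjugate alike and the associator between them acts trivially.\<close>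

lemma ass_cent: "ass x y z \<in> cent"
proof -
  have "ass x y z \<cdot> n = n \<cdot> ass x y z" if n: "n \<in> nuc" for n
  proof -
    define w where "w = x \<cdot> (y \<cdot> z)"
    define m where "m = ci w n"
    have m: "m \<in> nuc" using n by (simp add: m_def ci_nuc)
    have "cj (ass x y z) (cj w m) = cj (w \<cdot> ass x y z) m" by (simp add: cj_mul m)
    also have "\<dots> = cj ((x \<cdot> y) \<cdot> z) m" unfolding w_def ass_eq[symmetric] ..
    also have "\<dots> = cj w m" using m by (simp add: w_def cj_mul cj_nuc)
    finally have "cj (ass x y z) n = n" by (simp add: m_def)
    thus ?thesis using cj_eq[of n "ass x y z"] by simp
  qed
  thus ?thesis using ass_nuc unfolding cent_def by blast
qed

lemma ass_pent: "ass x y (z \<cdot> u) \<cdot> ass (x \<cdot> y) z u = (ass y z u \<cdot> ass x (y \<cdot> z) u) \<cdot> cj u (ass x y z)"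
proof -
  define W where "W = x \<cdot> (y \<cdot> (z \<cdot> u))"
  note n = nucD[OF ass_nuc] and n' = cj_nuc[OF ass_nuc, THEN nucD(3)]
  have "((x \<cdot> y) \<cdot> z) \<cdot> u = ((x \<cdot> (y \<cdot> z)) \<cdot> ass x y z) \<cdot> u" unfolding ass_eq[symmetric] ..
  also have "\<dots> = ((x \<cdot> (y \<cdot> z)) \<cdot> u) \<cdot> cj u (ass x y z)" by (rule nuc_move[OF ass_nuc])
  also have "(x \<cdot> (y \<cdot> z)) \<cdot> u = (x \<cdot> ((y \<cdot> (z \<cdot> u)) \<cdot> ass y z u)) \<cdot> ass x (y \<cdot> z) u"
    unfolding ass_eq[of y z u, symmetric] ass_eq[symmetric] ..
  also have "x \<cdot> ((y \<cdot> (z \<cdot> u)) \<cdot> ass y z u) = W \<cdot> ass y z u" unfolding W_def n(3) ..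
  finally have "((x \<cdot> y) \<cdot> z) \<cdot> u = W \<cdot> ((ass y z u \<cdot> ass x (y \<cdot> z) u) \<cdot> cj u (ass x y z))"
    unfolding n n' .
  moreover have "((x \<cdot> y) \<cdot> z) \<cdot> u = W \<cdot> (ass x y (z \<cdot> u) \<cdot> ass (x \<cdot> y) z u)"
    unfolding W_def n(3)[symmetric] ass_eq[symmetric] ..
  ultimately show ?thesis by (metis mul_lcancel)
qed

lemma ass_rot: "ass y z x \<cdot> cj x (ass x y z) = \<epsilon>"
proof -
  note n = nucD[OF ass_nuc] and n' = cj_nuc[OF ass_nuc, THEN nucD(3)]
  have "(x \<cdot> y) \<cdot> z = x \<cdot> ((y \<cdot> z) \<cdot> ass x y z)" unfolding n(3)[symmetric] by (rule ass_eq)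
  hence "((y \<cdot> z) \<cdot> ass x y z) \<cdot> x = y \<cdot> (z \<cdot> x)" using buch[of x y z] by (metis ld_mul rd_mul)
  hence "((y \<cdot> z) \<cdot> x) \<cdot> cj x (ass x y z) = y \<cdot> (z \<cdot> x)" unfolding nuc_move[OF ass_nuc] .
  hence "(y \<cdot> (z \<cdot> x)) \<cdot> (ass y z x \<cdot> cj x (ass x y z)) = y \<cdot> (z \<cdot> x)"
    unfolding n'[symmetric] ass_eq[symmetric] .
  thus ?thesis by simp
qed

abbreviation "G \<equiv> \<lparr>carrier = cent, monoid.mult = (\<cdot>), one = \<epsilon>\<rparr>"

lemma G_group: "comm_group G"
proof (rule comm_groupI)
  show "\<exists>y\<in>carrier G. y \<otimes>\<^bsub>G\<^esub> x = \<one>\<^bsub>G\<^esub>" if "x \<in> carrier G" for x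
    using that cent_ld[of x] nuc_inv[of x] centD(1)[of x] by auto
  show "x \<otimes>\<^bsub>G\<^esub> y \<otimes>\<^bsub>G\<^esub> z = x \<otimes>\<^bsub>G\<^esub> (y \<otimes>\<^bsub>G\<^esub> z)"
    if "x \<in> carrier G" "y \<in> carrier G" "z \<in> carrier G" for x y z using that centD(1) by (simp add: nucD)
  show "x \<otimes>\<^bsub>G\<^esub> y = y \<otimes>\<^bsub>G\<^esub> x" if "x \<in> carrier G" "y \<in> carrier G" for x y
    using that centD(1) by (simp add: centD(2)[of x y])
qed (simp_all add: cent_mul cent_e)

abbreviation "rel \<equiv> comm_group.relators G"

text \<open>Coefficients outside \<open>cent\<close> stay in place. This makes the action law hold
  for every formal sum, since \<open>ci_mul\<close> is available for nuclear elements.\<close>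

definition act where "act v F = (\<lambda>b. F (if b \<in> cent then ci v b else b) :: int)" for v and F :: "'q \<Rightarrow> int"

lemma ci_mul: assumes "b \<in> nuc" shows "ci (u \<cdot> v) b = ci u (ci v b)"
proof -
  have "b = cj (u \<cdot> v) (ci u (ci v b))" using assms by (simp add: cj_mul ci_nuc)
  thus ?thesis by (metis ci_cj)
qed

lemma act_gen: "c \<in> cent \<Longrightarrow> act v (gen c) = gen (cj v c)"
proof
  fix b assume c: "c \<in> cent"
  show "act v (gen c) b = gen (cj v c) b"
  proof (cases "b \<in> cent")
    case True
    have "ci v b = c \<longleftrightarrow> b = cj v c" using cj_ci ci_cj by metis
    thus ?thesis using True by (auto simp: act_def gen_def)
  qed (use c cent_cj[OF c, of v] in \<open>auto simp: act_def gen_def\<close>)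
qed

lemma finG: "finite (carrier G)" by (rule finite_subset[OF subset_UNIV fin])

lemma act_rel: "act v F \<in> rel \<longleftrightarrow> F \<in> rel"
proof -
  have "comm_group.ev G (act v F) = cj v (comm_group.ev G F)"
  proof (rule comm_group.ev_pushforward[OF G_group finG])
    show "cj v \<in> hom G G" by (simp add: hom_def cent_cj cj_nuc_hom centD)
    show "bij_betw (cj v) (carrier G) (carrier G)"
      by (rule bij_betwI[of _ _ _ "ci v"]) (simp_all add: cent_cj cent_ci)
  qed (simp add: act_def cent_cj)
  moreover have "cj v g = \<epsilon> \<longleftrightarrow> g = \<epsilon>" for g by (metis ci_cj cj_e(2))
  ultimately show ?thesis unfolding comm_group.relators_def[OF G_group] by simp
qed

lemma rel_mult: "a \<in> cent \<Longrightarrow> b \<in> cent \<Longrightarrow> gen a + gen b - gen (a \<cdot> b) \<in> rel"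
  using comm_group.relators_mult[OF G_group finG, of a b] by simp

lemma gen_e: "gen \<epsilon> \<in> rel" using rel_mult[OF cent_e cent_e] by simp

lemma rel_diff: "F \<in> rel \<Longrightarrow> H \<in> rel \<Longrightarrow> F - H \<in> rel"
  using comm_group.relators_diff[OF G_group] by simp

lemma module: "associator_module mul ld rd e rel act (\<lambda>x y z. gen (ass x y z))"
proof unfold_locales
  show "act (u \<cdot> v) F = act v (act u F)" for u v F
    by (auto simp: act_def fun_eq_iff ci_mul centD cent_ci)
  show "act e F = F" for F by (auto simp: act_def ci_def)
  thus "act (u \<cdot> v) (gen (ass x y z)) - act v (act u (gen (ass x y z))) - 0 \<in> rel" for u v x y z
    by (simp add: \<open>\<And>u v F. act (u \<cdot> v) F = act v (act u F)\<close> comm_group.relators_zero[OF G_group])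
  show "act x F \<in> rel \<longleftrightarrow> F \<in> rel" for x F by (rule act_rel)
  show "gen (ass y z x) + act x (gen (ass x y z)) - 0 \<in> rel" for x y z
    using rel_diff[OF rel_mult[OF ass_cent cent_cj[OF ass_cent], of y z x x x y z]
      rel_diff[OF comm_group.relators_zero[OF G_group] gen_e]]
    by (simp add: act_gen ass_cent ass_rot)
  show "gen (ass x y (z \<cdot> u)) + gen (ass (x \<cdot> y) z u) - gen (ass y z u) - gen (ass x (y \<cdot> z) u)
         - act u (gen (ass x y z)) - 0 \<in> rel" for x y z u
  proof -
    let ?g = "ass y z u" and ?h = "ass x (y \<cdot> z) u" and ?c = "cj u (ass x y z)"
    have "?g \<cdot> ?h \<in> cent" "?c \<in> cent" by (simp_all add: cent_mul ass_cent cent_cj)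
    from rel_diff[OF rel_diff[OF rel_mult[OF ass_cent ass_cent, of x y "z \<cdot> u" "x \<cdot> y" z u]
        rel_mult[OF ass_cent ass_cent, of y z u x "y \<cdot> z" u]] rel_mult[OF this]]
    show ?thesis by (simp add: ass_pent act_gen ass_cent algebra_simps)
  qed
qed (simp_all add: comm_group.relators_zero[OF G_group] comm_group.relators_diff[OF G_group] act_def fun_eq_iff
  comm_group.relators_zero[OF G_group, unfolded zero_fun_def])

lemma cong_iff: "associator_module.cong rel F H \<longleftrightarrow> comm_group.ev G F = comm_group.ev G H"
proof -
  interpret comm_group G by (rule G_group)
  have "ev (F - H) = \<epsilon> \<longleftrightarrow> ev F = ev H"
    using ev_diff[of F H] ev_closed[of F] ev_closed[of H] by (metis inv_equality inv_inv monoid.simps(1,2) r_inv inv_closed)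
  thus ?thesis unfolding associator_module.cong_def[OF module] by (simp add: relators_def)
qed

lemma ev_simps:
  "comm_group.ev G (F + H) = comm_group.ev G F \<cdot> comm_group.ev G H"
  "c \<in> cent \<Longrightarrow> comm_group.ev G (gen c) = c"
  "comm_group.ev G 0 = \<epsilon>"
  using comm_group.ev_add[OF G_group] comm_group.ev_gen[OF G_group finG] comm_group.ev_zero[OF G_group] by simp_all

lemma ass_mul1: "ass (x \<cdot> y) z u \<cdot> ass x y z = (ass x z u \<cdot> ass y z u) \<cdot> cj u (ass x y z)"
proof -
  have "associator_module.cong rel (gen (ass (x \<cdot> y) z u) + gen (ass x y z))
      (gen (ass x z u) + gen (ass y z u) + gen (cj u (ass x y z)))"
    by (rule associator_module.cg_by[OF module associator_module.mul1[OF module, of x y z u]])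
      (simp add: associator_module.h_def[OF module] act_gen ass_cent)
  thus ?thesis by (simp add: cong_iff ev_simps ass_cent cent_cj)
qed

text \<open>The symmetry of \<open>h\<close> under transpositions of neighbouring arguments, in
  multiplicative notation.\<close>

lemma ass_swap:
  "cj u (ass x y z) \<cdot> ass y x z = cj u (ass y x z) \<cdot> ass x y z"
  "cj u (ass x y z) \<cdot> ass x z y = cj u (ass x z y) \<cdot> ass x y z"
  "cj u (ass x y z) \<cdot> ass x y u = cj z (ass x y u) \<cdot> ass x y z"
proof -
  have 1: "cj u a \<cdot> b = cj v b \<cdot> a" if "associator_module.cong rel (act u (gen a) - gen a) (act v (gen b) - gen b)"
    "a \<in> cent" "b \<in> cent" for u v a b
  proof -
    have "associator_module.cong rel (gen (cj u a) + gen b) (gen (cj v b) + gen a)"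
      by (rule associator_module.cg_by[OF module that(1)]) (simp add: act_gen that)
    thus ?thesis by (simp add: cong_iff ev_simps that cent_cj)
  qed
  note h = associator_module.h_def[OF module]
  show "cj u (ass x y z) \<cdot> ass y x z = cj u (ass y x z) \<cdot> ass x y z"
    by (rule 1[OF associator_module.h_swap12[OF module, unfolded h] ass_cent ass_cent])
  show "cj u (ass x y z) \<cdot> ass x z y = cj u (ass x z y) \<cdot> ass x y z"
    by (rule 1[OF associator_module.h_swap23[OF module, unfolded h] ass_cent ass_cent])
  show "cj u (ass x y z) \<cdot> ass x y u = cj z (ass x y u) \<cdot> ass x y z"
    by (rule 1[OF associator_module.h_swap34[OF module, unfolded h] ass_cent ass_cent])
qed

text \<open>Together with nuclear associators this makes the quotient by the nucleus an abelian
  group.\<close>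

lemma commutator_nuc: "(y \<cdot> x) \<setminus> (x \<cdot> y) \<in> nuc"
proof (rule nucI1)
  fix z u
  have "ass ((y \<cdot> x) \<setminus> (x \<cdot> y)) z u = \<epsilon>"
    using associator_module.commutator_zero[OF module, of y x z u] by (simp add: cong_iff ev_simps ass_cent)
  thus "(y \<cdot> x) \<setminus> (x \<cdot> y) \<cdot> z \<cdot> u = (y \<cdot> x) \<setminus> (x \<cdot> y) \<cdot> (z \<cdot> u)"
    using ass_eq[of "(y \<cdot> x) \<setminus> (x \<cdot> y)" z u] by simp
qed

text \<open>Conjugation carries a nuclear factor to the right end of both bracketings, where it
  becomes the same element \<open>m\<close>; this \<open>m\<close> commutes with the
  associator.\<close>

lemma ass_nuc_mul: assumes n: "n \<in> nuc"
  shows "ass (x \<cdot> n) y z = ass x y z" "ass x (y \<cdot> n) z = ass x y z" "ass x y (z \<cdot> n) = ass x y z"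
proof -
  have key: "(W \<cdot> m) \<setminus> (V \<cdot> m) = ass x y z" if m: "m \<in> nuc" "W = x \<cdot> (y \<cdot> z)" "V = (x \<cdot> y) \<cdot> z" for m W V
  proof -
    have "(W \<cdot> m) \<cdot> ass x y z = W \<cdot> (m \<cdot> ass x y z)" by (rule nucD(3)[OF ass_nuc])
    also have "m \<cdot> ass x y z = ass x y z \<cdot> m" using centD(2)[OF ass_cent m(1)] by simp
    also have "W \<cdot> (ass x y z \<cdot> m) = V \<cdot> m" unfolding nucD(3)[OF m(1), symmetric] m(2,3) ass_eq[symmetric] ..
    finally show ?thesis by (simp add: ld_eq_iff)
  qed
  have c: "cj v n \<in> nuc" "cj v (cj w n) \<in> nuc" for v w using n by (simp_all add: cj_nuc)
  note 1 = nuc_move[OF n] and 2 = nuc_move[OF c(1)]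
  show "ass (x \<cdot> n) y z = ass x y z" unfolding ass_def[of "x \<cdot> n"] 1 2 cj_mul[OF n] by (rule key) (simp_all add: c)
  show "ass x (y \<cdot> n) z = ass x y z" unfolding ass_def[of x "y \<cdot> n"] nucD(3)[OF n, symmetric] 1 nucD(3)[OF c(1), symmetric]
    by (rule key) (simp_all add: c)
  show "ass x y (z \<cdot> n) = ass x y z" unfolding ass_def[of x y "z \<cdot> n"] nucD(3)[OF n, symmetric]
    by (rule key) (simp_all add: n)
qed

lemma ass_e [simp]: "ass \<epsilon> y z = \<epsilon>" "ass y \<epsilon> z = \<epsilon>" "ass y z \<epsilon> = \<epsilon>" by (simp_all add: ass_def)

lemma ass_of_nuc: assumes n: "n \<in> nuc" shows "ass n y z = \<epsilon>" "ass y n z = \<epsilon>" "ass y z n = \<epsilon>"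
  using ass_nuc_mul[OF n, of \<epsilon>] ass_nuc_mul(2)[OF n, of y \<epsilon>] ass_nuc_mul(3)[OF n, of y z \<epsilon>] by simp_all

definition coset where "coset x = (\<lambda>n. x \<cdot> n) ` nuc"

lemma coset_self: "x \<in> coset x" unfolding coset_def by (rule image_eqI[of _ _ \<epsilon>]) simp_all

lemma coset_mul_nuc: assumes n: "n \<in> nuc" shows "coset (x \<cdot> n) = coset x"
proof (intro equalityI subsetI)
  fix b assume "b \<in> coset (x \<cdot> n)"
  then obtain m where "m \<in> nuc" "b = (x \<cdot> n) \<cdot> m" by (auto simp: coset_def)
  thus "b \<in> coset x" unfolding coset_def using n by (intro image_eqI[of _ _ "n \<cdot> m"]) (simp_all add: nuc_mul nucD)
next
  fix b assume "b \<in> coset x"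
  then obtain m where m: "m \<in> nuc" "b = x \<cdot> m" by (auto simp: coset_def)
  have "(x \<cdot> n) \<cdot> (n \<setminus> \<epsilon> \<cdot> m) = x \<cdot> (n \<cdot> (n \<setminus> \<epsilon> \<cdot> m))" by (simp add: nucD(2)[OF n])
  also have "\<dots> = b" by (simp add: nucD(1)[OF n, symmetric] m)
  finally show "b \<in> coset (x \<cdot> n)" unfolding coset_def using n m
    by (intro image_eqI[of _ _ "n \<setminus> \<epsilon> \<cdot> m"]) (simp_all add: nuc_mul nuc_ld)
qed

lemma coset_eq: "coset x = coset y \<longleftrightarrow> (\<exists>n\<in>nuc. y = x \<cdot> n)"
proof
  assume "coset x = coset y"
  hence "y \<in> coset x" using coset_self by simp
  thus "\<exists>n\<in>nuc. y = x \<cdot> n" by (auto simp: coset_def)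
qed (auto simp: coset_mul_nuc)

lemma coset_eq_ld: "coset x = coset y \<longleftrightarrow> x \<setminus> y \<in> nuc"
  unfolding coset_eq by (metis ld_mul mul_ld)

lemma coset_fibres: "card (UNIV :: 'q set) = card (range coset) * card nuc"
proof (rule card_eq_fibres[OF fin])
  fix b assume "b \<in> range coset"
  then obtain x where "b = coset x" by blast
  have "a \<in> coset x \<longleftrightarrow> coset x = coset a" for a unfolding coset_eq by (auto simp: coset_def)
  hence "{a \<in> UNIV. coset a = b} = coset x" using \<open>b = coset x\<close> by blast
  thus "card {a \<in> UNIV. coset a = b} = card nuc" using card_nuc_coset by (simp add: coset_def)
qed

lemma ass_coset: assumes "coset x = coset x'"
  shows "ass x y z = ass x' y z" "ass y x z = ass y x' z" "ass y z x = ass y z x'"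
  using assms unfolding coset_eq by (auto simp: ass_nuc_mul)

lemma coset_mul: assumes "coset x = coset x'" "coset y = coset y'" shows "coset (x \<cdot> y) = coset (x' \<cdot> y')"
proof -
  obtain m n where mn: "m \<in> nuc" "n \<in> nuc" "x' = x \<cdot> m" "y' = y \<cdot> n" using assms unfolding coset_eq by blast
  have "x' \<cdot> y' = ((x \<cdot> y) \<cdot> cj y m) \<cdot> n" unfolding mn nucD(3)[OF mn(2), symmetric] nuc_move[OF mn(1)] ..
  thus ?thesis using mn by (simp add: coset_mul_nuc cj_nuc)
qed

lemma coset_comm: "coset (x \<cdot> y) = coset (y \<cdot> x)" unfolding coset_eq_ld by (rule commutator_nuc)
lemma coset_assoc: "coset ((x \<cdot> y) \<cdot> z) = coset (x \<cdot> (y \<cdot> z))"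
  by (metis ass_eq ass_nuc coset_mul_nuc)

lemma coset_e: "coset x = coset \<epsilon> \<longleftrightarrow> x \<in> nuc"
  by (metis coset_eq_ld e_ld)

lemma coset_lcancel: "coset (x \<cdot> y) = coset (x \<cdot> z) \<longleftrightarrow> coset y = coset z"
proof
  assume "coset (x \<cdot> y) = coset (x \<cdot> z)"
  then obtain n where n: "n \<in> nuc" "x \<cdot> z = (x \<cdot> y) \<cdot> n" unfolding coset_eq by blast
  hence "z = y \<cdot> n" by (simp add: nucD(3))
  thus "coset y = coset z" using n by (auto simp: coset_eq)
qed (rule coset_mul[OF refl])

lemma coset_rcancel: "coset (y \<cdot> x) = coset (z \<cdot> x) \<longleftrightarrow> coset y = coset z"
  using coset_comm[of x] coset_lcancel by metis

lemma ass_sym_if_small: assumes "card (range coset) \<le> 4" shows "ass x y z = ass y x z"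
proof -
  have "associator_module.cong rel (associator_module.s (\<lambda>x y z. gen (ass x y z)) x y z) 0"
  proof (rule associator_module.s_zero_if_small[OF module, of coset])
    show "gen (ass x y z) = gen (ass x' y z) \<and> gen (ass y x z) = gen (ass y x' z) \<and> gen (ass y z x) = gen (ass y z x')"
      if "coset x = coset x'" for x x' y z unfolding ass_coset[OF that] by blast
    show "finite (range coset)" by (rule finite_imageI[OF fin])
  qed (auto simp: assms coset_lcancel coset_rcancel cong_iff ev_simps cent_e)
  hence "associator_module.cong rel (gen (ass x y z)) (gen (ass y x z))"
    by (rule associator_module.cg_by[OF module]) (simp add: associator_module.s_def[OF module])
  thus ?thesis by (simp add: cong_iff ev_simps ass_cent)
qed

end

declare mult_bit_eq_and [simp del]

context nuclear_buchsteiner begin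

text \<open>With trivial conjugation on the nucleus, rotation makes associators cyclically invariant
  and of exponent two. Moving \<open>z\<close> past \<open>x\<close> and \<open>y\<close> in turn
  expresses the commutator of \<open>x \<cdot> y\<close> with \<open>z\<close> by those of
  \<open>x\<close> and \<open>y\<close> and by \<open>ass x z y\<close>. Since
  \<open>x \<cdot> y\<close> and \<open>y \<cdot> x\<close> differ by a central element, exchanging
  \<open>x\<close> and \<open>y\<close> preserves this commutator, and only the associator can
  change.\<close>

lemma ass_sym_if_central:
  assumes c: "\<And>n x. n \<in> nuc \<Longrightarrow> cj x n = n"
  shows "ass x y z = ass y x z"
proof -
  have comm: "m \<cdot> n = n \<cdot> m" if "m \<in> nuc" for m n using cj_eq[of m n] c[OF that, of n] by simp
  have rot: "ass y z x \<cdot> ass x y z = \<epsilon>" for x y z using ass_rot[of y z x] c[OF ass_nuc, of x x y z] by simp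
  have cyc: "ass z x y = ass x y z" for x y z
  proof -
    have "ass z x y = ass z x y \<cdot> (ass y z x \<cdot> ass x y z)" by (simp add: rot)
    also have "\<dots> = (ass z x y \<cdot> ass y z x) \<cdot> ass x y z" by (rule nucD(1)[OF ass_nuc, symmetric])
    finally show ?thesis by (simp add: rot)
  qed
  have sq: "ass x y z \<cdot> ass x y z = \<epsilon>" for x y z using rot[of y z x] cyc[of y z x] cyc[of z x y] by simp
  define C where "C x y = (y \<cdot> x) \<setminus> (x \<cdot> y)" for x y
  have C: "C x y \<in> nuc" "x \<cdot> y = (y \<cdot> x) \<cdot> C x y" for x y by (simp_all add: C_def commutator_nuc)
  have main: "(x \<cdot> y) \<cdot> z = (z \<cdot> (x \<cdot> y)) \<cdot> ((C x z \<cdot> C y z) \<cdot> ass x z y)" for x y z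
  proof -
    let ?M = "C x z" and ?K = "C y z" and ?f = "ass x y z" and ?g = "ass x z y" and ?W = "z \<cdot> (x \<cdot> y)"
    note nM = nucD[OF C(1)[of x z]] and nK = nucD[OF C(1)[of y z]]
      and nf = nucD[OF ass_nuc[of x y z]] and ng = nucD[OF ass_nuc[of x z y]]
    have 1: "(z \<cdot> x) \<cdot> y = ?W \<cdot> ?f" using ass_eq[of z x y] cyc[of z x y] by simp
    have 2: "(x \<cdot> z) \<cdot> y = (?W \<cdot> ?f) \<cdot> ?M"
      using nuc_move[OF C(1), of "z \<cdot> x" x z y] c[OF C(1), of y x z] C(2)[of x z] 1 by simp
    have 3: "x \<cdot> (z \<cdot> y) = ((x \<cdot> z) \<cdot> y) \<cdot> ?g"
    proof -
      have "((x \<cdot> z) \<cdot> y) \<cdot> ?g = (x \<cdot> (z \<cdot> y)) \<cdot> (?g \<cdot> ?g)" unfolding ng(3)[symmetric] ass_eq[symmetric] ..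
      thus ?thesis by (simp add: sq)
    qed
    have 4: "x \<cdot> (y \<cdot> z) = (x \<cdot> (z \<cdot> y)) \<cdot> ?K" unfolding nK(3)[of x "z \<cdot> y"] C(2)[of y z, symmetric] ..
    have "(x \<cdot> y) \<cdot> z = ((((?W \<cdot> ?f) \<cdot> ?M) \<cdot> ?g) \<cdot> ?K) \<cdot> ?f"
      using ass_eq[of x y z] unfolding 4 3 2 .
    also have "\<dots> = ?W \<cdot> ((((?f \<cdot> ?M) \<cdot> ?g) \<cdot> ?K) \<cdot> ?f)" 
      unfolding nM(3)[of ?W] ng(3)[of ?W] nK(3)[of ?W] nf(3)[of ?W] ..
    also have "(((?f \<cdot> ?M) \<cdot> ?g) \<cdot> ?K) \<cdot> ?f = ?f \<cdot> (((?f \<cdot> ?M) \<cdot> ?g) \<cdot> ?K)"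
      by (rule comm[OF ass_nuc, symmetric])
    also have "\<dots> = ((?M \<cdot> ?g) \<cdot> ?K)" 
      unfolding nf(1) nf(1)[of ?f, symmetric] sq e_mul ..
    also have "\<dots> = (?M \<cdot> ?K) \<cdot> ?g" unfolding nM(1) comm[OF ass_nuc, of x z y ?K] by (rule refl)
    finally show ?thesis .
  qed
  let ?c = "C x y" and ?D = "C x z \<cdot> C y z"
  have D: "C y z \<cdot> C x z = ?D" by (rule comm[OF C(1)])
  have "(x \<cdot> y) \<cdot> z = ((y \<cdot> x) \<cdot> z) \<cdot> ?c"
    using nuc_move[OF C(1), of "y \<cdot> x" x y z] c[OF C(1), of z x y] C(2)[of x y] by simp
  also have "(y \<cdot> x) \<cdot> z = (z \<cdot> (y \<cdot> x)) \<cdot> (?D \<cdot> ass y z x)" unfolding main[of y x z] D ..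
  also have "\<dots> \<cdot> ?c = ((z \<cdot> (y \<cdot> x)) \<cdot> ?c) \<cdot> (?D \<cdot> ass y z x)"
    unfolding nucD(3)[OF C(1)[of x y], of "z \<cdot> (y \<cdot> x)"] nucD(2)[OF C(1)[of x y], of "z \<cdot> (y \<cdot> x)"]
      comm[OF C(1), of x y "?D \<cdot> ass y z x"] ..
  also have "(z \<cdot> (y \<cdot> x)) \<cdot> ?c = z \<cdot> (x \<cdot> y)" unfolding nucD(3)[OF C(1), of z "y \<cdot> x"] C(2)[of x y, symmetric] ..
  finally have "(z \<cdot> (x \<cdot> y)) \<cdot> (?D \<cdot> ass x z y) = (z \<cdot> (x \<cdot> y)) \<cdot> (?D \<cdot> ass y z x)" unfolding main[of x y z] .
  hence "ass x z y = ass y z x" by simp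
  thus ?thesis using cyc[where x = x and y = y and z = z] cyc[where x = y and y = z and z = x]
    cyc[where x = x and y = z and z = y] cyc[where x = z and y = y and z = x] by metis
qed

end

section \<open>Nucleus of order four: the associator and commutator forms\<close>

locale four_nucleus = involution_loop mul ld rd e k + nuclear_buchsteiner mul ld rd e
  for mul :: "'q \<Rightarrow> 'q \<Rightarrow> 'q"  (infixl \<open>\<cdot>\<close> 70)
    and ld :: "'q \<Rightarrow> 'q \<Rightarrow> 'q"  (infixl \<open>\<setminus>\<close> 70)
    and rd :: "'q \<Rightarrow> 'q \<Rightarrow> 'q"  (infixl \<open>\<oslash>\<close> 70)
    and e :: 'q  (\<open>\<epsilon>\<close>)
    and k :: 'q +
  fixes n :: 'q
  assumes nuc_eq: "nuc = {\<epsilon>, k, n, n \<cdot> k}" and n_ne: "n \<noteq> \<epsilon>" "n \<noteq> k"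
    and card32: "card (UNIV :: 'q set) = 32"
    and moved: "\<exists>x. cj x n \<noteq> n"
begin

text \<open>The homomorphism from the nucleus to bits with kernel generated by \<open>k\<close>.
  Conjugation can only multiply \<open>n\<close> by a power of \<open>k\<close>, so
  \<open>lam\<close> and \<open>chi\<close> together describe the whole action
  (\<open>cj_lam\<close>).\<close>

definition lam :: "'q \<Rightarrow> bit" where "lam m = (if m \<in> {\<epsilon>, k} then 0 else 1)"
definition chi :: "'q \<Rightarrow> bit" where "chi x = (if cj x n = n then 0 else 1)"

lemma n_nuc: "n \<in> nuc" by (simp add: nuc_eq)
lemma e_sc_nuc: "\<epsilon> \<star> b \<in> nuc" by (simp add: sc_def k_nuc)
lemma n_sc_nuc: "n \<star> b \<in> nuc" by (simp add: sc_def nuc_eq)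

lemma nuc_cases: assumes "m \<in> nuc" obtains b where "m = \<epsilon> \<star> b" | b where "m = n \<star> b"
proof -
  have "m = \<epsilon> \<star> 0 \<or> m = \<epsilon> \<star> 1 \<or> m = n \<star> 0 \<or> m = n \<star> 1" using assms by (simp add: nuc_eq sc_def)
  thus thesis using that by blast
qed

lemma n_ne_sc: "n \<star> b \<noteq> \<epsilon> \<star> c"
proof
  assume "n \<star> b = \<epsilon> \<star> c"
  hence "n = \<epsilon> \<star> (b + c)" by (simp add: sc_cancel)
  thus False using n_ne by (simp add: sc_def split: if_splits)
qed

lemma lam_sc [simp]: "lam (\<epsilon> \<star> b) = 0" "lam (n \<star> b) = 1" "lam \<epsilon> = 0"
proof -
  show "lam (\<epsilon> \<star> b) = 0" "lam \<epsilon> = 0" by (simp_all add: lam_def sc_def)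
  show "lam (n \<star> b) = 1" using n_ne_sc[of b 0] n_ne_sc[of b 1] by (simp add: lam_def) (simp add: sc_def)
qed

lemma lam_zero: assumes "m \<in> nuc" "lam m = 0" obtains b where "m = \<epsilon> \<star> b"
  using assms by (elim nuc_cases) auto

lemma nn: obtains d where "n \<cdot> n = \<epsilon> \<star> d"
proof -
  have "n \<cdot> n \<in> nuc" by (simp add: nuc_mul n_nuc)
  moreover have "n \<cdot> n \<noteq> n \<star> b" for b
  proof
    assume "n \<cdot> n = n \<star> b"
    hence "n \<cdot> n = n \<cdot> (\<epsilon> \<star> b)" by simp
    thus False using n_ne_sc[of 0 b] unfolding mul_lcancel by simp
  qed
  ultimately show thesis using that by (elim nuc_cases) auto
qed

lemma lam_mul: assumes "m \<in> nuc" "m' \<in> nuc" shows "lam (m \<cdot> m') = lam m + lam m'"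
proof -
  obtain d where d: "n \<cdot> n = \<epsilon> \<star> d" by (rule nn)
  show ?thesis using assms by (elim nuc_cases) (simp_all add: d)
qed

lemma nuc_commute: assumes "m \<in> nuc" "m' \<in> nuc" shows "m \<cdot> m' = m' \<cdot> m"
  using assms by (elim nuc_cases) (simp_all add: ac_simps)

lemma cj_sc: "cj x (m \<star> b) = cj x m \<star> b" by (simp add: cj_def)

lemma cj_n: "cj x n = n \<star> chi x"
proof -
  have "cj x n \<in> nuc" by (simp add: cj_nuc n_nuc)
  moreover have "cj x n \<noteq> \<epsilon> \<star> b" for b
  proof
    assume "cj x n = \<epsilon> \<star> b"
    hence "cj x n = cj x (\<epsilon> \<star> b)" by (simp add: cj_sc)
    thus False using n_ne_sc[of 0 b] unfolding cj_inj by simp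
  qed
  ultimately obtain b where b: "cj x n = n \<star> b" by (elim nuc_cases) auto
  thus ?thesis by (cases b) (auto simp: chi_def)
qed

lemma cj_lam: assumes "m \<in> nuc" shows "cj x m = m \<star> (chi x * lam m)"
  using assms by (elim nuc_cases) (simp_all add: cj_sc cj_n ac_simps)

definition F where "F x y z = lam (ass x y z)"

lemma cj_ass: "cj u (ass x y z) = ass x y z \<star> (chi u * F x y z)"
  by (simp add: cj_lam ass_nuc F_def)

lemma F_swap: "chi u * F x y z = chi u * F y x z" "chi u * F x y z = chi u * F x z y"
  "chi u * F x y z = chi z * F x y u"
proof -
  have *: "b = c" if "p \<cdot> q \<star> b = q \<cdot> p \<star> c" "p \<in> nuc" "q \<in> nuc" for p q b c
    using that nuc_commute[of p q] by simp
  show "chi u * F x y z = chi u * F y x z"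
    by (rule *[OF _ ass_nuc[of x y z] ass_nuc[of y x z]]) (use ass_swap(1)[of u x y z] in \<open>simp add: cj_ass\<close>)
  show "chi u * F x y z = chi u * F x z y"
    by (rule *[OF _ ass_nuc[of x y z] ass_nuc[of x z y]]) (use ass_swap(2)[of u x y z] in \<open>simp add: cj_ass\<close>)
  show "chi u * F x y z = chi z * F x y u"
    by (rule *[OF _ ass_nuc[of x y z] ass_nuc[of x y u]]) (use ass_swap(3)[of u x y z] in \<open>simp add: cj_ass\<close>)
qed

lemma chi_one: obtains u where "chi u = 1" using moved by (auto simp: chi_def)

text \<open>\<open>F_swap\<close> with \<open>chi u = 1\<close> makes \<open>F\<close> symmetric and
  lets each argument be replaced by \<open>u\<close> at the cost of a factor
  \<open>chi\<close>.\<close>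

lemma F_product: assumes u: "chi u = 1" shows "F x y z = chi x * (chi y * (chi z * F u u u))"
proof -
  have s: "F x y z = F y x z" "F x y z = F x z y" "F x y z = chi z * F x y u" for x y z
    by (rule F_swap[of u x y z, unfolded u mult_1_left])+
  have "F x y z = chi z * F x u y" using s(3)[of x y z] s(2)[of x y u] by simp
  also have "\<dots> = chi z * (chi y * F x u u)" using s(3)[of x u y] by simp
  also have "F x u u = F u u x" using s(1)[of x u u] s(2)[of u x u] by simp
  also have "\<dots> = chi x * F u u u" by (rule s(3))
  finally show ?thesis by (simp add: ac_simps)
qed

lemma ass_mul1_bit: "ass (x \<cdot> y) z u = ass x z u \<cdot> ass y z u \<star> (chi u * F x y z)"
proof -
  have "ass (x \<cdot> y) z u \<cdot> ass x y z = (ass x z u \<cdot> ass y z u \<star> (chi u * F x y z)) \<cdot> ass x y z"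
    using ass_mul1[of x y z u] by (simp add: cj_ass)
  thus ?thesis unfolding mul_rcancel .
qed

lemma bit_idem [simp]: "(b::bit) * (b * c) = b * c" "(b::bit) * b = b" by (cases b; simp)+

text \<open>By \<open>F_product\<close> only \<open>F u u u\<close> can obstruct. If it is 1,
  rotation of \<open>u, u, u\<close> forces \<open>n \<cdot> n = k\<close>, and
  \<open>ass_mul1\<close> then makes \<open>u \<cdot> u\<close> nuclear. But then
  \<open>ass u u u\<close> is the effect of conjugating a nuclear element by \<open>u\<close>, a
  power of \<open>k\<close>, contradicting the assumption.\<close>

lemma F_zero: "F x y z = 0"
proof -
  obtain u where u: "chi u = 1" by (rule chi_one)
  have "F u u u = 0"
  proof (rule ccontr)
    assume "F u u u \<noteq> 0"
    hence F1: "F u u u = 1" by simp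
    obtain d where d: "n \<cdot> n = \<epsilon> \<star> d" by (rule nn)
    obtain b where b: "ass u u u = n \<star> b"
      using ass_nuc[of u u u] F1 by (elim nuc_cases) (auto simp: F_def)
    have "\<epsilon> \<star> (d + 1) = \<epsilon>" using ass_rot[of u u u] by (simp add: b d cj_sc cj_n u ac_simps)
    hence "d = 1" by (cases d) auto
    hence sq: "m \<cdot> m = \<epsilon> \<star> lam m" if "m \<in> nuc" for m
      using that d by (elim nuc_cases) simp_all
    have "ass (u \<cdot> u) z w = \<epsilon>" for z w
    proof -
      have "F u z w = chi z * chi w" "F u u z = chi z" 
        using F_product[OF u, of u z w] F_product[OF u, of u u z] by (simp_all add: F1 u)
      hence "F u z w + chi w * F u u z = 0" by (simp add: mult.commute)
      thus ?thesis unfolding ass_mul1_bit sq[OF ass_nuc] F_def[symmetric] sc_sc by simp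
    qed
    hence "u \<cdot> u \<in> nuc" by (intro nucI1) (metis ass_eq mul_e)
    hence "(u \<cdot> u) \<cdot> u = (u \<cdot> (u \<cdot> u)) \<star> (chi u * lam (u \<cdot> u))"
      by (subst cj_eq) (simp add: cj_lam)
    hence "ass u u u = \<epsilon> \<star> (chi u * lam (u \<cdot> u))" by (simp add: ass_def)
    thus False using F1 by (simp add: F_def)
  qed
  thus ?thesis using F_product[OF u, of x y z] by simp
qed

text \<open>The exponent of \<open>k\<close> in the associator: a cyclically invariant trilinear
  form over the two-element field.\<close>

definition \<beta> :: "'q \<Rightarrow> 'q \<Rightarrow> 'q \<Rightarrow> bit" where "\<beta> x y z = (if ass x y z = \<epsilon> then 0 else 1)"

lemma ass_beta: "ass x y z = \<epsilon> \<star> \<beta> x y z"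
proof -
  obtain b where "ass x y z = \<epsilon> \<star> b" by (rule lam_zero[OF ass_nuc F_zero[of x y z, unfolded F_def]])
  thus ?thesis by (cases b) (auto simp: \<beta>_def)
qed

lemma assoc_beta: "(x \<cdot> y) \<cdot> z = x \<cdot> (y \<cdot> z) \<star> \<beta> x y z" using ass_eq[of x y z] by (simp add: ass_beta)

lemma beta_mul1: "\<beta> (x \<cdot> y) z u = \<beta> x z u + \<beta> y z u"
  using ass_mul1_bit[of x y z u] by (simp add: ass_beta F_zero)

lemma beta_rot: "\<beta> x y z = \<beta> y z x"
proof -
  have "\<epsilon> \<star> (\<beta> x y z + \<beta> y z x) = \<epsilon>"
    using ass_rot[of y z x] by (simp add: ass_beta cj_sc ac_simps)
  thus ?thesis by (cases "\<beta> x y z"; cases "\<beta> y z x") auto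
qed

lemma beta_mul2: "\<beta> x (y \<cdot> z) u = \<beta> x y u + \<beta> x z u"
  using beta_mul1[of y z u x] beta_rot by metis
lemma beta_mul3: "\<beta> x y (z \<cdot> u) = \<beta> x y z + \<beta> x y u"
  using beta_mul1[of z u x y] beta_rot by metis

lemma beta_nuc: "m \<in> nuc \<Longrightarrow> \<beta> m x y = 0" "m \<in> nuc \<Longrightarrow> \<beta> x m y = 0" "m \<in> nuc \<Longrightarrow> \<beta> x y m = 0"
  by (simp_all add: \<beta>_def ass_of_nuc)

lemma square_nuc: "x \<cdot> x \<in> nuc"
  by (rule nucI1) (simp add: assoc_beta[of "x \<cdot> x"] beta_mul1)

text \<open>Commutators modulo \<open>k\<close>: an alternating bilinear form on the elementary
  abelian quotient by the nucleus.\<close>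

definition C where "C u v = lam ((v \<cdot> u) \<setminus> (u \<cdot> v))"

lemma C_eq: assumes "u \<cdot> v = (v \<cdot> u) \<cdot> m" shows "C u v = lam m" by (simp add: C_def assms)

lemma C_self [simp]: "C u u = 0" by (simp add: C_def)

lemma C_swap: "C u v = C v u"
proof -
  let ?K = "(v \<cdot> u) \<setminus> (u \<cdot> v)" and ?L = "(u \<cdot> v) \<setminus> (v \<cdot> u)"
  have K: "?K \<in> nuc" "?L \<in> nuc" by (rule commutator_nuc)+
  have "(v \<cdot> u) \<cdot> (?K \<cdot> ?L) = v \<cdot> u" using nucD(2)[OF K(1), of "v \<cdot> u" ?L] by simp
  hence "lam ?K + lam ?L = 0" by (simp add: lam_mul[OF K, symmetric])
  thus ?thesis unfolding C_def by (metis bit_two add.assoc add_0 add_0_right)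
qed

text \<open>Moving \<open>z\<close> past \<open>x\<close> and \<open>y\<close> in turn introduces
  associators and conjugation effects, all of them powers of \<open>k\<close> and hence invisible to
  \<open>lam\<close>.\<close>

lemma C_mul1: "C (x \<cdot> y) z = C x z + C y z"
proof -
  let ?M = "(z \<cdot> x) \<setminus> (x \<cdot> z)" and ?K = "(z \<cdot> y) \<setminus> (y \<cdot> z)"
  have N: "?M \<in> nuc" "?K \<in> nuc" by (rule commutator_nuc)+
  let ?b = "\<beta> x y z + (\<beta> x z y + (\<beta> z x y + chi y * lam ?M))"
  have "(x \<cdot> y) \<cdot> z = x \<cdot> ((z \<cdot> y) \<cdot> ?K) \<star> \<beta> x y z" by (simp add: assoc_beta)
  also have "x \<cdot> ((z \<cdot> y) \<cdot> ?K) = (x \<cdot> (z \<cdot> y)) \<cdot> ?K" by (rule nucD(3)[OF N(2), symmetric])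
  also have "x \<cdot> (z \<cdot> y) = ((z \<cdot> x) \<cdot> ?M) \<cdot> y \<star> \<beta> x z y" by (simp add: assoc_beta[of x z y])
  also have "((z \<cdot> x) \<cdot> ?M) \<cdot> y = ((z \<cdot> x) \<cdot> y) \<cdot> ?M \<star> (chi y * lam ?M)"
    unfolding nuc_move[OF N(1)] by (simp add: cj_lam N)
  also have "(z \<cdot> x) \<cdot> y = z \<cdot> (x \<cdot> y) \<star> \<beta> z x y" by (rule assoc_beta)
  finally have "(x \<cdot> y) \<cdot> z = ((z \<cdot> (x \<cdot> y)) \<cdot> ?M) \<cdot> ?K \<star> ?b" by (simp add: ac_simps)
  also have "\<dots> = (z \<cdot> (x \<cdot> y)) \<cdot> ((?M \<cdot> ?K) \<cdot> (\<epsilon> \<star> ?b))" using nucD(2)[OF N(1)] by simp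
  finally have "C (x \<cdot> y) z = lam ((?M \<cdot> ?K) \<cdot> (\<epsilon> \<star> ?b))" by (rule C_eq)
  also have "\<dots> = lam ?M + lam ?K" by (simp add: lam_mul nuc_mul N e_sc_nuc del: sc_mr)
  finally show ?thesis by (simp add: C_def)
qed

lemma C_mul2: "C z (x \<cdot> y) = C z x + C z y" using C_mul1[of x y z] C_swap by metis

lemma C_nuc: assumes m: "m \<in> nuc" shows "C m v = 0" "C v m = 0"
proof -
  have "m \<cdot> v = (v \<cdot> m) \<cdot> (\<epsilon> \<star> (chi v * lam m))" by (subst cj_eq) (simp add: cj_lam m)
  from C_eq[OF this] show "C m v = 0" by simp
  thus "C v m = 0" by (simp add: C_swap[of v])
qed

lemma card_nuc: "card nuc = 4"
proof -
  have "n \<noteq> n \<cdot> k" using mul_eq_left[of n k] k_ne by metis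
  moreover have "k \<noteq> n \<cdot> k" using mul_eq_right[of n k] n_ne(1) by metis
  moreover have "\<epsilon> \<noteq> k" "\<epsilon> \<noteq> n \<cdot> k" "\<epsilon> \<noteq> n" "k \<noteq> n"
    using k_ne n_ne n_ne_sc[of 1 0] by (auto simp: sc_def)
  ultimately have "card {\<epsilon>, k, n, n \<cdot> k} = 4" by simp
  thus ?thesis by (simp only: nuc_eq)
qed

text \<open>An alternating form on a space of odd dimension is degenerate; here the dimension is 3.
  If \<open>C x y = 1\<close>, the orthogonal space \<open>K\<close> of \<open>x\<close> and
  \<open>y\<close> has index 4, hence order 8, and exceeds the nucleus; any further element of it is
  radical.\<close>

lemma radical: obtains z where "z \<notin> nuc" "\<And>u. C u z = 0"
proof (cases "\<forall>x y. C x y = 0")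
  case True
  have "nuc \<noteq> UNIV" using card_nuc card32 by auto
  thus thesis using True that by blast
next
  case False
  then obtain x y where xy: "C x y = 1" by auto
  hence yx: "C y x = 1" using C_swap by metis
  define \<phi> where "\<phi> u = (C u x, C u y)" for u
  define K where "K = {u. \<phi> u = (0, 0)}"
  have \<phi>_mul: "\<phi> (u \<cdot> v) = (fst (\<phi> u) + fst (\<phi> v), snd (\<phi> u) + snd (\<phi> v))" for u v
    by (simp add: \<phi>_def C_mul1)
  have "card {a \<in> UNIV. \<phi> a = b} = card K" if "b \<in> range \<phi>" for b
  proof -
    obtain u where u: "b = \<phi> u" using \<open>b \<in> range \<phi>\<close> by blast
    have "{a. \<phi> a = \<phi> u} = (\<lambda>s. s \<cdot> u) ` K"
    proof (intro equalityI subsetI)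
      fix a assume "a \<in> {a. \<phi> a = \<phi> u}"
      hence "\<phi> ((a \<oslash> u) \<cdot> u) = \<phi> u" by simp
      hence "\<phi> (a \<oslash> u) = (0, 0)" unfolding \<phi>_mul by (cases "\<phi> u"; cases "\<phi> (a \<oslash> u)") simp
      thus "a \<in> (\<lambda>s. s \<cdot> u) ` K" by (intro image_eqI[of _ _ "a \<oslash> u"]) (simp_all add: K_def)
    qed (auto simp: K_def \<phi>_mul)
    thus ?thesis by (simp add: u card_image inj_on_def)
  qed
  from card_eq_fibres[OF fin this] have "32 = card (range \<phi>) * card K" by (simp add: card32)
  moreover have "range \<phi> = UNIV"
  proof -
    have "(i, j) \<in> range \<phi>" for i j
    proof (cases i; cases j)
      show "(i, j) \<in> range \<phi>" if "i = 0" "j = 0" by (rule range_eqI[of _ _ \<epsilon>]) (simp add: that \<phi>_def C_nuc)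
      show "(i, j) \<in> range \<phi>" if "i = 0" "j = 1" by (rule range_eqI[of _ _ x]) (simp add: that \<phi>_def xy)
      show "(i, j) \<in> range \<phi>" if "i = 1" "j = 0" by (rule range_eqI[of _ _ y]) (simp add: that \<phi>_def yx)
      show "(i, j) \<in> range \<phi>" if "i = 1" "j = 1" by (rule range_eqI[of _ _ "x \<cdot> y"]) (simp add: that \<phi>_def xy yx C_mul1)
    qed
    thus ?thesis by auto
  qed
  moreover have "card (UNIV :: (bit \<times> bit) set) = 4"
  proof -
    have "(UNIV :: bit set) = {0, 1}" by (auto intro: bit.exhaust)
    hence "card (UNIV :: bit set) = card {0, 1 :: bit}" by (rule arg_cong)
    thus ?thesis by (simp add: card_UNIV_prod)
  qed
  ultimately have cK: "card K = 8" by simp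
  have "K \<noteq> nuc" using cK card_nuc by auto
  moreover have nK: "nuc \<subseteq> K" by (auto simp: K_def \<phi>_def C_nuc)
  ultimately obtain z where z: "z \<in> K" "z \<notin> nuc" by blast
  have zx: "C z x = 0" "C z y = 0" using z by (simp_all add: K_def \<phi>_def)
  have K: "K = nuc \<union> coset z"
  proof (rule card_seteq[symmetric])
    show "finite K" by (rule finite_subset[OF subset_UNIV fin])
    show "nuc \<union> coset z \<subseteq> K" using nK by (auto simp: K_def \<phi>_def coset_def C_mul1 C_nuc zx)
    have "nuc \<inter> coset z = {}"
    proof (rule ccontr)
      assume "nuc \<inter> coset z \<noteq> {}"
      then obtain m where "m \<in> nuc" "m \<in> coset z" by blast
      hence "coset z = coset \<epsilon>" by (metis coset_e coset_mul_nuc coset_def imageE)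
      thus False using z by (simp add: coset_e)
    qed
    hence "card (nuc \<union> coset z) = 8"
      using card_nuc card_nuc_coset[of z] by (subst card_Un_disjoint) (auto simp: coset_def intro: finite_subset[OF subset_UNIV fin])
    thus "card K \<le> card (nuc \<union> coset z)" by (simp add: cK)
  qed
  show thesis
  proof (rule that[OF z(2)])
    fix u
    have inK: "C v z = 0" if "v \<in> K" for v
      using that unfolding K by (auto simp: C_nuc coset_def C_mul1)
    \<comment> \<open>One of \<open>\<epsilon>\<close>, \<open>x\<close>, \<open>y\<close>,
      \<open>x \<cdot> y\<close> corrects \<open>u\<close> to lie in \<open>K\<close>. All of these
      are orthogonal to \<open>z\<close>, so the correction does not change
      \<open>C u z\<close>.\<close>
    have "\<exists>w. u \<cdot> w \<in> K \<and> C z w = 0"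
    proof (cases "C u x"; cases "C u y")
      show ?thesis if "C u x = 0" "C u y = 0"
        by (rule exI[of _ \<epsilon>]) (simp add: that K_def \<phi>_def C_nuc)
      show ?thesis if "C u x = 0" "C u y = 1"
        by (rule exI[of _ x]) (simp add: that K_def \<phi>_def C_mul1 xy zx)
      show ?thesis if "C u x = 1" "C u y = 0"
        by (rule exI[of _ y]) (simp add: that K_def \<phi>_def C_mul1 yx zx)
      show ?thesis if "C u x = 1" "C u y = 1"
        by (rule exI[of _ "x \<cdot> y"]) (simp add: that K_def \<phi>_def C_mul1 C_mul2 xy yx zx)
    qed
    then obtain w where "u \<cdot> w \<in> K" "C z w = 0" by blast
    thus "C u z = 0" using inK[of "u \<cdot> w"] C_swap[of w z] by (simp add: C_mul1)
  qed
qed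

lemma coset_closed:
  assumes "nuc \<subseteq> H" "\<And>x y. x \<in> H \<Longrightarrow> y \<in> H \<Longrightarrow> x \<cdot> y \<in> H" "coset x = coset y" "x \<in> H"
  shows "y \<in> H"
  using assms unfolding coset_eq by blast

text \<open>\<open>H\<close> has maximal size among the multiplicatively closed sets that contain
  the nucleus and avoid \<open>z\<close>. For \<open>u\<close> outside, the union of
  \<open>H\<close> and \<open>u H\<close> is again closed and larger, so \<open>z\<close> lies in
  \<open>u H\<close>. As squares are nuclear, \<open>z \<cdot> u\<close> lies in
  \<open>H\<close>.\<close>

lemma complement: assumes z: "z \<notin> nuc"
  obtains H where "nuc \<subseteq> H" "\<And>x y. x \<in> H \<Longrightarrow> y \<in> H \<Longrightarrow> x \<cdot> y \<in> H" "z \<notin> H"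
    "\<And>u. u \<notin> H \<Longrightarrow> z \<cdot> u \<in> H"
proof -
  define \<H> where "\<H> = {H. nuc \<subseteq> H \<and> (\<forall>x\<in>H. \<forall>y\<in>H. x \<cdot> y \<in> H) \<and> z \<notin> H}"
  have finite: "finite A" for A :: "'q set" by (rule finite_subset[OF subset_UNIV fin])
  have "nuc \<in> \<H>" using z by (simp add: \<H>_def nuc_mul)
  hence "\<exists>H. H \<in> \<H> \<and> (\<forall>H'. H' \<in> \<H> \<longrightarrow> card H' \<le> card H)"
    by (rule ex_has_greatest_nat[of "\<lambda>H. H \<in> \<H>" _ card "Suc (card (UNIV :: 'q set))"]) (simp add: less_Suc_eq_le card_mono fin)
  then obtain H where H: "H \<in> \<H>" and max: "\<And>H'. H' \<in> \<H> \<Longrightarrow> card H' \<le> card H" by blast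
  have HN: "nuc \<subseteq> H" and Hm: "\<And>x y. x \<in> H \<Longrightarrow> y \<in> H \<Longrightarrow> x \<cdot> y \<in> H" and zH: "z \<notin> H"
    using H by (auto simp: \<H>_def)
  note cl = coset_closed[OF HN Hm]
  show thesis
  proof (rule that[OF HN Hm zH])
    fix u assume u: "u \<notin> H"
    define U where "U = (\<lambda>h. u \<cdot> h) ` H"
    have Ucl: "b \<in> U" if ab: "coset a = coset b" "a \<in> U" for a b
    proof -
      obtain m h where m: "m \<in> nuc" "b = a \<cdot> m" "a = u \<cdot> h" "h \<in> H" using ab by (auto simp: U_def coset_eq)
      have "b = u \<cdot> (h \<cdot> m)" using m by (simp add: nucD(3))
      moreover have "h \<cdot> m \<in> H" using m HN Hm by blast
      ultimately show ?thesis by (auto simp: U_def)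
    qed
    have sq: "coset ((u \<cdot> u) \<cdot> h) = coset h" for h
    proof -
      have "coset ((u \<cdot> u) \<cdot> h) = coset (\<epsilon> \<cdot> h)" using square_nuc[of u] by (intro coset_mul) (simp_all add: coset_e)
      thus ?thesis by simp
    qed
    have "z \<in> U"
    proof (rule ccontr)
      assume "z \<notin> U"
      have "H \<union> U \<in> \<H>"
      proof -
        have "x \<cdot> y \<in> H \<union> U" if "x \<in> H \<union> U" "y \<in> H \<union> U" for x y
        proof -
          have UH: "a \<cdot> b \<in> U" if ab: "a \<in> U" "b \<in> H" for a b
          proof -
            obtain h where h: "a = u \<cdot> h" "h \<in> H" using ab by (auto simp: U_def)
            have "u \<cdot> (h \<cdot> b) \<in> U" using h ab Hm by (auto simp: U_def)
            thus ?thesis unfolding h using coset_assoc[of u h b, symmetric] by (rule Ucl[rotated])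
          qed
          have UU: "a \<cdot> b \<in> H" if ab: "a \<in> U" "b \<in> U" for a b
          proof -
            obtain g h where h: "a = u \<cdot> g" "b = u \<cdot> h" "g \<in> H" "h \<in> H" using ab by (auto simp: U_def)
            have "coset (a \<cdot> b) = coset ((g \<cdot> u) \<cdot> (u \<cdot> h))" unfolding h by (rule coset_mul[OF coset_comm refl])
            also have "\<dots> = coset (g \<cdot> (u \<cdot> (u \<cdot> h)))" by (rule coset_assoc)
            also have "\<dots> = coset (g \<cdot> ((u \<cdot> u) \<cdot> h))" by (rule coset_mul[OF refl coset_assoc[symmetric]])
            also have "\<dots> = coset (g \<cdot> h)" by (rule coset_mul[OF refl sq])
            finally show ?thesis using cl[of "g \<cdot> h" "a \<cdot> b"] Hm[OF h(3,4)] by simp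
          qed
          show ?thesis using that Hm UH[of x y] UH[of y x] UU[of x y] Ucl[OF coset_comm[of y x]] by blast
        qed
        thus ?thesis using HN zH \<open>z \<notin> U\<close> by (auto simp: \<H>_def)
      qed
      hence "card (H \<union> U) \<le> card H" by (rule max)
      hence "H \<union> U = H" by (intro card_seteq[symmetric] finite) auto
      moreover have "u \<in> U" unfolding U_def using HN by (intro image_eqI[of _ _ \<epsilon>]) auto
      ultimately show False using u by blast
    qed
    then obtain h where h: "z = u \<cdot> h" "h \<in> H" by (auto simp: U_def)
    have "coset (z \<cdot> u) = coset (u \<cdot> (u \<cdot> h))" unfolding h by (rule coset_comm)
    also have "\<dots> = coset h" using coset_assoc[of u u h] sq[of h] by simp
    finally show "z \<cdot> u \<in> H" using cl[of h "z \<cdot> u"] h by simp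
  qed
qed

end

context nuclear_buchsteiner begin

text \<open>Asymmetry gives more than four nuclear cosets and a nuclear \<open>n\<close> moved by
  some conjugation. With the central involution \<open>k\<close> the nucleus has at least four
  elements, and divisibility of 32 leaves exactly four.\<close>

lemma four_nucleus_if_proper:
  assumes card32: "card (UNIV :: 'q set) = 32" and ne: "ass x y z \<noteq> ass y x z"
  obtains k n where "four_nucleus mul ld rd e k n"
proof -
  obtain n w where n: "n \<in> nuc" "cj w n \<noteq> n" using ass_sym_if_central ne by blast
  have ne1: "nuc \<noteq> {\<epsilon>}"
  proof
    assume "nuc = {\<epsilon>}"
    hence "n = \<epsilon>" using n by simp
    thus False using n by simp
  qed
  have c5: "card (UNIV :: 'q set) = 2 ^ 5" by (simp add: card32)
  obtain k where k: "k \<in> nuc" "\<And>x. k \<cdot> x = x \<cdot> k" "k \<cdot> k = \<epsilon>" "k \<noteq> \<epsilon>"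
    by (rule central_involution[OF c5 ne1]) (rule that)
  have I: "involution_loop mul ld rd e k"
    by (intro involution_loop.intro involution_loop_axioms.intro total_buchsteiner_axioms k)
  have ck: "cj w k = k" using k(2) by (simp add: cj_def)
  have "n \<noteq> \<epsilon>" "n \<noteq> k" using n ck by auto
  moreover have "n \<noteq> n \<cdot> k" using mul_eq_left[of n k] k(4) by metis
  moreover have "k \<noteq> n \<cdot> k" using mul_eq_right[of n k] \<open>n \<noteq> \<epsilon>\<close> by metis
  moreover have "\<epsilon> \<noteq> n \<cdot> k"
  proof
    assume "\<epsilon> = n \<cdot> k"
    hence "k \<cdot> k = n \<cdot> k" using k(3) by simp
    thus False using \<open>n \<noteq> k\<close> by simp
  qed
  ultimately have c4: "card {\<epsilon>, k, n, n \<cdot> k} = 4" using k(4) by auto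
  have sub: "{\<epsilon>, k, n, n \<cdot> k} \<subseteq> nuc" using k(1) n(1) nuc_mul by simp
  have finn: "finite nuc" by (rule finite_subset[OF subset_UNIV fin])
  have "card (range coset) > 4" using ass_sym_if_small ne by (metis not_less)
  moreover have prod: "32 = card (range coset) * card nuc" using coset_fibres card32 by simp
  moreover have "4 \<le> card nuc" using card_mono[OF finn sub] c4 by simp
  ultimately have "card nuc = 4"
  proof -
    \<comment> \<open>At least five cosets bound the nucleus by 6, and neither 5 nor 6 divides
      32.\<close>
    have "5 * card nuc \<le> 32" using prod mult_le_mono1[of 5 "card (range coset)" "card nuc"] \<open>card (range coset) > 4\<close> by simp
    hence "card nuc \<in> {4, 5, 6}" using \<open>4 \<le> card nuc\<close> by auto
    thus ?thesis using prod by (elim insertE emptyE) (simp_all, presburger+)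
  qed
  hence "nuc = {\<epsilon>, k, n, n \<cdot> k}" using card_seteq[OF finn sub] c4 by simp
  hence "four_nucleus mul ld rd e k n"
    using I nuclear_buchsteiner_axioms \<open>n \<noteq> \<epsilon>\<close> \<open>n \<noteq> k\<close> card32 n(2)
    by (intro four_nucleus.intro four_nucleus_axioms.intro) auto
  thus thesis by (rule that)
qed

end

section \<open>Copies of total loops, and of closed subsets of them, as records with
  carriers\<close>

locale loop_copy = total_loop mul ld rd e
  for mul :: "'q \<Rightarrow> 'q \<Rightarrow> 'q"  (infixl \<open>\<cdot>\<close> 70)
    and ld :: "'q \<Rightarrow> 'q \<Rightarrow> 'q"  (infixl \<open>\<setminus>\<close> 70)
    and rd :: "'q \<Rightarrow> 'q \<Rightarrow> 'q"  (infixl \<open>\<oslash>\<close> 70)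
    and e :: 'q  (\<open>\<epsilon>\<close>) +
  fixes \<phi> :: "'q \<Rightarrow> 'a" and M :: "('a, 'b) monoid_scheme" and H :: "'q set"
  assumes \<phi>_inj: "inj \<phi>" and carrier_M: "carrier M = \<phi> ` H"
    and mult_M [simp]: "\<phi> u \<otimes>\<^bsub>M\<^esub> \<phi> v = \<phi> (u \<cdot> v)" and one_M [simp]: "\<one>\<^bsub>M\<^esub> = \<phi> \<epsilon>"
    and H_e: "\<epsilon> \<in> H" and H_mul: "u \<in> H \<Longrightarrow> v \<in> H \<Longrightarrow> u \<cdot> v \<in> H"
    and H_ld: "u \<in> H \<Longrightarrow> v \<in> H \<Longrightarrow> u \<setminus> v \<in> H" and H_rd: "u \<in> H \<Longrightarrow> v \<in> H \<Longrightarrow> u \<oslash> v \<in> H"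
begin

lemma \<phi>_eq [simp]: "\<phi> u = \<phi> v \<longleftrightarrow> u = v" using \<phi>_inj by (simp add: inj_eq)
lemma \<phi>_mem [simp]: "\<phi> u \<in> carrier M \<longleftrightarrow> u \<in> H" by (auto simp: carrier_M)

lemma is_loop: "loop M"
proof
  fix x y assume "x \<in> carrier M" "y \<in> carrier M"
  then obtain u v where uv: "x = \<phi> u" "y = \<phi> v" "u \<in> H" "v \<in> H" by (auto simp: carrier_M)
  show "x \<otimes>\<^bsub>M\<^esub> y \<in> carrier M" using uv by (simp add: H_mul)
  show "\<exists>!w. w \<in> carrier M \<and> x \<otimes>\<^bsub>M\<^esub> w = y"
    by (rule ex1I[of _ "\<phi> (u \<setminus> v)"]) (use uv in \<open>auto simp: H_ld carrier_M\<close>)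
  show "\<exists>!w. w \<in> carrier M \<and> w \<otimes>\<^bsub>M\<^esub> x = y"
    by (rule ex1I[of _ "\<phi> (v \<oslash> u)"]) (use uv in \<open>auto simp: H_rd carrier_M\<close>)
qed (auto simp: carrier_M H_e)

lemma ldiv_M [simp]: "u \<in> H \<Longrightarrow> v \<in> H \<Longrightarrow> ldiv M (\<phi> u) (\<phi> v) = \<phi> (u \<setminus> v)"
  unfolding ldiv_def by (rule the_equality) (auto simp: H_ld carrier_M)
lemma rdiv_M [simp]: "u \<in> H \<Longrightarrow> v \<in> H \<Longrightarrow> rdiv M (\<phi> u) (\<phi> v) = \<phi> (u \<oslash> v)"
  unfolding rdiv_def by (rule the_equality) (auto simp: H_rd carrier_M)

lemma nucleus_M: "m \<in> nuc \<Longrightarrow> m \<in> H \<Longrightarrow> \<phi> m \<in> nucleus M"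
  by (auto simp: nucleus_def carrier_M nucD)

lemma lcoset_M: "\<phi> u <#\<^bsub>M\<^esub> (\<phi> ` B) = \<phi> ` ((\<lambda>b. u \<cdot> b) ` B)" by (auto simp: l_coset_def)
lemma rcoset_M: "(\<phi> ` B) #>\<^bsub>M\<^esub> \<phi> u = \<phi> ` ((\<lambda>b. b \<cdot> u) ` B)" by (auto simp: r_coset_def)

end

locale buchsteiner_copy = loop_copy mul ld rd e \<phi> M H + total_buchsteiner mul ld rd e
  for mul :: "'q \<Rightarrow> 'q \<Rightarrow> 'q"  (infixl \<open>\<cdot>\<close> 70)
    and ld :: "'q \<Rightarrow> 'q \<Rightarrow> 'q"  (infixl \<open>\<setminus>\<close> 70)
    and rd :: "'q \<Rightarrow> 'q \<Rightarrow> 'q"  (infixl \<open>\<oslash>\<close> 70)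
    and e :: 'q  (\<open>\<epsilon>\<close>)
    and \<phi> :: "'q \<Rightarrow> 'a" and M :: "('a, 'b) monoid_scheme" and H :: "'q set"
begin

lemma is_buchsteiner: "buchsteiner_loop M"
  unfolding buchsteiner_loop_def buchsteiner_loop_axioms_def
  using is_loop by (auto simp: carrier_M H_mul buch)

text \<open>For subsets of the nucleus the associativity conditions on cosets are automatic, and
  normality becomes invariance under conjugation in both directions.\<close>

lemma normal_copy:
  assumes B: "B \<subseteq> nuc" "B \<subseteq> H" "\<epsilon> \<in> B" "\<And>a b. a \<in> B \<Longrightarrow> b \<in> B \<Longrightarrow> a \<cdot> b \<in> B \<and> a \<setminus> b \<in> B \<and> b \<oslash> a \<in> B"
    and c: "\<And>b v. b \<in> B \<Longrightarrow> cj v b \<in> B \<and> ci v b \<in> B"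
  shows "normal_subloop (\<phi> ` B) M"
proof -
  have BH: "b \<in> H" if "b \<in> B" for b using that B by blast
  have n: "(u \<cdot> v) \<cdot> b = u \<cdot> (v \<cdot> b)" "(b \<cdot> u) \<cdot> v = b \<cdot> (u \<cdot> v)" if "b \<in> B" for b u v
    using nucD[of b] that B by auto
  have "(\<lambda>b. u \<cdot> b) ` B = (\<lambda>b. b \<cdot> u) ` B" for u
  proof (intro equalityI subsetI)
    fix t assume "t \<in> (\<lambda>b. u \<cdot> b) ` B"
    then obtain b where "b \<in> B" "t = u \<cdot> b" by blast
    thus "t \<in> (\<lambda>b. b \<cdot> u) ` B" using c[of b u] by (intro image_eqI[of _ _ "ci u b"]) (simp_all add: ci_def)
  next
    fix t assume "t \<in> (\<lambda>b. b \<cdot> u) ` B"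
    then obtain b where "b \<in> B" "t = b \<cdot> u" by blast
    thus "t \<in> (\<lambda>b. u \<cdot> b) ` B" using c[of b u] by (intro image_eqI[of _ _ "cj u b"]) (simp_all add: cj_def)
  qed
  moreover have "(\<lambda>b. u \<cdot> b) ` (\<lambda>b. v \<cdot> b) ` B = (\<lambda>b. (u \<cdot> v) \<cdot> b) ` B" for u v
    unfolding image_image by (rule image_cong) (simp_all add: n)
  moreover have "(\<lambda>b. b \<cdot> v) ` (\<lambda>b. b \<cdot> u) ` B = (\<lambda>b. b \<cdot> (u \<cdot> v)) ` B" for u v
    unfolding image_image by (rule image_cong) (simp_all add: n)
  ultimately show ?thesis using B BH
    by (auto simp: normal_subloop_def subloop_def carrier_M lcoset_M rcoset_M simp del: image_image)
qed

end

section \<open>Symmetric associators imply conjugacy closedness\<close>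

context nuclear_buchsteiner begin

text \<open>The conjugate of \<open>L_y\<close> by \<open>L_x\<close> can only be \<open>L_w\<close>
  with \<open>w = (x \<cdot> y) \<oslash> x\<close>. Since \<open>w\<close> lies in the nuclear
  coset of \<open>y\<close>, the required identity reduces to \<open>ass y x t = ass x y t\<close>.
  Right translations need symmetry in the last two arguments, which follows by rotation.\<close>

lemma conjugacy_closed_copy:
  assumes copy: "loop_copy mul ld rd e \<phi> M UNIV" and sym: "\<And>x y z. ass x y z = ass y x z"
  shows "conjugacy_closed M"
proof -
  interpret loop_copy mul ld rd e \<phi> M UNIV by (rule copy)
  let ?B = "BijGroup (carrier M)"
  interpret B: group ?B by (rule group_BijGroup)
  have cM: "carrier M = range \<phi>" by (rule carrier_M)
  have LB: "left_trans M (\<phi> u) \<in> Bij (carrier M)" for u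
    unfolding Bij_def left_trans_def
    by (auto intro!: bij_betwI[of _ _ _ "\<lambda>x. \<phi> (u \<setminus> (Hilbert_Choice.inv \<phi> x))"] simp: cM \<phi>_inj)
  have RB: "right_trans M (\<phi> u) \<in> Bij (carrier M)" for u
    unfolding Bij_def right_trans_def
    by (auto intro!: bij_betwI[of _ _ _ "\<lambda>x. \<phi> ((Hilbert_Choice.inv \<phi> x) \<oslash> u)"] simp: cM \<phi>_inj)
  have cB: "carrier ?B = Bij (carrier M)" by (simp add: BijGroup_def)
  have conj: "f \<otimes>\<^bsub>?B\<^esub> g \<otimes>\<^bsub>?B\<^esub> inv\<^bsub>?B\<^esub> f = h"
    if "f \<in> Bij (carrier M)" "g \<in> Bij (carrier M)" "h \<in> Bij (carrier M)"
      "\<And>t. f (g (\<phi> t)) = h (f (\<phi> t))" for f g h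
  proof -
    have "f \<otimes>\<^bsub>?B\<^esub> g = h \<otimes>\<^bsub>?B\<^esub> f" using that by (auto simp: BijGroup_def compose_def cM intro!: restrict_ext)
    thus ?thesis using that(1-3) by (simp add: cB[symmetric] B.m_assoc)
  qed
  have L: "left_trans M (\<phi> u) (\<phi> t) = \<phi> (u \<cdot> t)" and R: "right_trans M (\<phi> u) (\<phi> t) = \<phi> (t \<cdot> u)" for u t
    by (simp_all add: left_trans_def right_trans_def)
  have left: "left_trans M (\<phi> x) \<otimes>\<^bsub>?B\<^esub> left_trans M (\<phi> y) \<otimes>\<^bsub>?B\<^esub> inv\<^bsub>?B\<^esub> (left_trans M (\<phi> x))
      = left_trans M (\<phi> ((x \<cdot> y) \<oslash> x))" for x y
  proof (rule conj[OF LB LB LB], unfold L)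
    fix t
    define w where "w = (x \<cdot> y) \<oslash> x"
    have w: "w \<cdot> x = x \<cdot> y" by (simp add: w_def)
    hence "coset (x \<cdot> w) = coset (x \<cdot> y)" using coset_comm[of x w] by simp
    hence "coset w = coset y" by (simp add: coset_lcancel)
    hence "ass w x t = ass x y t" using ass_coset(1)[of w y x t] sym[of x y t] by simp
    hence "(w \<cdot> (x \<cdot> t)) \<cdot> ass w x t = (x \<cdot> (y \<cdot> t)) \<cdot> ass w x t"
      using ass_eq[of w x t] ass_eq[of x y t] by (simp add: w)
    thus "\<phi> (x \<cdot> (y \<cdot> t)) = \<phi> (((x \<cdot> y) \<oslash> x) \<cdot> (x \<cdot> t))" by (simp add: w_def)
  qed
  have sym': "ass t x y = ass t y x" for t x y
  proof -
    have "ass x y t \<cdot> cj t (ass t x y) = ass x y t \<cdot> cj t (ass t y x)"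
      using ass_rot[of x y t] ass_rot[of y x t] sym[of x y t] by simp
    thus ?thesis by simp
  qed
  have right: "right_trans M (\<phi> x) \<otimes>\<^bsub>?B\<^esub> right_trans M (\<phi> y) \<otimes>\<^bsub>?B\<^esub> inv\<^bsub>?B\<^esub> (right_trans M (\<phi> x))
      = right_trans M (\<phi> (x \<setminus> (y \<cdot> x)))" for x y
  proof (rule conj[OF RB RB RB], unfold R)
    fix t
    define w where "w = x \<setminus> (y \<cdot> x)"
    have w: "x \<cdot> w = y \<cdot> x" by (simp add: w_def)
    hence "coset (x \<cdot> w) = coset (x \<cdot> y)" using coset_comm[of x y] by simp
    hence "coset w = coset y" by (simp add: coset_lcancel)
    hence "ass t x w = ass t y x" using ass_coset(3)[of w y t x] sym'[of t x y] by simp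
    hence "(t \<cdot> x) \<cdot> w = (t \<cdot> y) \<cdot> x" using ass_eq[of t x w] ass_eq[of t y x] by (simp add: w)
    thus "\<phi> ((t \<cdot> y) \<cdot> x) = \<phi> ((t \<cdot> x) \<cdot> (x \<setminus> (y \<cdot> x)))" by (simp add: w_def)
  qed
  show ?thesis unfolding conjugacy_closed_def Let_def
  proof (intro ballI)
    fix X Y assume "X \<in> carrier M" "Y \<in> carrier M"
    then obtain x y where "X = \<phi> x" "Y = \<phi> y" by (auto simp: cM)
    thus "left_trans M X \<otimes>\<^bsub>?B\<^esub> left_trans M Y \<otimes>\<^bsub>?B\<^esub> inv\<^bsub>?B\<^esub> (left_trans M X) \<in> left_trans M ` carrier M \<and>
      right_trans M X \<otimes>\<^bsub>?B\<^esub> right_trans M Y \<otimes>\<^bsub>?B\<^esub> inv\<^bsub>?B\<^esub> (right_trans M X) \<in> right_trans M ` carrier M"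
      by (simp only: left right) simp
  qed
qed

end

section \<open>Splitting off \<open>z\<close>: recovering the loop as a doubling\<close>

locale doubling_copy = four_nucleus mul ld rd e k n
  for mul :: "'q \<Rightarrow> 'q \<Rightarrow> 'q"  (infixl \<open>\<cdot>\<close> 70)
    and ld :: "'q \<Rightarrow> 'q \<Rightarrow> 'q"  (infixl \<open>\<setminus>\<close> 70)
    and rd :: "'q \<Rightarrow> 'q \<Rightarrow> 'q"  (infixl \<open>\<oslash>\<close> 70)
    and e :: 'q  (\<open>\<epsilon>\<close>)
    and k n :: 'q +
  fixes \<phi> :: "'q \<Rightarrow> 'a" and M :: "('a, 'b) monoid_scheme" and z :: 'q and H :: "'q set"
  assumes M: "loop_copy mul ld rd e \<phi> M UNIV"
    and z: "z \<notin> nuc" "C u z = 0"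
    and H_nuc: "nuc \<subseteq> H" and H_mul: "u \<in> H \<Longrightarrow> v \<in> H \<Longrightarrow> u \<cdot> v \<in> H" and z_H: "z \<notin> H"
    and H_z: "u \<notin> H \<Longrightarrow> z \<cdot> u \<in> H"
begin

definition Q :: "'a monoid" where "Q = \<lparr>carrier = \<phi> ` H, mult = mult M, one = \<one>\<^bsub>M\<^esub>\<rparr>"

lemma coset_square: "coset (u \<cdot> (u \<cdot> v)) = coset v"
proof -
  have "coset ((u \<cdot> u) \<cdot> v) = coset (\<epsilon> \<cdot> v)" using square_nuc[of u] by (intro coset_mul) (simp_all add: coset_e)
  thus ?thesis using coset_assoc[of u u v] by simp
qed

lemma coset_ld: "coset (u \<setminus> v) = coset (u \<cdot> v)"
  using coset_square[of u v] coset_lcancel[of u "u \<setminus> v" "u \<cdot> v"] by simp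

lemma coset_rd: "coset (v \<oslash> u) = coset (u \<cdot> v)"
  using coset_square[of u v] coset_lcancel[of u "v \<oslash> u" "u \<cdot> v"] coset_comm[of u "v \<oslash> u"] by simp

lemma H_coset: "coset u = coset v \<Longrightarrow> u \<in> H \<Longrightarrow> v \<in> H"
  by (rule coset_closed[OF H_nuc H_mul])

lemma H_ld: "u \<in> H \<Longrightarrow> v \<in> H \<Longrightarrow> u \<setminus> v \<in> H"
  using H_coset[OF coset_ld[symmetric]] H_mul by blast

lemma H_rd: "u \<in> H \<Longrightarrow> v \<in> H \<Longrightarrow> u \<oslash> v \<in> H"
  using H_coset[OF coset_rd[symmetric]] H_mul by blast

lemma zu_H: "u \<in> H \<Longrightarrow> z \<cdot> u \<notin> H" using H_rd[of "z \<cdot> u" u] z_H by auto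

lemma z_ld_H: "u \<notin> H \<Longrightarrow> z \<setminus> u \<in> H" using H_coset[OF coset_ld[symmetric]] H_z by blast

lemma Q_copy: "buchsteiner_copy mul ld rd e \<phi> Q H"
proof -
  interpret M: loop_copy mul ld rd e \<phi> M UNIV by (rule M)
  show ?thesis
    by unfold_locales (use H_nuc M.\<phi>_inj in \<open>auto simp: Q_def H_mul H_ld H_rd\<close>)
qed

text \<open>As \<open>z\<close> lies in the radical of \<open>C\<close>, the commutator of
  \<open>u\<close> with \<open>z\<close> is a power of \<open>k\<close>. Its exponent
  \<open>kap u\<close> will be the value of \<open>q\<close>.\<close>

definition kap where "kap u = (if u \<cdot> z = z \<cdot> u then 0 else 1 :: bit)"

lemma kap: "u \<cdot> z = z \<cdot> u \<star> kap u"
proof -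
  obtain b where "(z \<cdot> u) \<setminus> (u \<cdot> z) = \<epsilon> \<star> b"
    by (rule lam_zero[OF commutator_nuc]) (use z(2)[of u] in \<open>simp add: C_def\<close>)
  hence "u \<cdot> z = z \<cdot> u \<star> b" by (simp add: ld_eq_iff)
  thus ?thesis by (cases b) (auto simp: kap_def)
qed

lemma beta_zz: "\<beta> z v z = \<beta> z z v" "\<beta> v z z = \<beta> z z v"
  using beta_rot[of z v z] beta_rot[of v z z] beta_rot[of z z v] by simp_all

lemma bit_cancel: "(a :: bit) + (b + (a + c)) = b + c" by (simp add: add.left_commute)

text \<open>Moving \<open>z\<close> past \<open>v\<close> and \<open>u\<close> in turn costs three
  associator bits, two of which agree by cyclic invariance and cancel. Thus the polarisation of
  \<open>kap\<close>, which is the \<open>g\<close> of the construction, is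
  \<open>\<beta> z\<close>.\<close>

lemma kap_mul: "kap (v \<cdot> u) = kap u + kap v + \<beta> z u v"
proof -
  have "(v \<cdot> u) \<cdot> z = z \<cdot> (v \<cdot> u) \<star> (\<beta> z v u + kap v + \<beta> v z u + kap u + \<beta> v u z)"
  proof -
    have "(v \<cdot> u) \<cdot> z = v \<cdot> (z \<cdot> u) \<star> (kap u + \<beta> v u z)" using assoc_beta[of v u z] kap[of u] by simp
    also have "v \<cdot> (z \<cdot> u) = (z \<cdot> v \<star> kap v) \<cdot> u \<star> \<beta> v z u"
      using assoc_beta[of v z u] kap[of v] by (simp add: ac_simps)
    finally show ?thesis using assoc_beta[of z v u] by (simp add: ac_simps)
  qed
  hence "kap (v \<cdot> u) = \<beta> z v u + kap v + \<beta> v z u + kap u + \<beta> v u z" using kap[of "v \<cdot> u"] by simp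
  moreover have "\<beta> v u z = \<beta> z v u" "\<beta> v z u = \<beta> z u v" by (metis beta_rot)+
  ultimately show ?thesis by (simp add: ac_simps)
qed

lemma gam: "kap (v \<cdot> u) + kap u + kap v = \<beta> z u v" by (simp add: kap_mul ac_simps)

lemma kap_sc [simp]: "kap (u \<star> b) = kap u" using kap[of u] kap[of "u \<star> b"] by (simp add: ac_simps)

abbreviation "d \<equiv> z \<cdot> z"

lemma d_nuc: "d \<in> nuc" by (rule square_nuc)

text \<open>This identifies the commutator map of \<open>d\<close>, the \<open>\<phi>\<close> of the
  construction, with \<open>\<beta> z z\<close>.\<close>

lemma d_comm: "d \<cdot> v = v \<cdot> d \<star> \<beta> z z v"
proof -
  have "d \<cdot> v = z \<cdot> (z \<cdot> v) \<star> \<beta> z z v" by (rule assoc_beta)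
  also have "z \<cdot> v = v \<cdot> z \<star> kap v" using kap[of v] by simp
  also have "z \<cdot> (v \<cdot> z \<star> kap v) = (z \<cdot> v) \<cdot> z \<star> (kap v + \<beta> z z v)"
    using assoc_beta[of z v z] by (simp add: beta_zz ac_simps)
  also have "z \<cdot> v = v \<cdot> z \<star> kap v" using kap[of v] by simp
  also have "(v \<cdot> z \<star> kap v) \<cdot> z = v \<cdot> d \<star> (kap v + \<beta> z z v)"
    using assoc_beta[of v z z] by (simp add: beta_zz ac_simps)
  finally show ?thesis by (simp add: ac_simps)
qed

text \<open>This lemma and the next two are the twisted clauses of the doubling, with
  \<open>q\<close>, \<open>g\<close> and \<open>\<phi>\<close> replaced by the exponents
  \<open>kap\<close>, \<open>\<beta> z\<close> and \<open>\<beta> z z\<close>.\<close>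

lemma mul_zl: "u \<cdot> (z \<cdot> v) = z \<cdot> (u \<cdot> v \<star> (kap u + \<beta> z u v + \<beta> z v u))"
proof -
  have "u \<cdot> (z \<cdot> v) = (u \<cdot> z) \<cdot> v \<star> \<beta> u z v" using assoc_beta[of u z v] by simp
  also have "(u \<cdot> z) \<cdot> v = z \<cdot> (u \<cdot> v) \<star> (\<beta> z u v + kap u)"
    using assoc_beta[of z u v] kap[of u] by simp
  finally show ?thesis using beta_rot[of u z v] by (simp add: ac_simps)
qed

lemma mul_zr: "(z \<cdot> u) \<cdot> v = z \<cdot> (u \<cdot> v \<star> \<beta> z u v)" using assoc_beta[of z u v] by simp

lemma mul_zz: "(z \<cdot> u) \<cdot> (z \<cdot> v) = d \<cdot> (u \<cdot> v) \<star> (\<beta> z z v + kap u + \<beta> z v u)"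
proof -
  have "(z \<cdot> u) \<cdot> z = d \<cdot> u \<star> kap u"
  proof -
    have "(z \<cdot> u) \<cdot> z = z \<cdot> (z \<cdot> u \<star> kap u) \<star> \<beta> z z u" using assoc_beta[of z u z] kap[of u] by (simp add: beta_zz)
    also have "\<dots> = d \<cdot> u \<star> kap u" using assoc_beta[of z z u] by (simp add: ac_simps)
    finally show ?thesis .
  qed
  hence "((z \<cdot> u) \<cdot> z) \<cdot> v = d \<cdot> (u \<cdot> v) \<star> kap u" by (simp add: nucD(1)[OF d_nuc])
  moreover have "\<beta> u z v = \<beta> z v u" by (rule beta_rot)
  ultimately have "(z \<cdot> u) \<cdot> (z \<cdot> v) \<star> (\<beta> z v u + \<beta> z z v) = d \<cdot> (u \<cdot> v) \<star> kap u"
    using assoc_beta[of "z \<cdot> u" z v] by (simp add: beta_mul1 ac_simps)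
  thus ?thesis unfolding sc_cancel[of "(z \<cdot> u) \<cdot> (z \<cdot> v)"] by (simp add: ac_simps)
qed

definition A where "A = range (\<lambda>b. \<epsilon> \<star> b)"
definition q where "q x = \<phi> (\<epsilon> \<star> kap (Hilbert_Choice.inv \<phi> x))"

lemma A_H: "\<epsilon> \<star> b \<in> H" using H_nuc e_sc_nuc by blast

text \<open>\<open>A\<close> is generated by \<open>k\<close>, and \<open>S\<close> is the nucleus
  of the whole loop. The numbered conditions come from trilinearity of \<open>\<beta>\<close>, its
  vanishing on nuclear arguments such as \<open>d\<close>, the formula \<open>kap_mul\<close>, and
  nuclearity of squares.\<close>

lemma doubling_data: "doubling_data Q (\<phi> ` A) (\<phi> ` nuc) (\<phi> d) q"
proof -
  interpret Q: buchsteiner_copy mul ld rd e \<phi> Q H by (rule Q_copy)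
  note [simp] = H_mul A_H
  have q [simp]: "q (\<phi> u) = \<phi> (\<epsilon> \<star> kap u)" for u by (simp add: q_def Q.\<phi>_inj)
  have dH [simp]: "d \<in> H" using d_nuc H_nuc by blast
  have phi [simp]: "dbl_phi Q (\<phi> d) (\<phi> u) = \<phi> (\<epsilon> \<star> \<beta> z z u)" if "u \<in> H" for u
  proof -
    have "(u \<cdot> d) \<setminus> (d \<cdot> u) = \<epsilon> \<star> \<beta> z z u" by (subst d_comm) (simp add: ld_eq_iff)
    thus ?thesis using that by (simp add: dbl_phi_def loop_commutator_def)
  qed
  have g [simp]: "dbl_g Q q (\<phi> u) (\<phi> v) = \<phi> (\<epsilon> \<star> \<beta> z u v)" for u v
    using gam[of v u] by (simp add: dbl_g_def ac_simps)
  have cj_e_sc: "cj v (\<epsilon> \<star> b) = \<epsilon> \<star> b" "ci v (\<epsilon> \<star> b) = \<epsilon> \<star> b" for v b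
    by (simp_all add: cj_def ci_def)
  have [simp]: "\<epsilon> \<oslash> (\<epsilon> \<star> b) = \<epsilon> \<star> b" for b by (simp add: rd_eq_iff)
  have [simp]: "\<epsilon> \<in> range ((\<star>) \<epsilon>)" by (rule range_eqI[of _ _ 0]) simp
  have nA: "normal_subloop (\<phi> ` A) Q"
    by (rule Q.normal_copy) (use A_H e_sc_nuc in \<open>auto simp: A_def cj_e_sc\<close>)
  have nuc_div: "a \<setminus> b \<in> nuc" "b \<oslash> a \<in> nuc" if "a \<in> nuc" "b \<in> nuc" for a b
  proof -
    have "coset (a \<cdot> b) = coset \<epsilon>" using that by (simp add: coset_e nuc_mul)
    thus "a \<setminus> b \<in> nuc" "b \<oslash> a \<in> nuc" by (simp_all add: coset_ld coset_rd flip: coset_e)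
  qed
  have nS: "normal_subloop (\<phi> ` nuc) Q"
  proof (rule Q.normal_copy[OF subset_refl H_nuc])
    show "cj v b \<in> nuc \<and> ci v b \<in> nuc" if "b \<in> nuc" for b v
      using that by (simp add: cj_nuc ci_nuc)
  qed (simp_all add: nuc_mul nuc_div)
  have A_bool: "boolean_group (Q\<lparr>carrier := \<phi> ` A\<rparr>)"
    unfolding boolean_group_def
  proof
    show "group (Q\<lparr>carrier := \<phi> ` A\<rparr>)"
    proof (rule groupI)
      fix x assume "x \<in> carrier (Q\<lparr>carrier := \<phi> ` A\<rparr>)"
      then obtain b where "x = \<phi> (\<epsilon> \<star> b)" by (auto simp: A_def)
      thus "\<exists>y\<in>carrier (Q\<lparr>carrier := \<phi> ` A\<rparr>). y \<otimes>\<^bsub>Q\<lparr>carrier := \<phi> ` A\<rparr>\<^esub> x = \<one>\<^bsub>Q\<lparr>carrier := \<phi> ` A\<rparr>\<^esub>"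
        by (intro bexI[of _ x]) (auto simp: A_def)
    qed (auto simp: A_def ac_simps)
  qed (auto simp: A_def)
  have rc: "(\<phi> ` nuc) #>\<^bsub>Q\<^esub> \<phi> u = \<phi> ` coset u" for u
  proof -
    have "(\<lambda>b. b \<cdot> u) ` nuc = coset u"
    proof (intro equalityI subsetI)
      fix t assume "t \<in> (\<lambda>b. b \<cdot> u) ` nuc"
      then obtain b where "b \<in> nuc" "t = b \<cdot> u" by blast
      thus "t \<in> coset u" unfolding coset_def by (intro image_eqI[of _ _ "cj u b"]) (simp_all add: cj_def nuc_conj)
    next
      fix t assume "t \<in> coset u"
      then obtain b where "b \<in> nuc" "t = u \<cdot> b" by (auto simp: coset_def)
      thus "t \<in> (\<lambda>b. b \<cdot> u) ` nuc" by (intro image_eqI[of _ _ "ci u b"]) (simp_all add: ci_def nuc_conj')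
    qed
    thus ?thesis by (simp add: Q.rcoset_M)
  qed
  have sm: "\<phi> ` coset u <#>\<^bsub>Q\<^esub> \<phi> ` coset v = \<phi> ` coset (u \<cdot> v)" for u v
  proof -
    have "coset (u \<cdot> v) = {a \<cdot> b | a b. a \<in> coset u \<and> b \<in> coset v}"
    proof (intro equalityI subsetI)
      fix t assume "t \<in> coset (u \<cdot> v)"
      then obtain m where m: "m \<in> nuc" "t = u \<cdot> (v \<cdot> m)" by (auto simp: coset_def nucD(3))
      moreover have "v \<cdot> m \<in> coset v" using m by (simp add: coset_def)
      ultimately show "t \<in> {a \<cdot> b | a b. a \<in> coset u \<and> b \<in> coset v}" using coset_self by blast
    next
      fix t assume "t \<in> {a \<cdot> b | a b. a \<in> coset u \<and> b \<in> coset v}"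
      then obtain a b where t: "t = a \<cdot> b" "a \<in> coset u" "b \<in> coset v" by blast
      have "coset u = coset a" "coset v = coset b" using t unfolding coset_eq by (auto simp: coset_def)
      hence "coset (u \<cdot> v) = coset t" unfolding t by (rule coset_mul)
      thus "t \<in> coset (u \<cdot> v)" using coset_self by simp
    qed
    thus ?thesis by (auto simp: set_mult_def)
  qed
  have ce: "coset \<epsilon> = nuc" by (simp add: coset_def)
  have fc: "carrier (Q Mod \<phi> ` nuc) = {\<phi> ` coset u | u. u \<in> H}"
    by (auto simp: FactGroup_def RCOSETS_def Q.carrier_M rc)
  have fm: "mult (Q Mod \<phi> ` nuc) = set_mult Q" "\<one>\<^bsub>Q Mod \<phi> ` nuc\<^esub> = \<phi> ` nuc"
    by (simp_all add: FactGroup_def)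
  have sq: "coset (u \<cdot> u) = nuc" for u using coset_e[of "u \<cdot> u"] square_nuc[of u] by (simp add: ce)
  have S_bool: "boolean_group (Q Mod \<phi> ` nuc)"
    unfolding boolean_group_def
  proof
    show "group (Q Mod \<phi> ` nuc)"
    proof (rule groupI)
      fix x assume "x \<in> carrier (Q Mod \<phi> ` nuc)"
      thus "\<exists>y\<in>carrier (Q Mod \<phi> ` nuc). y \<otimes>\<^bsub>Q Mod \<phi> ` nuc\<^esub> x = \<one>\<^bsub>Q Mod \<phi> ` nuc\<^esub>"
        by (intro bexI[of _ x]) (auto simp: fc fm sm sq)
    next
      show "\<one>\<^bsub>Q Mod \<phi> ` nuc\<^esub> \<in> carrier (Q Mod \<phi> ` nuc)"
        using Q.H_e by (auto simp: fc fm ce intro!: exI[of _ \<epsilon>])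
      show "\<one>\<^bsub>Q Mod \<phi> ` nuc\<^esub> \<otimes>\<^bsub>Q Mod \<phi> ` nuc\<^esub> x = x" if "x \<in> carrier (Q Mod \<phi> ` nuc)" for x
        using that sm[of \<epsilon>] by (auto simp: fc fm ce)
    qed (auto simp: fc fm sm coset_assoc)
  qed (auto simp: fc fm sm sq)
  have bz: "\<beta> z u m = 0" "\<beta> z m u = 0" if "m \<in> nuc" for u m using that by (simp_all add: beta_nuc)
  have central: "\<phi> (\<epsilon> \<star> b) \<in> loop_centre Q" for b
    unfolding loop_centre_def using Q.nucleus_M[OF e_sc_nuc A_H] by (auto simp: Q.carrier_M)
  show ?thesis
    unfolding doubling_data_def doubling_data_axioms_def
  proof (intro conjI Q.is_loop nA nS A_bool S_bool)
    show "\<phi> d \<in> nucleus Q" by (rule Q.nucleus_M[OF d_nuc dH])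
    show "q \<in> carrier Q \<rightarrow> \<phi> ` A" by (auto simp: Q.carrier_M A_def)
    show "\<phi> ` A \<subseteq> \<phi> ` nuc \<inter> loop_centre Q" using central e_sc_nuc by (auto simp: A_def)
  qed (use H_nuc in \<open>auto simp: Q.carrier_M A_def beta_mul1 beta_mul2 beta_mul3 bz kap_mul d_nuc ac_simps subset_iff\<close>)
qed

lemma doubling_iso: "M \<cong> doubling Q (\<phi> d) q"
proof -
  interpret M: loop_copy mul ld rd e \<phi> M UNIV by (rule M)
  interpret Q: buchsteiner_copy mul ld rd e \<phi> Q H by (rule Q_copy)
  note [simp] = H_mul A_H
  have q [simp]: "q (\<phi> u) = \<phi> (\<epsilon> \<star> kap u)" for u by (simp add: q_def Q.\<phi>_inj)
  have dH [simp]: "d \<in> H" using d_nuc H_nuc by blast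
  have phi [simp]: "dbl_phi Q (\<phi> d) (\<phi> u) = \<phi> (\<epsilon> \<star> \<beta> z z u)" if "u \<in> H" for u
  proof -
    have "(u \<cdot> d) \<setminus> (d \<cdot> u) = \<epsilon> \<star> \<beta> z z u" by (subst d_comm) (simp add: ld_eq_iff)
    thus ?thesis using that by (simp add: dbl_phi_def loop_commutator_def)
  qed
  have g [simp]: "dbl_g Q q (\<phi> u) (\<phi> v) = \<phi> (\<epsilon> \<star> \<beta> z u v)" for u v
    using gam[of v u] by (simp add: dbl_g_def ac_simps)
  \<comment> \<open>Since \<open>H\<close> has index two, an element outside it is
    \<open>z \<cdot> u\<close> for a unique \<open>u\<close> in \<open>H\<close>, namely
    \<open>z \<setminus> t\<close>.\<close>
  define \<theta> where "\<theta> x = (let t = Hilbert_Choice.inv \<phi> x in if t \<in> H then Inl x else Inr (\<phi> (z \<setminus> t)))" for x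
  have \<theta>l: "\<theta> (\<phi> u) = Inl (\<phi> u)" and \<theta>r: "\<theta> (\<phi> (z \<cdot> u)) = Inr (\<phi> u)" if "u \<in> H" for u
    using that zu_H[OF that] by (simp_all add: \<theta>_def M.\<phi>_inj)
  have split: "t \<in> H \<or> (\<exists>u\<in>H. t = z \<cdot> u)" for t
    using z_ld_H[of t] by (metis mul_ld)
  have scH: "u \<star> b \<in> H" if "u \<in> H" for u b using H_mul[OF that A_H[of b]] by simp
  have "\<theta> (\<phi> (s \<cdot> t)) = doubling_mult Q (\<phi> d) q (\<theta> (\<phi> s)) (\<theta> (\<phi> t))" for s t
  proof -
    consider (1) "s \<in> H" "t \<in> H" | (2) v where "s \<in> H" "v \<in> H" "t = z \<cdot> v"
      | (3) u where "t \<in> H" "u \<in> H" "s = z \<cdot> u" | (4) u v where "u \<in> H" "v \<in> H" "s = z \<cdot> u" "t = z \<cdot> v"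
      using split[of s] split[of t] by blast
    thus ?thesis
    proof cases
      case 1
      thus ?thesis by (simp add: \<theta>l)
    next
      case 2
      have "\<theta> (\<phi> (s \<cdot> t)) = Inr (\<phi> (s \<cdot> v \<star> (kap s + \<beta> z s v + \<beta> z v s)))"
        unfolding 2(3) mul_zl by (rule \<theta>r) (simp add: 2 scH)
      thus ?thesis using 2 by (simp add: \<theta>l \<theta>r)
    next
      case 3
      have "\<theta> (\<phi> (s \<cdot> t)) = Inr (\<phi> (u \<cdot> t \<star> \<beta> z u t))"
        unfolding 3(3) mul_zr by (rule \<theta>r) (simp add: 3 scH)
      thus ?thesis using 3 by (simp add: \<theta>l \<theta>r)
    next
      case 4
      have "\<theta> (\<phi> (s \<cdot> t)) = Inl (\<phi> (d \<cdot> (u \<cdot> v) \<star> (\<beta> z z v + kap u + \<beta> z v u)))"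
        unfolding 4(3,4) mul_zz by (rule \<theta>l) (simp add: 4 scH)
      thus ?thesis using 4 by (simp add: \<theta>r)
    qed
  qed
  moreover have \<theta>c: "\<theta> (\<phi> t) \<in> carrier Q <+> carrier Q" for t
    using split[of t] by (auto simp: \<theta>l \<theta>r)
  ultimately have "\<theta> \<in> hom M (doubling Q (\<phi> d) q)"
    by (auto simp: hom_def doubling_def M.carrier_M)
  moreover have "bij_betw \<theta> (carrier M) (carrier (doubling Q (\<phi> d) q))"
    unfolding bij_betw_def
  proof
    have "s = t" if "\<theta> (\<phi> s) = \<theta> (\<phi> t)" for s t
      using that split[of s] split[of t] by (auto simp: \<theta>l \<theta>r)
    thus "inj_on \<theta> (carrier M)" by (auto simp: inj_on_def M.carrier_M)
    have "Inl (\<phi> u) \<in> \<theta> ` carrier M" "Inr (\<phi> u) \<in> \<theta> ` carrier M" if "u \<in> H" for u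
      using \<theta>l[OF that] \<theta>r[OF that] by (metis M.\<phi>_mem UNIV_I image_eqI)+
    thus "\<theta> ` carrier M = carrier (doubling Q (\<phi> d) q)"
      using \<theta>c by (auto simp: doubling_def M.carrier_M Q.carrier_M)
  qed
  ultimately show ?thesis by (auto simp: is_iso_def iso_def)
qed

end

section \<open>From the record \<open>P\<close> to total operations, and the conclusion\<close>

context loop begin

lemma ldiv_closed: "x \<in> carrier Q \<Longrightarrow> y \<in> carrier Q \<Longrightarrow> ldiv Q x y \<in> carrier Q"
  and mult_ldiv: "x \<in> carrier Q \<Longrightarrow> y \<in> carrier Q \<Longrightarrow> x \<otimes> ldiv Q x y = y"
  using theI'[OF ldiv_ex1] unfolding ldiv_def by blast+

lemma rdiv_closed: "x \<in> carrier Q \<Longrightarrow> y \<in> carrier Q \<Longrightarrow> rdiv Q y x \<in> carrier Q"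
  and rdiv_mult: "x \<in> carrier Q \<Longrightarrow> y \<in> carrier Q \<Longrightarrow> rdiv Q y x \<otimes> x = y"
  using theI'[OF rdiv_ex1] unfolding rdiv_def by blast+

lemma ldiv_mult: "x \<in> carrier Q \<Longrightarrow> y \<in> carrier Q \<Longrightarrow> ldiv Q x (x \<otimes> y) = y"
  unfolding ldiv_def by (rule the1_equality[OF ldiv_ex1]) (simp_all add: m_closed)

lemma mult_rdiv: "x \<in> carrier Q \<Longrightarrow> y \<in> carrier Q \<Longrightarrow> rdiv Q (y \<otimes> x) x = y"
  unfolding rdiv_def by (rule the1_equality[OF rdiv_ex1]) (simp_all add: m_closed)

end

theorem corollary6p4:
  fixes P :: "('a, 'b) monoid_scheme"
  assumes "buchsteiner_loop P"
    and "order P = 32"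
    and "\<not> conjugacy_closed P"
  shows "\<exists>(Q :: 'a monoid) A S d q.
    buchsteiner_loop Q \<and> doubling_data Q A S d q \<and> P \<cong> doubling Q d q"
proof -
  interpret P: buchsteiner_loop P by (rule assms(1))
  have card: "card (carrier P) = 32" using assms(2) by (simp add: order_def)
  have "finite (carrier P)" by (rule card_ge_0_finite) (simp add: card)
  \<comment> \<open>\<open>P\<close> is reindexed by a type with exactly 32 elements, on which its
    operations are total.\<close>
  moreover have "card (UNIV :: (bool \<times> bool \<times> bool \<times> bool \<times> bool) set) = card (carrier P)"
    by (simp add: card card_UNIV_prod)
  ultimately obtain \<phi> :: "bool \<times> bool \<times> bool \<times> bool \<times> bool \<Rightarrow> 'a" where \<phi>: "bij_betw \<phi> UNIV (carrier P)"
    using finite_same_card_bij[OF finite_UNIV] by blast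
  define \<psi> where "\<psi> = Hilbert_Choice.inv \<phi>"
  have inj: "inj \<phi>" and ran: "carrier P = range \<phi>" using \<phi> by (simp_all add: bij_betw_def)
  have \<psi>\<phi> [simp]: "\<psi> (\<phi> t) = t" for t by (simp add: \<psi>_def inj)
  have \<phi>\<psi> [simp]: "\<phi> (\<psi> x) = x" if "x \<in> carrier P" for x using that by (auto simp: ran)
  have \<phi>c [simp]: "\<phi> t \<in> carrier P" for t by (simp add: ran)
  note [simp] = P.m_closed P.one_closed P.l_one P.r_one P.ldiv_closed P.rdiv_closed
    P.mult_ldiv P.ldiv_mult P.rdiv_mult P.mult_rdiv
  define mul where "mul u v = \<psi> (\<phi> u \<otimes>\<^bsub>P\<^esub> \<phi> v)" for u v
  define ld where "ld u v = \<psi> (ldiv P (\<phi> u) (\<phi> v))" for u v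
  define rd where "rd u v = \<psi> (rdiv P (\<phi> u) (\<phi> v))" for u v
  define e where "e = \<psi> \<one>\<^bsub>P\<^esub>"
  have B: "total_buchsteiner mul ld rd e"
    by unfold_locales (simp_all add: mul_def ld_def rd_def e_def P.buchsteiner)
  interpret nuclear_buchsteiner mul ld rd e
    by (intro nuclear_buchsteiner.intro nuclear_buchsteiner_axioms.intro B buchsteiner_ass_nuc_32[OF B] finite_UNIV)
  have copy: "loop_copy mul ld rd e \<phi> P UNIV"
    by (intro loop_copy.intro loop_copy_axioms.intro total_loop_axioms inj)
      (simp_all add: ran mul_def e_def flip: ran)
  \<comment> \<open>Properness enters only here, as a failure of symmetry of the associator.\<close>
  obtain x y z where ne: "ass x y z \<noteq> ass y x z"
    using conjugacy_closed_copy[OF copy] assms(3) by blast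
  have "card (UNIV :: (bool \<times> bool \<times> bool \<times> bool \<times> bool) set) = 32" by (simp add: card_UNIV_prod)
  then obtain k n where N: "four_nucleus mul ld rd e k n"
    by (rule four_nucleus_if_proper[OF _ ne])
  obtain z where z: "z \<notin> nuc" "\<And>u. four_nucleus.C mul ld e k u z = 0"
    by (rule four_nucleus.radical[OF N]) (rule that)
  obtain H where H: "nuc \<subseteq> H" "\<And>x y. x \<in> H \<Longrightarrow> y \<in> H \<Longrightarrow> mul x y \<in> H" "z \<notin> H" "\<And>u. u \<notin> H \<Longrightarrow> mul z u \<in> H"
    by (rule four_nucleus.complement[OF N z(1)]) (rule that)
  have D: "doubling_copy mul ld rd e k n \<phi> P z H"
    by (intro doubling_copy.intro doubling_copy_axioms.intro N copy z H)
  show ?thesis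
    using buchsteiner_copy.is_buchsteiner[OF doubling_copy.Q_copy[OF D]]
      doubling_copy.doubling_data[OF D] doubling_copy.doubling_iso[OF D] by blast
qed

end
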